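(* Let $\mathbb{F}$ be an algebraically closed field, $d\ge3$, and let $A,A^*$ be a zero-diagonal TD-TD pair in $\mathrm{Mat}_{d+1}(\mathbb{F})$ that is a Leonard pair (acting on $\mathbb{F}^{d+1}$), with fundamental parameter $\beta$. Then: (i) If $\beta=2$, there exist nonzero $\xi,\xi^*\in\mathbb{F}$ such that $\xi A,\xi^*A^*$ is equivalent to a pair belonging to family K. (ii) If $\beta=-2$, there exist nonzero $\xi,\xi^*\in\mathbb{F}$ such that $\xi A,\xi^*A^*$ is equivalent to a pair belonging to family BI. (iii) If $\beta\ne2$ and $\beta\neq-2$, there exist nonzero $\xi,\xi^*\in\mathbb{F}$ such that $\xi A,\xi^*A^*$ or its anti-diagonal transpose is equivalent to a pair belonging to one of the families C, LT, E.
   Context: Matrices in $\mathrm{Mat}_{d+1}(\mathbb{F})$ have rows/columns indexed $0,\dots,d$ and act on $\mathbb{F}^{d+1}$ by left multiplication. A matrix is zero-diagonal TD if it is tridiagonal with all diagonal entries $0$ and all subdiagonal and superdiagonal entries nonzero; a zero-diagonal TD-TD pair is a pair of such matrices. A Leonard pair in $\mathrm{Mat}_{d+1}(\mathbb{F})$ is a pair $A,A^*$ of matrices such that there is a basis of $\mathbb{F}^{d+1}$ in which $A$ is irreducible tridiagonal and $A^*$ diagonal, and one in which $A^*$ is irreducible tridiagonal and $A$ diagonal. A Leonard system is $(A,\{E_i\}_{i=0}^d,A^*,\{E^*_i\}_{i=0}^d)$ with $A,A^*$ each having $d+1$ distinct eigenvalues, $\{E_i\},\{E^*_i\}$ orderings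 of their primitive idempotents with $E_iA^*E_j,E^*_iAE^*_j$ zero for $|i-j|>1$ and nonzero for $|i-j|=1$; each Leonard pair has associated Leonard systems; $AE_i=\theta_iE_i$. The fundamental parameter $\beta$ is one less than the common value of $(\theta_{i-2}-\theta_{i+1})/(\theta_{i-1}-\theta_i)$, $2\le i\le d-1$. Two zero-diagonal TD-TD pairs $A,A^*$ and $B,B^*$ are equivalent if there is an invertible diagonal $D$ with $B=D^{-1}AD$, $B^*=D^{-1}A^*D$. The anti-diagonal transpose of a matrix $M$ is $Z^{-1}M^{\mathsf T}Z$, where $Z_{i,j}=\delta_{i,d-j}$; the anti-diagonal transpose of the pair $A,A^*$ is the pair of anti-diagonal transposes. Notation $T(x,y,z)$: for nonzero $x_i,y_i,z_i$ ($1\le i\le d$), the pair $A,A^*$ with zero diagonals, $A_{i,i-1}=1$, $A_{i-1,i}=z_i$, $A^*_{i,i-1}=x_i$, $A^*_{i-1,i}=y_iz_i$, other entries $0$. Families (a pair "belongs to" a family if it equals $T(x,y,z)$ for some admissible parameters): K: $s\neq0$, $\mathrm{Char}(\mathbb{F})$ $0$ or $>d$, $s^2\ne1$; $x_i=s$, $y_i=s^{-1}$, $z_i=i(d-i+1)$. BI: $d$ even, $\tau\in\mathbb{F}$, $\epsilon\in\{\pm1\}$, $\mathrm{Char}(\mathbb{F})$ $0$ or $>d$, $\tau\notin\{1-d,3-d,\dots,d-1\}$; $x_i=y_i=(-1)^{i-1}\epsilon$; $z_i=i(d-i+1-\epsilon\tau)$ ($i$ even), $z_i=(d-i+1)(i+\epsilon\tau)$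 ($i$ odd). For C, LT, E: nonzero $q,s$ with $q^i\ne1$ ($1\le i\le d$), $q^i\neq-1$ ($0\le i\le d-1$), $s^2\neq q^{2i}$ ($0\le i\le d-1$). C: $x_i=sq^{1-i}$, $y_i=s^{-1}q^{d-i}$, $z_i=q^{i-1}(q^i-1)(q^{d-i+1}-1)$. LT: additionally $s^2\neq q^i$ for $0\le i\le 2d-2$; $x_i=sq^{1-i}$, $y_i=s^{-1}q^{i-1}$, $z_1=\frac{(q-1)(q^d-1)(s^2-q^d)}{s^2-q}$, $z_i=\frac{q^{i-1}(q^i-1)(q^{d-i+1}-1)(s^2-q^{i-2})(s^2-q^{d+i-1})}{(s^2-q^{2i-3})(s^2-q^{2i-1})}$ ($2\le i\le d-1$), $z_d=\frac{q^{d-1}(q-1)(q^d-1)(s^2-q^{d-2})}{s^2-q^{2d-3}}$. E: additionally $d$ even; $x_i=y_i=sq^{1-i}$; $z_i=q^d(q^i-1)(1-s^{-2}q^{i-2})$ ($i$ even), $z_i=-q^{i-1}(q^{d-i+1}-1)(1-s^{-2}q^{d+i-1})$ ($i$ odd). *)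

theory Defs
  imports "HOL-Computational_Algebra.Polynomial" "Jordan_Normal_Form.Matrix"
begin

definition tridiag_mat :: "nat \<Rightarrow> 'a::field mat \<Rightarrow> bool" where
  "tridiag_mat d M \<longleftrightarrow> M \<in> carrier_mat (d+1) (d+1) \<and>
     (\<forall>i\<le>d. \<forall>j\<le>d. (i > j + 1 \<or> j > i + 1) \<longrightarrow> M $$ (i,j) = 0)"

definition irred_tridiag_mat :: "nat \<Rightarrow> 'a::field mat \<Rightarrow> bool" where
  "irred_tridiag_mat d M \<longleftrightarrow> tridiag_mat d M \<and>
     (\<forall>i. 1 \<le> i \<and> i \<le> d \<longrightarrow> M $$ (i, i-1) \<noteq> 0 \<and> M $$ (i-1, i) \<noteq> 0)"

definition zero_diag_TD :: "nat \<Rightarrow> 'a::field mat \<Rightarrow> bool" where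
  "zero_diag_TD d M \<longleftrightarrow> irred_tridiag_mat d M \<and> (\<forall>i\<le>d. M $$ (i,i) = 0)"

definition zero_diag_TD_TD_pair :: "nat \<Rightarrow> 'a::field mat \<Rightarrow> 'a mat \<Rightarrow> bool" where
  "zero_diag_TD_TD_pair d A As \<longleftrightarrow> zero_diag_TD d A \<and> zero_diag_TD d As"

text \<open>A basis of F^{d+1} is given by the columns of an invertible matrix P; the matrix
  of M in that basis is P^{-1} M P.\<close>

definition leonard_pair :: "nat \<Rightarrow> 'a::field mat \<Rightarrow> 'a mat \<Rightarrow> bool" where
  "leonard_pair d A As \<longleftrightarrow> A \<in> carrier_mat (d+1) (d+1) \<and> As \<in> carrier_mat (d+1) (d+1) \<and>
     (\<exists>P Q. P \<in> carrier_mat (d+1) (d+1) \<and> Q \<in> carrier_mat (d+1) (d+1) \<and>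
        P * Q = 1\<^sub>m (d+1) \<and> Q * P = 1\<^sub>m (d+1) \<and>
        irred_tridiag_mat d (Q * A * P) \<and> diagonal_mat (Q * As * P)) \<and>
     (\<exists>P Q. P \<in> carrier_mat (d+1) (d+1) \<and> Q \<in> carrier_mat (d+1) (d+1) \<and>
        P * Q = 1\<^sub>m (d+1) \<and> Q * P = 1\<^sub>m (d+1) \<and>
        irred_tridiag_mat d (Q * As * P) \<and> diagonal_mat (Q * A * P))"

definition prim_idempotents :: "nat \<Rightarrow> 'a::field mat \<Rightarrow> (nat \<Rightarrow> 'a mat) \<Rightarrow> (nat \<Rightarrow> 'a) \<Rightarrow> bool" where
  "prim_idempotents d A E th \<longleftrightarrow> A \<in> carrier_mat (d+1) (d+1) \<and>
     inj_on th {0..d} \<and>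
     (\<forall>i\<le>d. E i \<in> carrier_mat (d+1) (d+1) \<and> E i \<noteq> 0\<^sub>m (d+1) (d+1) \<and> A * E i = th i \<cdot>\<^sub>m E i) \<and>
     (\<forall>i\<le>d. \<forall>j\<le>d. E i * E j = (if i = j then E i else 0\<^sub>m (d+1) (d+1))) \<and>
     foldr (+) (map E [0..<d+1]) (0\<^sub>m (d+1) (d+1)) = 1\<^sub>m (d+1)"

definition leonard_system :: "nat \<Rightarrow> 'a::field mat \<Rightarrow> (nat \<Rightarrow> 'a mat) \<Rightarrow> 'a mat \<Rightarrow> (nat \<Rightarrow> 'a mat)
     \<Rightarrow> (nat \<Rightarrow> 'a) \<Rightarrow> (nat \<Rightarrow> 'a) \<Rightarrow> bool" where
  "leonard_system d A E As Es th ths \<longleftrightarrow>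
     prim_idempotents d A E th \<and> prim_idempotents d As Es ths \<and>
     (\<forall>i\<le>d. \<forall>j\<le>d. (i > j + 1 \<or> j > i + 1) \<longrightarrow>
         E i * As * E j = 0\<^sub>m (d+1) (d+1) \<and> Es i * A * Es j = 0\<^sub>m (d+1) (d+1)) \<and>
     (\<forall>i\<le>d. \<forall>j\<le>d. (i = j + 1 \<or> j = i + 1) \<longrightarrow>
         E i * As * E j \<noteq> 0\<^sub>m (d+1) (d+1) \<and> Es i * A * Es j \<noteq> 0\<^sub>m (d+1) (d+1))"

definition fundamental_parameter :: "nat \<Rightarrow> 'a::field mat \<Rightarrow> 'a mat \<Rightarrow> 'a \<Rightarrow> bool" where
  "fundamental_parameter d A As \<beta> \<longleftrightarrow>
     (\<exists>E Es th ths. leonard_system d A E As Es th ths \<and>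
        (\<forall>i. 2 \<le> i \<and> i \<le> d - 1 \<longrightarrow>
            (th (i-2) - th (i+1)) / (th (i-1) - th i) = \<beta> + 1))"

definition diag_equiv :: "nat \<Rightarrow> 'a::field mat \<times> 'a mat \<Rightarrow> 'a mat \<times> 'a mat \<Rightarrow> bool" where
  "diag_equiv d AA BB \<longleftrightarrow>
     (\<exists>D Di. D \<in> carrier_mat (d+1) (d+1) \<and> Di \<in> carrier_mat (d+1) (d+1) \<and> diagonal_mat D \<and>
        D * Di = 1\<^sub>m (d+1) \<and> Di * D = 1\<^sub>m (d+1) \<and>
        fst BB = Di * fst AA * D \<and> snd BB = Di * snd AA * D)"

definition Zmat :: "nat \<Rightarrow> 'a::field mat" where
  "Zmat d = mat (d+1) (d+1) (\<lambda>(i,j). if i = d - j then 1 else 0)"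

definition antidiag_transpose :: "nat \<Rightarrow> 'a::field mat \<Rightarrow> 'a mat" where
  "antidiag_transpose d M = (THE Zi. Zi \<in> carrier_mat (d+1) (d+1) \<and>
      Zi * Zmat d = 1\<^sub>m (d+1) \<and> Zmat d * Zi = 1\<^sub>m (d+1)) * transpose_mat M * Zmat d"

definition antidiag_transpose_pair :: "nat \<Rightarrow> 'a::field mat \<times> 'a mat \<Rightarrow> 'a mat \<times> 'a mat" where
  "antidiag_transpose_pair d AA = (antidiag_transpose d (fst AA), antidiag_transpose d (snd AA))"

definition Tpair :: "nat \<Rightarrow> (nat \<Rightarrow> 'a::field) \<Rightarrow> (nat \<Rightarrow> 'a) \<Rightarrow> (nat \<Rightarrow> 'a) \<Rightarrow> 'a mat \<times> 'a mat" where
  "Tpair d x y z =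
     (mat (d+1) (d+1) (\<lambda>(i,j). if i = j + 1 then 1 else if j = i + 1 then z j else 0),
      mat (d+1) (d+1) (\<lambda>(i,j). if i = j + 1 then x i else if j = i + 1 then y j * z j else 0))"

definition char_ok :: "nat \<Rightarrow> 'a::field itself \<Rightarrow> bool" where
  "char_ok d _ \<longleftrightarrow> CHAR('a) = 0 \<or> CHAR('a) > d"

definition family_K :: "nat \<Rightarrow> 'a::field mat \<times> 'a mat \<Rightarrow> bool" where
  "family_K d AA \<longleftrightarrow> (\<exists>s::'a. s \<noteq> 0 \<and> char_ok d TYPE('a) \<and> s^2 \<noteq> 1 \<and>
     AA = Tpair d (\<lambda>i. s) (\<lambda>i. inverse s) (\<lambda>i. of_nat (i * (d - i + 1))))"

definition family_BI :: "nat \<Rightarrow> 'a::field mat \<times> 'a mat \<Rightarrow> bool" where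
  "family_BI d AA \<longleftrightarrow> (\<exists>(\<tau>::'a) (\<epsilon>::'a). even d \<and> (\<epsilon> = 1 \<or> \<epsilon> = -1) \<and> char_ok d TYPE('a) \<and>
     (\<forall>k<d. \<tau> \<noteq> of_int (2 * int k + 1 - int d)) \<and>
     AA = Tpair d (\<lambda>i. (-1)^(i-1) * \<epsilon>) (\<lambda>i. (-1)^(i-1) * \<epsilon>)
       (\<lambda>i. if even i then of_nat i * (of_nat (d - i + 1) - \<epsilon> * \<tau>)
            else of_nat (d - i + 1) * (of_nat i + \<epsilon> * \<tau>)))"

definition q_cond :: "nat \<Rightarrow> 'a::field \<Rightarrow> 'a \<Rightarrow> bool" where
  "q_cond d q s \<longleftrightarrow> q \<noteq> 0 \<and> s \<noteq> 0 \<and> (\<forall>i. 1 \<le> i \<and> i \<le> d \<longrightarrow> q^i \<noteq> 1) \<and>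
     (\<forall>i<d. q^i \<noteq> -1) \<and> (\<forall>i<d. s^2 \<noteq> q^(2*i))"

definition family_C :: "nat \<Rightarrow> 'a::field mat \<times> 'a mat \<Rightarrow> bool" where
  "family_C d AA \<longleftrightarrow> (\<exists>q s::'a. q_cond d q s \<and>
     AA = Tpair d (\<lambda>i. s * q powi (1 - int i)) (\<lambda>i. inverse s * q^(d-i))
       (\<lambda>i. q^(i-1) * (q^i - 1) * (q^(d-i+1) - 1)))"

definition family_LT :: "nat \<Rightarrow> 'a::field mat \<times> 'a mat \<Rightarrow> bool" where
  "family_LT d AA \<longleftrightarrow> (\<exists>q s::'a. q_cond d q s \<and> (\<forall>i. i \<le> 2*d - 2 \<longrightarrow> s^2 \<noteq> q^i) \<and>
     AA = Tpair d (\<lambda>i. s * q powi (1 - int i)) (\<lambda>i. inverse s * q^(i-1))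
       (\<lambda>i. if i = 1 then (q - 1) * (q^d - 1) * (s^2 - q^d) / (s^2 - q)
            else if i = d then q^(d-1) * (q - 1) * (q^d - 1) * (s^2 - q^(d-2)) / (s^2 - q^(2*d-3))
            else q^(i-1) * (q^i - 1) * (q^(d-i+1) - 1) * (s^2 - q^(i-2)) * (s^2 - q^(d+i-1))
                 / ((s^2 - q^(2*i-3)) * (s^2 - q^(2*i-1)))))"

definition family_E :: "nat \<Rightarrow> 'a::field mat \<times> 'a mat \<Rightarrow> bool" where
  "family_E d AA \<longleftrightarrow> (\<exists>q s::'a. q_cond d q s \<and> even d \<and>
     AA = Tpair d (\<lambda>i. s * q powi (1 - int i)) (\<lambda>i. s * q powi (1 - int i))
       (\<lambda>i. if even i then q^d * (q^i - 1) * (1 - inverse (s^2) * q^(i-2))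
            else - (q^(i-1) * (q^(d-i+1) - 1) * (1 - inverse (s^2) * q^(d+i-1)))))"

end

(*
  Let S be the alternating sign matrix. Since S negates A and A*, uniqueness of the standard
  orderings forces th_(d-i) = - th_i, and the Askey-Wilson relation loses its even part:
    A^2 A* - beta A A* A + A* A^2 - rho A* = omega A,
  with the same omega in the dual relation. Compare entries in the given basis, where
  x_i, y_i are the ratios of the entries of A* to those of A and z_i = A_(i,i-1) A_(i-1,i).
  The entries farthest from the diagonal make x and y geometric with ratios q or 1/q, where
  q + 1/q = beta. The sub- and superdiagonal entries are linear in z, and their difference is a
  recurrence for z that involves only delta = x - y, rho and the th_i. Its initial value z_1 is
  not determined by the relations alone (they hold for more pairs when q^(d+1) = 1): it comes from
  the eigenvector w of th_0, for which w A* (A - th_1) is a multiple of w. If delta is not zero this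
  determines z and gives the families K, C and LT; if delta = 0 then d is even and the
  sum of the two entries gives BI and E. The inequalities imposed on s express that
  consecutive eigenspaces of A are linked by A*.
*)
theory Submission
  imports Defs "Jordan_Normal_Form.Determinant"
begin

section \<open>Tridiagonal matrices\<close>

text \<open>Three obstacles shape the proof. Characteristic 2 has to be excluded first, since there
  S is the identity and yields nothing. Next, the equation for z_1 contains an unknown, the diagonal
  entry of A* at th_0 in the eigenbasis of A. The transposed pair has the same entry, so the
  difference of the two equations is free of it; its value is still needed for the later
  inequalities. Finally, the inequalities do not have a single source. In BI and E a forbidden
  parameter makes some z_i vanish. In C the z_i do not contain s, and in LT the value s^2 = q^(d-1)
  for odd d is a zero of no z_i. There the products p_i of opposite off-diagonal entries of A* in
  the eigenbasis of A are needed: the diagonal entries of the dual relation form a recurrence for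
  them, and the solution has a factor whose nonvanishing is the required inequality.\<close>

definition lo :: "nat \<Rightarrow> 'a::field mat \<Rightarrow> nat \<Rightarrow> 'a" where
  "lo d M i = (if 1 \<le> i \<and> i \<le> d then M $$ (i, i - 1) else 0)"

definition up :: "nat \<Rightarrow> 'a::field mat \<Rightarrow> nat \<Rightarrow> 'a" where
  "up d M i = (if 1 \<le> i \<and> i \<le> d then M $$ (i - 1, i) else 0)"

text \<open>Extension by zero to the indices 0 and d+1 lets the three-term product formulas hold in
  the border rows and columns: the meaningless entry at index \<open>i-1\<close> or
  \<open>Suc d\<close> is always multiplied by zero.\<close>

lemma lo_0 [simp]: "lo d M 0 = 0" and lo_Suc_d [simp]: "lo d M (Suc d) = 0"
  and up_0 [simp]: "up d M 0 = 0" and up_Suc_d [simp]: "up d M (Suc d) = 0"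
  by (auto simp: lo_def up_def)

lemma sum_three_point:
  fixes f :: "nat \<Rightarrow> 'a::comm_ring"
  assumes "i \<le> d" and z: "\<And>k. k \<le> d \<Longrightarrow> k + 1 < i \<or> i + 1 < k \<Longrightarrow> f k = 0"
  shows "(\<Sum>k<Suc d. f k) = (if 1 \<le> i then f (i-1) else 0) + f i + (if i < d then f (i+1) else 0)"
proof -
  define S where "S = (if 1 \<le> i then {i-1} else {}) \<union> {i} \<union> (if i < d then {i+1} else {})"
  have "(\<Sum>k<Suc d. f k) = sum f S"
  proof (rule sum.mono_neutral_right)
    show "\<forall>k\<in>{..<Suc d} - S. f k = 0"
    proof
      fix k assume k: "k \<in> {..<Suc d} - S"
      then have "k + 1 < i \<or> i + 1 < k"
        unfolding S_def by (cases "k < i"; cases "k = i") (auto split: if_splits)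
      with k z show "f k = 0" by auto
    qed
  qed (use assms in \<open>auto simp: S_def\<close>)
  also have "\<dots> = (if 1 \<le> i then f (i-1) else 0) + f i + (if i < d then f (i+1) else 0)"
    unfolding S_def by (cases "1 \<le> i"; cases "i < d") (auto simp: add_ac)
  finally show ?thesis .
qed

lemma index_mult_mat_sum:
  fixes M N :: "'a::comm_ring_1 mat"
  assumes "M \<in> carrier_mat n m" "N \<in> carrier_mat m l" "i < n" "j < l"
  shows "(M * N) $$ (i,j) = (\<Sum>k<m. M $$ (i,k) * N $$ (k,j))"
  using assms by (auto simp: scalar_prod_def lessThan_atLeast0 intro!: sum.cong)

lemma tridiag_mult_left:
  assumes M: "tridiag_mat d M" and N: "N \<in> carrier_mat (Suc d) m" and ij: "i \<le> d" "j < m"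
  shows "(M * N) $$ (i,j) = lo d M i * N $$ (i-1,j) + M $$ (i,i) * N $$ (i,j)
            + up d M (Suc i) * N $$ (Suc i,j)"
proof -
  have C: "M \<in> carrier_mat (Suc d) (Suc d)" using M by (simp add: tridiag_mat_def)
  have "(M * N) $$ (i,j) = (\<Sum>k<Suc d. M $$ (i,k) * N $$ (k,j))"
    using index_mult_mat_sum[OF C N] ij by simp
  also have "\<dots> = lo d M i * N $$ (i-1,j) + M $$ (i,i) * N $$ (i,j) + up d M (Suc i) * N $$ (Suc i,j)"
    by (subst sum_three_point[where i = i]) (use M ij in \<open>auto simp: tridiag_mat_def lo_def up_def\<close>)
  finally show ?thesis .
qed

lemma tridiag_mult_right:
  assumes M: "tridiag_mat d M" and N: "N \<in> carrier_mat m (Suc d)" and ij: "i < m" "j \<le> d"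
  shows "(N * M) $$ (i,j) = N $$ (i,j-1) * up d M j + N $$ (i,j) * M $$ (j,j)
            + N $$ (i,Suc j) * lo d M (Suc j)"
proof -
  have C: "M \<in> carrier_mat (Suc d) (Suc d)" using M by (simp add: tridiag_mat_def)
  have "(N * M) $$ (i,j) = (\<Sum>k<Suc d. N $$ (i,k) * M $$ (k,j))"
    using index_mult_mat_sum[OF N C] ij by simp
  also have "\<dots> = N $$ (i,j-1) * up d M j + N $$ (i,j) * M $$ (j,j) + N $$ (i,Suc j) * lo d M (Suc j)"
    by (subst sum_three_point[where i = j]) (use M ij in \<open>auto simp: tridiag_mat_def lo_def up_def\<close>)
  finally show ?thesis .
qed

lemma tridiag_carrier: "tridiag_mat d M \<Longrightarrow> M \<in> carrier_mat (Suc d) (Suc d)"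
  by (simp add: tridiag_mat_def)

lemma irred_tridiag: "irred_tridiag_mat d M \<Longrightarrow> tridiag_mat d M"
  by (simp add: irred_tridiag_mat_def)

lemma irred_lo_nonzero: "irred_tridiag_mat d M \<Longrightarrow> 1 \<le> i \<Longrightarrow> i \<le> d \<Longrightarrow> lo d M i \<noteq> 0"
  and irred_up_nonzero: "irred_tridiag_mat d M \<Longrightarrow> 1 \<le> i \<Longrightarrow> i \<le> d \<Longrightarrow> up d M i \<noteq> 0"
  by (auto simp: irred_tridiag_mat_def lo_def up_def)

text \<open>Row k of the eigenvalue equation expresses entry k+1 through the two entries before it,
  because the superdiagonal does not vanish. So an eigenvector is determined by its 0-th entry, and
  eigenspaces are lines.\<close>

lemma irred_eigenvector_zero:
  assumes A: "irred_tridiag_mat d A" and V: "V \<in> carrier_mat (Suc d) m" and j: "j < m"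
    and eig: "\<And>i. i \<le> d \<Longrightarrow> (A * V) $$ (i,j) = t * V $$ (i,j)" and 0: "V $$ (0,j) = 0"
  shows "i \<le> d \<Longrightarrow> V $$ (i,j) = 0"
proof (induction i rule: less_induct)
  case (less i)
  show ?case
  proof (cases i)
    case 0 then show ?thesis using assms by simp
  next
    case (Suc k)
    have "(A * V) $$ (k,j) = lo d A k * V $$ (k-1,j) + A $$ (k,k) * V $$ (k,j) + up d A (Suc k) * V $$ (Suc k,j)"
      using tridiag_mult_left[OF irred_tridiag[OF A] V] Suc less.prems j by simp
    moreover have "V $$ (k-1,j) = 0" "V $$ (k,j) = 0" using less Suc by auto
    ultimately have "up d A (Suc k) * V $$ (Suc k,j) = 0"
      using eig[of k] less.prems Suc by simp
    then show ?thesis using irred_up_nonzero[OF A] Suc less.prems by auto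
  qed
qed

lemma irred_tridiag_transpose:
  "irred_tridiag_mat d A \<Longrightarrow> irred_tridiag_mat d (transpose_mat A)"
  by (auto simp: irred_tridiag_mat_def tridiag_mat_def)

lemma irred_left_eigenvector_zero:
  assumes A: "irred_tridiag_mat d A" and V: "V \<in> carrier_mat m (Suc d)" and j: "j < m"
    and eig: "\<And>i. i \<le> d \<Longrightarrow> (V * A) $$ (j,i) = t * V $$ (j,i)" and 0: "V $$ (j,0) = 0"
    and i: "i \<le> d"
  shows "V $$ (j,i) = 0"
proof -
  have C: "A \<in> carrier_mat (Suc d) (Suc d)" using A irred_tridiag tridiag_carrier by blast
  have "transpose_mat V $$ (i,j) = 0"
  proof (rule irred_eigenvector_zero[OF irred_tridiag_transpose[OF A], of "transpose_mat V" m j t])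
    fix i assume i: "i \<le> d"
    have "(transpose_mat A * transpose_mat V) $$ (i,j) = transpose_mat (V * A) $$ (i,j)"
      using transpose_mult[OF V C] by simp
    then show "(transpose_mat A * transpose_mat V) $$ (i,j) = t * transpose_mat V $$ (i,j)"
      using eig[OF i] i V C j by simp
  qed (use V j 0 i in auto)
  then show ?thesis using V j i by simp
qed

lemma mult_col_zero:
  assumes V: "V \<in> carrier_mat n m" "W \<in> carrier_mat m l" "i < n" "j < l"
    and "\<And>k. k < m \<Longrightarrow> V $$ (i,k) * W $$ (k,j) = 0"
  shows "(V * W) $$ (i,j) = (0::'a::comm_ring_1)"
  using assms by (simp add: index_mult_mat_sum[OF V])

text \<open>The first basis vector is cyclic for an irreducible tridiagonal A: as the subdiagonal
  does not vanish, column k of \<open>A * Y = Y * A\<close> determines column k+1 of Y from the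
  earlier ones. A matrix commuting with A is thus determined by its 0-th column.\<close>

lemma commuting_irred_col_zero:
  assumes A: "irred_tridiag_mat d A" and Y: "Y \<in> carrier_mat (Suc d) (Suc d)"
    and comm: "A * Y = Y * A" and 0: "\<And>i. i \<le> d \<Longrightarrow> Y $$ (i,0) = 0"
    and i: "i \<le> d" and j: "j \<le> d"
  shows "Y $$ (i,j) = 0"
  using i j
proof (induction j arbitrary: i rule: less_induct)
  case (less j)
  note T = irred_tridiag[OF A]
  show ?case
  proof (cases j)
    case 0 then show ?thesis using assms less by simp
  next
    case (Suc k)
    have "(Y * A) $$ (i,k) = Y $$ (i,k-1) * up d A k + Y $$ (i,k) * A $$ (k,k) + Y $$ (i,Suc k) * lo d A (Suc k)"
      using tridiag_mult_right[OF T Y] less Suc by simp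
    moreover have "Y $$ (l,k) = 0" if "l \<le> d" for l using less that Suc by auto
    moreover have "Y $$ (i,k-1) = 0" using less Suc by auto
    moreover have "(A * Y) $$ (i,k) = 0"
      by (rule mult_col_zero[OF tridiag_carrier[OF T] Y]) (use less Suc in auto)
    ultimately have "Y $$ (i,Suc k) * lo d A (Suc k) = 0"
      using comm less Suc by simp
    then show ?thesis using irred_lo_nonzero[OF A] Suc less.prems by auto
  qed
qed

text \<open>The columns of P are an eigenbasis of A, ordered by \<open>th\<close>, in which B is
  irreducible tridiagonal. A Leonard system supplies two of these, with the roles of A and B
  exchanged, and the idempotents can then be dropped.\<close>

definition eigform :: "nat \<Rightarrow> 'a::field mat \<Rightarrow> 'a mat \<Rightarrow> (nat \<Rightarrow> 'a) \<Rightarrow> 'a mat \<Rightarrow> 'a mat \<Rightarrow> bool" where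
  "eigform d A B th P Q \<longleftrightarrow>
     P \<in> carrier_mat (Suc d) (Suc d) \<and> Q \<in> carrier_mat (Suc d) (Suc d) \<and>
     P * Q = 1\<^sub>m (Suc d) \<and> Q * P = 1\<^sub>m (Suc d) \<and> inj_on th {0..d} \<and>
     Q * A * P = mat (Suc d) (Suc d) (\<lambda>(i,j). if i = j then th i else 0) \<and>
     irred_tridiag_mat d (Q * B * P)"

section \<open>Eigenbases of a Leonard system\<close>

text \<open>Each E_j has rank one, because its columns lie in an eigenline of A. Writing E_j as
  column j of P times row j of Q turns every condition on E_i B E_j into one on the entry (i,j) of Q
  B P.\<close>

lemma eigform_of_idempotents:
  fixes A B :: "'a::field mat"
  assumes A: "irred_tridiag_mat d A" and B: "B \<in> carrier_mat (Suc d) (Suc d)"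
    and E: "prim_idempotents d A E th"
    and far: "\<And>i j. i \<le> d \<Longrightarrow> j \<le> d \<Longrightarrow> i > j + 1 \<or> j > i + 1 \<Longrightarrow>
          E i * B * E j = 0\<^sub>m (d+1) (d+1)"
    and adj: "\<And>i j. i \<le> d \<Longrightarrow> j \<le> d \<Longrightarrow> i = j + 1 \<or> j = i + 1 \<Longrightarrow>
          E i * B * E j \<noteq> 0\<^sub>m (d+1) (d+1)"
  shows "\<exists>P Q. eigform d A B th P Q"
proof -
  let ?n = "Suc d"
  have AC: "A \<in> carrier_mat ?n ?n" using A irred_tridiag tridiag_carrier by blast
  have EC: "E j \<in> carrier_mat ?n ?n" and E0: "E j \<noteq> 0\<^sub>m ?n ?n" and AE: "A * E j = th j \<cdot>\<^sub>m E j"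
    if "j \<le> d" for j using E that by (auto simp: prim_idempotents_def)
  have EE: "E i * E j = (if i = j then E i else 0\<^sub>m ?n ?n)" if "i \<le> d" "j \<le> d" for i j
    using E that by (auto simp: prim_idempotents_def)
  have inj: "inj_on th {0..d}" using E by (auto simp: prim_idempotents_def)
  have "\<exists>l\<le>d. E j $$ (0,l) \<noteq> 0" if j: "j \<le> d" for j
  proof (rule ccontr)
    assume H: "\<not> ?thesis"
    have "E j $$ (k,l) = 0" if "k \<le> d" "l \<le> d" for k l
      by (rule irred_eigenvector_zero[OF A EC[OF j], of l "th j"])
        (use AE[OF j] EC[OF j] H that in auto)
    then have "E j = 0\<^sub>m ?n ?n" using EC[OF j] by (intro eq_matI) auto
    then show False using E0[OF j] by simp
  qed
  then obtain l where l: "\<And>j. j \<le> d \<Longrightarrow> l j \<le> d" "\<And>j. j \<le> d \<Longrightarrow> E j $$ (0, l j) \<noteq> 0"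
    by metis
  \<comment> \<open>Column j of P is the eigenvector for \<open>th j\<close> with 0-th entry 1,
    taken from a column of E_j whose 0-th entry is not zero. With this normalization row j of Q is
    simply the 0-th row of E_j.\<close>
  define P where "P = mat ?n ?n (\<lambda>(k,j). E j $$ (k, l j) / E j $$ (0, l j))"
  define Q where "Q = mat ?n ?n (\<lambda>(j,k). E j $$ (0, k))"
  have P: "P \<in> carrier_mat ?n ?n" and Q: "Q \<in> carrier_mat ?n ?n"
    by (auto simp: P_def Q_def)
  have P0: "P $$ (0,j) = 1" if "j \<le> d" for j using that l by (simp add: P_def)
  have Epq: "E j $$ (k,m) = P $$ (k,j) * Q $$ (j,m)" if j: "j \<le> d" and k: "k \<le> d" and m: "m \<le> d" for j k m
  proof -
    \<comment> \<open>Both terms lie in the eigenspace of \<open>th j\<close> and have the same 0-th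
      entry, so their difference vanishes.\<close>
    define V where "V = mat ?n 1 (\<lambda>(k,_). E j $$ (k,m) - P $$ (k,j) * E j $$ (0,m))"
    have V: "V \<in> carrier_mat ?n 1" by (simp add: V_def)
    have E_eig: "(\<Sum>i<?n. A $$ (k,i) * E j $$ (i,m)) = th j * E j $$ (k,m)" if "k \<le> d" "m \<le> d" for k m
      using index_mult_mat_sum[OF AC EC[OF j], of k m] AE[OF j] that EC[OF j] by simp
    have "V $$ (k,0) = 0"
    proof (rule irred_eigenvector_zero[OF A V])
      fix i assume i: "i \<le> d"
      have "(A * V) $$ (i,0) = (\<Sum>s<?n. A $$ (i,s) * V $$ (s,0))"
        using index_mult_mat_sum[OF AC V, of i 0] i by simp
      also have "\<dots> = (\<Sum>s<?n. A $$ (i,s) * E j $$ (s,m)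
           - (A $$ (i,s) * E j $$ (s,l j)) * (E j $$ (0,m) / E j $$ (0,l j)))"
        using j by (intro sum.cong) (auto simp: V_def P_def algebra_simps)
      also have "\<dots> = th j * V $$ (i,0)"
        unfolding sum_subtractf sum_distrib_right[symmetric]
        using E_eig[OF i m] E_eig[OF i l(1)[OF j]] i j by (simp add: V_def P_def algebra_simps)
      finally show "(A * V) $$ (i,0) = th j * V $$ (i,0)" .
    qed (use k P0[OF j] in \<open>auto simp: V_def\<close>)
    then show ?thesis using j k m by (simp add: V_def Q_def)
  qed
  \<comment> \<open>The 0-th row of E_i M E_j suffices: there the factor from P is 1, and what
    remains is the matrix of M in the new basis times a row of Q.\<close>
  have mult: "(E i * M * E j) $$ (0,m) = (Q * M * P) $$ (i,j) * Q $$ (j,m)"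
    if M: "M \<in> carrier_mat ?n ?n" and ij: "i \<le> d" "j \<le> d" and m: "m \<le> d" for i j m M
  proof -
    have EM: "E i * M \<in> carrier_mat ?n ?n" and QM: "Q * M \<in> carrier_mat ?n ?n"
      using EC[OF ij(1)] Q M by auto
    have "(E i * M) $$ (0,k) = (Q * M) $$ (i,k)" if "k \<le> d" for k
      using that ij by (simp add: index_mult_mat_sum[OF EC[OF ij(1)] M] index_mult_mat_sum[OF Q M]
          Epq P0 del: sum.lessThan_Suc)
    then show ?thesis
      using ij m by (simp add: index_mult_mat_sum[OF EM EC[OF ij(2)]] index_mult_mat_sum[OF QM P]
          Epq sum_distrib_right mult.assoc del: sum.lessThan_Suc)
  qed
  have Ql: "Q $$ (j, l j) \<noteq> 0" if "j \<le> d" for j using that l(1)[OF that] l(2)[OF that] by (simp add: Q_def)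
  have QP: "Q * P = 1\<^sub>m ?n"
  proof (rule eq_matI)
    fix i j assume "i < dim_row (1\<^sub>m ?n :: 'a mat)" "j < dim_col (1\<^sub>m ?n :: 'a mat)"
    then have ij: "i \<le> d" "j \<le> d" by auto
    have "(E i * E j) $$ (0,l j) = (Q * P) $$ (i,j) * Q $$ (j,l j)"
      using mult[of "1\<^sub>m ?n" i j "l j"] ij l Q EC[OF ij(1)] by simp
    also have "(E i * E j) $$ (0,l j) = (if i = j then Q $$ (j, l j) else 0)"
      using ij l(1)[OF ij(2)] EE[OF ij] by (simp add: Q_def)
    finally show "(Q * P) $$ (i,j) = 1\<^sub>m ?n $$ (i,j)" using Ql[OF ij(2)] ij by (auto split: if_splits)
  qed (use P Q in auto)
  have PQ: "P * Q = 1\<^sub>m ?n" by (rule mat_mult_left_right_inverse[OF Q P QP])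
  have AP: "A * P = P * mat ?n ?n (\<lambda>(i,j). if i = j then th i else 0)" (is "_ = P * ?D")
  proof (rule eq_matI)
    fix i j assume "i < dim_row (P * ?D)" "j < dim_col (P * ?D)"
    then have ij: "i \<le> d" "j \<le> d" using P by auto
    have D: "?D \<in> carrier_mat ?n ?n" by simp
    have "(A * P) $$ (i,j) = (\<Sum>k<?n. A $$ (i,k) * E j $$ (k, l j)) / E j $$ (0, l j)"
      using ij by (simp add: index_mult_mat_sum[OF AC P] sum_divide_distrib del: sum.lessThan_Suc)
        (auto simp: P_def intro!: sum.cong)
    also have "(\<Sum>k<?n. A $$ (i,k) * E j $$ (k, l j)) = th j * E j $$ (i, l j)"
      using index_mult_mat_sum[OF AC EC[OF ij(2)], of i "l j"] AE[OF ij(2)] ij l(1)[OF ij(2)] EC[OF ij(2)] by (simp del: sum.lessThan_Suc)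
    also have "th j * E j $$ (i, l j) / E j $$ (0, l j) = (\<Sum>k<?n. P $$ (i,k) * ?D $$ (k,j))"
      using ij by (subst sum.remove[of _ j]) (auto simp: P_def)
    also have "\<dots> = (P * ?D) $$ (i,j)" using ij by (simp add: index_mult_mat_sum[OF P D] del: sum.lessThan_Suc)
    finally show "(A * P) $$ (i,j) = (P * ?D) $$ (i,j)" .
  qed (use P AC in auto)
  have D: "?D \<in> carrier_mat ?n ?n" by simp
  have "Q * A * P = Q * (P * ?D)" using P Q AC AP by simp
  also have "\<dots> = (Q * P) * ?D" using assoc_mult_mat[OF Q P D] by simp
  also have "\<dots> = ?D" using QP D by simp
  finally have QAP: "Q * A * P = ?D" .
  have "irred_tridiag_mat d (Q * B * P)"
  proof -
    have z: "(Q * B * P) $$ (i,j) = 0 \<longleftrightarrow> E i * B * E j = 0\<^sub>m ?n ?n" if ij: "i \<le> d" "j \<le> d" for i j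
    proof
      assume "E i * B * E j = 0\<^sub>m ?n ?n"
      then show "(Q * B * P) $$ (i,j) = 0"
        using mult[OF B ij l(1)[OF ij(2)]] l(1)[OF ij(2)] Ql[OF ij(2)] by simp
    next
      assume z: "(Q * B * P) $$ (i,j) = 0"
      have C: "E i * B \<in> carrier_mat ?n ?n" and C': "Q * B \<in> carrier_mat ?n ?n"
        using EC[OF ij(1)] B Q by auto
      have EB: "(E i * B) $$ (k,m) = P $$ (k,i) * (Q * B) $$ (i,m)" if "k \<le> d" "m \<le> d" for k m
        using that ij by (simp add: index_mult_mat_sum[OF EC[OF ij(1)] B] index_mult_mat_sum[OF Q B]
          Epq sum_distrib_left mult.assoc del: sum.lessThan_Suc)
      show "E i * B * E j = 0\<^sub>m ?n ?n"
      proof (rule eq_matI)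
        fix k m assume "k < dim_row (0\<^sub>m ?n ?n :: 'a mat)" "m < dim_col (0\<^sub>m ?n ?n :: 'a mat)"
        then have km: "k \<le> d" "m \<le> d" by auto
        have "(E i * B * E j) $$ (k,m) = (\<Sum>s<?n. P $$ (k,i) * (Q * B) $$ (i,s) * (P $$ (s,j) * Q $$ (j,m)))"
          using km ij by (simp add: index_mult_mat_sum[OF C EC[OF ij(2)]] EB Epq del: sum.lessThan_Suc)
        also have "\<dots> = P $$ (k,i) * (Q * B * P) $$ (i,j) * Q $$ (j,m)"
          using km ij by (simp add: index_mult_mat_sum[OF C' P] sum_distrib_left sum_distrib_right mult_ac
              del: sum.lessThan_Suc)
        finally show "(E i * B * E j) $$ (k,m) = 0\<^sub>m ?n ?n $$ (k,m)" using z km by simp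
      qed (use EC[OF ij(1)] EC[OF ij(2)] B in auto)
    qed
    show ?thesis unfolding irred_tridiag_mat_def tridiag_mat_def
      using z far adj P Q B by (auto simp: Suc_le_eq)
  qed
  then show ?thesis using P Q PQ QP inj QAP unfolding eigform_def by blast
qed

lemma leonard_system_eigform:
  assumes "leonard_system d A E As Es th ths" "irred_tridiag_mat d A" "irred_tridiag_mat d As"
  shows "\<exists>P Q. eigform d A As th P Q" "\<exists>P Q. eigform d As A ths P Q"
proof -
  note L = assms(1)[unfolded leonard_system_def]
  have C: "A \<in> carrier_mat (Suc d) (Suc d)" "As \<in> carrier_mat (Suc d) (Suc d)"
    using assms irred_tridiag tridiag_carrier by blast+
  show "\<exists>P Q. eigform d A As th P Q"
    by (rule eigform_of_idempotents[where E = E]) (use L assms C in auto)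
  show "\<exists>P Q. eigform d As A ths P Q"
    by (rule eigform_of_idempotents[where E = Es]) (use L assms C in auto)
qed

section \<open>Symmetry of the spectrum\<close>

text \<open>An injective walk on a path cannot turn back, so all its steps go in one direction; the
  bounds then fix its starting point.\<close>

lemma path_automorphism:
  fixes \<sigma> :: "nat \<Rightarrow> nat"
  assumes bd: "\<And>i. i \<le> d \<Longrightarrow> \<sigma> i \<le> d" and inj: "inj_on \<sigma> {..d}"
    and adj: "\<And>i. i < d \<Longrightarrow> \<sigma> (Suc i) = Suc (\<sigma> i) \<or> Suc (\<sigma> (Suc i)) = \<sigma> i"
  shows "(\<forall>i\<le>d. \<sigma> i = i) \<or> (\<forall>i\<le>d. \<sigma> i = d - i)"
proof -
  have step: "\<sigma> (Suc (Suc i)) \<noteq> \<sigma> i" if "Suc i < d" for i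
    using inj_onD[OF inj, of "Suc (Suc i)" i] that by auto
  have "k \<le> d \<Longrightarrow> (\<forall>i<k. \<sigma> (Suc i) = Suc (\<sigma> i)) \<or> (\<forall>i<k. Suc (\<sigma> (Suc i)) = \<sigma> i)" for k
  proof (induction k)
    case (Suc k)
    show ?case
    proof (cases k)
      case 0 then show ?thesis using adj[of 0] Suc.prems by simp
    next
      case k: (Suc m)
      have kd: "k < d" and m: "m < k" using Suc.prems k by auto
      note st = step[of m, folded k, OF kd]
      from Suc.IH[OF less_imp_le[OF kd]] consider "\<forall>i<k. \<sigma> (Suc i) = Suc (\<sigma> i)"
        | "\<forall>i<k. Suc (\<sigma> (Suc i)) = \<sigma> i" by blast
      then show ?thesis
      proof cases
        case 1
        have "\<sigma> (Suc k) = Suc (\<sigma> k)" using adj[OF kd] st 1[rule_format, OF m] unfolding k by linarith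
        then show ?thesis using 1 less_antisym by blast
      next
        case 2
        have "Suc (\<sigma> (Suc k)) = \<sigma> k" using adj[OF kd] st 2[rule_format, OF m] unfolding k by linarith
        then show ?thesis using 2 less_antisym by blast
      qed
    qed
  qed simp
  from this[of d] consider "\<forall>i<d. \<sigma> (Suc i) = Suc (\<sigma> i)" | "\<forall>i<d. Suc (\<sigma> (Suc i)) = \<sigma> i"
    by blast
  then show ?thesis
  proof cases
    case 1
    have s: "i \<le> d \<longrightarrow> \<sigma> i = \<sigma> 0 + i" for i
    proof (induction i)
      case (Suc i) then show ?case using 1[rule_format, of i] by linarith
    qed simp
    have "\<sigma> 0 = 0" using s[of d] bd[of d] by linarith
    then have "\<sigma> i = i" if "i \<le> d" for i using s[of i] that by linarith
    then show ?thesis by blast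
  next
    case 2
    have s: "i \<le> d \<longrightarrow> \<sigma> i + i = \<sigma> 0" for i
    proof (induction i)
      case (Suc i) then show ?case using 2[rule_format, of i] by linarith
    qed simp
    have "\<sigma> 0 = d" using s[of d] bd[of 0] by linarith
    then have "\<sigma> i = d - i" if "i \<le> d" for i using s[of i] that by linarith
    then show ?thesis by blast
  qed
qed

section \<open>Diagonal matrices and conjugation by the sign matrix\<close>

definition dg :: "nat \<Rightarrow> (nat \<Rightarrow> 'a::field) \<Rightarrow> 'a mat" where
  "dg d f = mat (Suc d) (Suc d) (\<lambda>(i,j). if i = j then f i else 0)"

lemma dg_carrier [simp]: "dg d f \<in> carrier_mat (Suc d) (Suc d)"
  and dg_dim [simp]: "dim_row (dg d f) = Suc d" "dim_col (dg d f) = Suc d"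
  by (simp_all add: dg_def)

lemma dg_mult_left:
  assumes "M \<in> carrier_mat (Suc d) m" "i \<le> d" "j < m"
  shows "(dg d f * M) $$ (i,j) = f i * M $$ (i,j)"
proof -
  have "(dg d f * M) $$ (i,j) = (\<Sum>k<Suc d. dg d f $$ (i,k) * M $$ (k,j))"
    using index_mult_mat_sum[OF dg_carrier assms(1)] assms by simp
  also have "\<dots> = f i * M $$ (i,j)"
    using assms by (subst sum.remove[of _ i]) (auto simp: dg_def intro!: sum.neutral)
  finally show ?thesis .
qed

lemma dg_mult_right:
  assumes "M \<in> carrier_mat m (Suc d)" "i < m" "j \<le> d"
  shows "(M * dg d f) $$ (i,j) = M $$ (i,j) * f j"
proof -
  have "(M * dg d f) $$ (i,j) = (\<Sum>k<Suc d. M $$ (i,k) * dg d f $$ (k,j))"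
    using index_mult_mat_sum[OF assms(1) dg_carrier] assms by simp
  also have "\<dots> = M $$ (i,j) * f j"
    using assms by (subst sum.remove[of _ j]) (auto simp: dg_def intro!: sum.neutral)
  finally show ?thesis .
qed

lemma eigformD:
  assumes "eigform d A B th P Q"
  shows "P \<in> carrier_mat (Suc d) (Suc d)" "Q \<in> carrier_mat (Suc d) (Suc d)"
    "P * Q = 1\<^sub>m (Suc d)" "Q * P = 1\<^sub>m (Suc d)" "inj_on th {0..d}"
    "Q * A * P = dg d th" "irred_tridiag_mat d (Q * B * P)"
  using assms by (auto simp: eigform_def dg_def)

lemma conj_mult:
  fixes P Q M N :: "'a::field mat"
  assumes P: "P \<in> carrier_mat n n" and Q: "Q \<in> carrier_mat n n" and PQ: "P * Q = 1\<^sub>m n"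
    and M: "M \<in> carrier_mat n n" and N: "N \<in> carrier_mat n n"
  shows "Q * (M * N) * P = (Q * M * P) * (Q * N * P)"
proof -
  have "(Q * M * P) * (Q * N * P) = Q * M * (P * Q) * N * P"
    using P Q M N by (simp add: assoc_mult_mat[of _ n n _ n _ n] del: assoc_mult_mat)
  also have "\<dots> = Q * (M * N) * P"
    using P Q M N PQ by (simp add: assoc_mult_mat[of _ n n _ n _ n] del: assoc_mult_mat)
  finally show ?thesis by simp
qed

lemma zero_diagD:
  assumes "zero_diag_TD d A"
  shows "irred_tridiag_mat d A" "tridiag_mat d A" "A \<in> carrier_mat (Suc d) (Suc d)"
    "i \<le> d \<Longrightarrow> A $$ (i,i) = 0"
    "i \<le> d \<Longrightarrow> j \<le> d \<Longrightarrow> A $$ (i,j) \<noteq> 0 \<Longrightarrow> i = Suc j \<or> j = Suc i"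
proof -
  show "irred_tridiag_mat d A" "tridiag_mat d A" "A \<in> carrier_mat (Suc d) (Suc d)"
    "i \<le> d \<Longrightarrow> A $$ (i,i) = 0"
    using assms by (auto simp: zero_diag_TD_def irred_tridiag_mat_def tridiag_mat_def)
  assume ij: "i \<le> d" "j \<le> d" "A $$ (i,j) \<noteq> 0"
  then have "\<not> (i > j + 1 \<or> j > i + 1)" "i \<noteq> j"
    using assms by (auto simp: zero_diag_TD_def irred_tridiag_mat_def tridiag_mat_def)
  then show "i = Suc j \<or> j = Suc i" by linarith
qed

text \<open>In every characteristic the projection U onto the even coordinates satisfies A U + U A =
  A, as A exchanges even and odd coordinates. In the eigenbasis the diagonal entries of this
  equation read 2 th_i U_ii = th_i, so 2 = 0 would make all eigenvalues 0.\<close>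

lemma eigform_char_not_2:
  fixes A B :: "'a::field mat"
  assumes A: "zero_diag_TD d A" and E: "eigform d A B th P Q" and d: "d \<ge> 1"
  shows "(2::'a) \<noteq> 0"
proof
  assume 2: "(2::'a) = 0"
  note e = eigformD[OF E] and a = zero_diagD[OF A]
  define U where "U = dg d (\<lambda>i. if even i then 1 else 0 :: 'a)"
  have UC: "U \<in> carrier_mat (Suc d) (Suc d)" by (simp add: U_def)
  have "A * U + U * A = A"
  proof (rule eq_matI)
    fix i j assume "i < dim_row A" "j < dim_col A"
    then have ij: "i \<le> d" "j \<le> d" using a(3) by auto
    have "(A * U) $$ (i,j) = A $$ (i,j) * (if even j then 1 else 0)"
      "(U * A) $$ (i,j) = (if even i then 1 else 0) * A $$ (i,j)"
      unfolding U_def using dg_mult_right[OF a(3)] dg_mult_left[OF a(3)] ij by simp_all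
    then show "(A * U + U * A) $$ (i,j) = A $$ (i,j)"
      using a(3) a(5)[OF ij] ij UC by (cases "A $$ (i,j) = 0") auto
  qed (use a(3) UC in auto)
  then have "Q * (A * U + U * A) * P = dg d th" using e(6) by simp
  moreover have "Q * (A * U + U * A) * P = Q * (A * U) * P + Q * (U * A) * P"
    using e(1,2) a(3) UC mult_add_distrib_mat[OF e(2), of "A * U" _ "U * A"]
      add_mult_distrib_mat[OF _ _ e(1), of "Q * (A * U)" _ "Q * (U * A)"]
    by (metis mult_carrier_mat)
  moreover have "Q * (A * U) * P = dg d th * (Q * U * P)" "Q * (U * A) * P = (Q * U * P) * dg d th"
    using conj_mult[OF e(1,2,3)] a(3) UC e(6) by auto
  ultimately have eq: "dg d th * (Q * U * P) + (Q * U * P) * dg d th = dg d th" by simp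
  have V: "Q * U * P \<in> carrier_mat (Suc d) (Suc d)" using e(1,2) UC by auto
  have "th i = 0" if i: "i \<le> d" for i
  proof -
    have "(dg d th * (Q * U * P) + (Q * U * P) * dg d th) $$ (i,i) = 2 * (th i * (Q * U * P) $$ (i,i))"
      using i V dg_mult_left[OF V i, of i th] dg_mult_right[OF V _ i, of i th]
      by (subst index_add_mat) (auto simp: mult.commute simp del: index_mult_mat(1))
    then show ?thesis using eq 2 i by (simp add: dg_def)
  qed
  then have "th 0 = th 1" using d by simp
  then show False using inj_onD[OF e(5), of 0 1] d by simp
qed

text \<open>Conjugation by the alternating sign matrix negates both members of the pair; in the
  eigenbasis it becomes a matrix that anticommutes with both.\<close>

lemma sign_conj:
  fixes A :: "'a::field mat"
  assumes P: "P \<in> carrier_mat (Suc d) (Suc d)" and Q: "Q \<in> carrier_mat (Suc d) (Suc d)"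
    and PQ: "P * Q = 1\<^sub>m (Suc d)" and A: "zero_diag_TD d A"
  shows "(Q * A * P) * (Q * dg d (\<lambda>i. (-1)^i) * P)
     = (-1) \<cdot>\<^sub>m ((Q * dg d (\<lambda>i. (-1)^i) * P) * (Q * A * P))"
proof -
  let ?S = "dg d (\<lambda>i. (-1)^i) :: 'a mat"
  note a = zero_diagD[OF A]
  have S: "?S \<in> carrier_mat (Suc d) (Suc d)" by simp
  have "A * ?S = (-1) \<cdot>\<^sub>m (?S * A)"
  proof (rule eq_matI)
    fix i j assume "i < dim_row ((-1) \<cdot>\<^sub>m (?S * A))" "j < dim_col ((-1) \<cdot>\<^sub>m (?S * A))"
    then have ij: "i \<le> d" "j \<le> d" using a(3) S by auto
    have "(A * ?S) $$ (i,j) = A $$ (i,j) * (-1)^j" "(?S * A) $$ (i,j) = (-1)^i * A $$ (i,j)"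
      using dg_mult_right[OF a(3)] dg_mult_left[OF a(3)] ij by simp_all
    then show "(A * ?S) $$ (i,j) = ((-1) \<cdot>\<^sub>m (?S * A)) $$ (i,j)"
      using a(3) a(5)[OF ij] ij S by (cases "A $$ (i,j) = 0") (auto simp del: index_mult_mat(1))
  qed (use a(3) S in auto)
  then have "Q * (A * ?S) * P = Q * ((-1) \<cdot>\<^sub>m (?S * A)) * P" by simp
  also have "\<dots> = (-1) \<cdot>\<^sub>m (Q * (?S * A) * P)"
    using mult_smult_distrib[OF Q mult_carrier_mat[OF S a(3)], of "-1"]
      mult_smult_assoc_mat[OF mult_carrier_mat[OF Q mult_carrier_mat[OF S a(3)]] P, of "-1"] by simp
  finally show ?thesis using conj_mult[OF P Q PQ a(3) S] conj_mult[OF P Q PQ S a(3)] by simp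
qed

lemma sign_square:
  assumes P: "P \<in> carrier_mat (Suc d) (Suc d)" and Q: "Q \<in> carrier_mat (Suc d) (Suc d)"
    and PQ: "P * Q = 1\<^sub>m (Suc d)" and QP: "Q * P = 1\<^sub>m (Suc d)"
  shows "(Q * dg d (\<lambda>i. (-1)^i) * P) * (Q * dg d (\<lambda>i. (-1)^i) * P) = (1\<^sub>m (Suc d) :: 'a::field mat)"
proof -
  let ?S = "dg d (\<lambda>i. (-1)^i) :: 'a mat"
  have "?S * ?S = 1\<^sub>m (Suc d)"
  proof (rule eq_matI)
    fix i j assume "i < dim_row (1\<^sub>m (Suc d) :: 'a mat)" "j < dim_col (1\<^sub>m (Suc d) :: 'a mat)"
    then show "(?S * ?S) $$ (i,j) = 1\<^sub>m (Suc d) $$ (i,j)"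
      by (subst dg_mult_left[OF dg_carrier]) (auto simp: dg_def simp flip: power_add)
  qed auto
  then show ?thesis using conj_mult[OF P Q PQ, of ?S ?S] P Q QP by simp
qed

lemma anticommuting_entry:
  fixes th :: "nat \<Rightarrow> 'a::field"
  assumes T: "T \<in> carrier_mat (Suc d) (Suc d)" and anti: "dg d th * T = (-1) \<cdot>\<^sub>m (T * dg d th)"
    and ij: "i \<le> d" "j \<le> d" and nz: "T $$ (i,j) \<noteq> 0"
  shows "th i = - th j"
proof -
  have ij': "i < Suc d" "j < Suc d" using ij by auto
  have "(dg d th * T) $$ (i,j) = - ((T * dg d th) $$ (i,j))"
    unfolding anti using ij' T by (subst index_smult_mat) auto
  then have "th i * T $$ (i,j) = - (T $$ (i,j) * th j)"
    using dg_mult_left[OF T ij(1) ij'(2)] dg_mult_right[OF T ij'(1) ij(2)] by simp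
  then have "(th i + th j) * T $$ (i,j) = 0" by (simp add: distrib_right mult.commute)
  then show ?thesis using nz by (simp add: eq_neg_iff_add_eq_0)
qed

text \<open>In the eigenbasis the sign matrix T anticommutes with the diagonal matrix of the th_i,
  so it can be nonzero only where \<open>th i = - th j\<close> and, being invertible, is a
  permutation matrix up to scalars. As it also anticommutes with the irreducible tridiagonal B', the
  permutation preserves adjacency, so it is the identity or the reversal of 0..d.\<close>

lemma eigform_flip:
  fixes A B :: "'a::field mat"
  assumes A: "zero_diag_TD d A" and B: "zero_diag_TD d B" and E: "eigform d A B th P Q" and d: "d \<ge> 1"
  shows "i \<le> d \<Longrightarrow> th (d - i) = - th i"
proof -
  note e = eigformD[OF E]
  define T where "T = Q * dg d (\<lambda>i. (-1)^i) * P"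
  have T: "T \<in> carrier_mat (Suc d) (Suc d)" unfolding T_def by (rule mult_carrier_mat[OF mult_carrier_mat[OF e(2) dg_carrier] e(1)])
  define B' where "B' = Q * B * P"
  have B': "irred_tridiag_mat d B'" "B' \<in> carrier_mat (Suc d) (Suc d)"
    using e(7) tridiag_carrier[OF irred_tridiag[OF e(7)]] by (simp_all add: B'_def)
  have DT: "dg d th * T = (-1) \<cdot>\<^sub>m (T * dg d th)"
    using sign_conj[OF e(1,2,3) A] e(6) by (simp add: T_def)
  have BT: "B' * T = (-1) \<cdot>\<^sub>m (T * B')"
    using sign_conj[OF e(1,2,3) B] by (simp add: T_def B'_def)
  have TT: "T * T = 1\<^sub>m (Suc d)" using sign_square[OF e(1,2,3,4)] by (simp add: T_def)
  note Tz = anticommuting_entry[OF T DT]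
  have "\<exists>i\<le>d. T $$ (i,j) \<noteq> 0" if "j \<le> d" for j
  proof (rule ccontr)
    assume "\<not> ?thesis"
    then have "(T * T) $$ (j,j) = 0" by (intro mult_col_zero[OF T T]) (use that in simp_all)
    then show False unfolding TT using that by simp
  qed
  then obtain \<sigma> where \<sigma>: "\<And>j. j \<le> d \<Longrightarrow> \<sigma> j \<le> d" "\<And>j. j \<le> d \<Longrightarrow> T $$ (\<sigma> j, j) \<noteq> 0" by metis
  have th\<sigma>: "th (\<sigma> j) = - th j" if "j \<le> d" for j using Tz \<sigma> that by blast
  have uniq: "i = \<sigma> j" if "i \<le> d" "j \<le> d" "T $$ (i,j) \<noteq> 0" for i j
    using Tz[OF that] th\<sigma>[OF that(2)] that(1) \<sigma>(1)[OF that(2)] inj_onD[OF e(5), of i "\<sigma> j"] by simp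
  have uniq': "j = k" if "j \<le> d" "k \<le> d" "\<sigma> j = \<sigma> k" for j k
    using th\<sigma>[OF that(1)] th\<sigma>[OF that(2)] that inj_onD[OF e(5), of j k] by simp
  \<comment> \<open>At the entry (\<sigma> i, i+1) the products \<open>B' * T\<close> and
    \<open>T * B'\<close> have one term each. The second contains a superdiagonal entry of B' and is
    nonzero, so B' links \<sigma> i with \<sigma> (i+1).\<close>
  have adj: "\<sigma> (Suc i) = Suc (\<sigma> i) \<or> Suc (\<sigma> (Suc i)) = \<sigma> i" if i: "i < d" for i
  proof -
    have ij: "i \<le> d" "Suc i \<le> d" using i by auto
    have s: "\<sigma> i < Suc d" "\<sigma> (Suc i) < Suc d" using \<sigma>(1)[OF ij(1)] \<sigma>(1)[OF ij(2)] by auto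
    have "(B' * T) $$ (\<sigma> i, Suc i) = (\<Sum>k<Suc d. B' $$ (\<sigma> i,k) * T $$ (k, Suc i))"
      by (rule index_mult_mat_sum[OF B'(2) T s(1)]) (use ij in simp)
    also have "\<dots> = (\<Sum>k\<in>{\<sigma> (Suc i)}. B' $$ (\<sigma> i,k) * T $$ (k, Suc i))"
    proof (rule sum.mono_neutral_right)
      show "\<forall>k\<in>{..<Suc d} - {\<sigma> (Suc i)}. B' $$ (\<sigma> i,k) * T $$ (k, Suc i) = 0"
      proof
        fix k assume k: "k \<in> {..<Suc d} - {\<sigma> (Suc i)}"
        then have "T $$ (k, Suc i) = 0" using uniq[of k, OF _ ij(2)] by force
        then show "B' $$ (\<sigma> i,k) * T $$ (k, Suc i) = 0" by simp
      qed
    qed (use s in simp_all)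
    also have "\<dots> = B' $$ (\<sigma> i, \<sigma> (Suc i)) * T $$ (\<sigma> (Suc i), Suc i)" by simp
    finally have 1: "(B' * T) $$ (\<sigma> i, Suc i) = B' $$ (\<sigma> i, \<sigma> (Suc i)) * T $$ (\<sigma> (Suc i), Suc i)" .
    have "(T * B') $$ (\<sigma> i, Suc i) = (\<Sum>k<Suc d. T $$ (\<sigma> i,k) * B' $$ (k, Suc i))"
      by (rule index_mult_mat_sum[OF T B'(2) s(1)]) (use ij in simp)
    also have "\<dots> = (\<Sum>k\<in>{i}. T $$ (\<sigma> i,k) * B' $$ (k, Suc i))"
    proof (rule sum.mono_neutral_right)
      show "\<forall>k\<in>{..<Suc d} - {i}. T $$ (\<sigma> i,k) * B' $$ (k, Suc i) = 0"
      proof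
        fix k assume k: "k \<in> {..<Suc d} - {i}"
        then have kd: "k \<le> d" and "i \<noteq> k" by auto
        then have "\<sigma> i \<noteq> \<sigma> k" using uniq'[OF ij(1) kd] by metis
        then have "T $$ (\<sigma> i, k) = 0" using uniq[OF \<sigma>(1)[OF ij(1)] kd] by metis
        then show "T $$ (\<sigma> i,k) * B' $$ (k, Suc i) = 0" by simp
      qed
    qed (use ij in simp_all)
    finally have 2: "(T * B') $$ (\<sigma> i, Suc i) = T $$ (\<sigma> i, i) * B' $$ (i, Suc i)" by simp
    have "(B' * T) $$ (\<sigma> i, Suc i) = - ((T * B') $$ (\<sigma> i, Suc i))"
      unfolding BT using s ij T B'(2) by (subst index_smult_mat) auto
    then have "B' $$ (\<sigma> i, \<sigma> (Suc i)) * T $$ (\<sigma> (Suc i), Suc i) = - (T $$ (\<sigma> i, i) * B' $$ (i, Suc i))"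
      unfolding 1 2 .
    moreover have "B' $$ (i, Suc i) \<noteq> 0" using irred_up_nonzero[OF B'(1), of "Suc i"] i by (simp add: up_def)
    ultimately have "B' $$ (\<sigma> i, \<sigma> (Suc i)) \<noteq> 0" using \<sigma>(2)[OF ij(1)] by auto
    then have "\<not> (\<sigma> i > \<sigma> (Suc i) + 1 \<or> \<sigma> (Suc i) > \<sigma> i + 1)"
      using irred_tridiag[OF B'(1)] \<sigma>(1)[OF ij(1)] \<sigma>(1)[OF ij(2)] unfolding tridiag_mat_def by blast
    moreover have "\<sigma> i \<noteq> \<sigma> (Suc i)" using uniq'[OF ij] by (metis n_not_Suc_n)
    ultimately show ?thesis by arith
  qed
  have "(\<forall>i\<le>d. \<sigma> i = i) \<or> (\<forall>i\<le>d. \<sigma> i = d - i)"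
  proof (rule path_automorphism[of d \<sigma>])
    show "inj_on \<sigma> {..d}" using uniq' by (auto intro!: inj_onI)
    show "\<And>i. i \<le> d \<Longrightarrow> \<sigma> i \<le> d" by (fact \<sigma>(1))
    show "\<And>i. i < d \<Longrightarrow> \<sigma> (Suc i) = Suc (\<sigma> i) \<or> Suc (\<sigma> (Suc i)) = \<sigma> i" by (fact adj)
  qed
  moreover have "\<not> (\<forall>i\<le>d. \<sigma> i = i)"
  proof
    assume "\<forall>i\<le>d. \<sigma> i = i"
    then have "th j = - th j" if "j \<le> d" for j using th\<sigma>[OF that] that by simp
    then have "2 * th j = 0" if "j \<le> d" for j using that by (metis add.right_inverse mult_2)
    then have "th 0 = th 1" using eigform_char_not_2[OF A E d] d by auto
    then show False using inj_onD[OF e(5), of 0 1] d by simp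
  qed
  ultimately show "i \<le> d \<Longrightarrow> th (d - i) = - th i" using th\<sigma>[of i] by auto
qed

section \<open>The Askey-Wilson relations\<close>

lemma conj_add:
  fixes P Q M N :: "'a::field mat"
  assumes "P \<in> carrier_mat n n" "Q \<in> carrier_mat n n" "M \<in> carrier_mat n n" "N \<in> carrier_mat n n"
  shows "Q * (M + N) * P = Q * M * P + Q * N * P"
  using mult_add_distrib_mat[OF assms(2,3,4)]
    add_mult_distrib_mat[OF mult_carrier_mat[OF assms(2,3)] mult_carrier_mat[OF assms(2,4)] assms(1)]
  by simp

lemma conj_smult:
  fixes P Q M :: "'a::field mat"
  assumes "P \<in> carrier_mat n n" "Q \<in> carrier_mat n n" "M \<in> carrier_mat n n"
  shows "Q * (k \<cdot>\<^sub>m M) * P = k \<cdot>\<^sub>m (Q * M * P)"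
  using mult_smult_distrib[OF assms(2,3), of k]
    mult_smult_assoc_mat[OF mult_carrier_mat[OF assms(2,3)] assms(1), of k] by simp

lemma conj_inject:
  fixes P Q M N :: "'a::field mat"
  assumes P: "P \<in> carrier_mat n n" and Q: "Q \<in> carrier_mat n n" and PQ: "P * Q = 1\<^sub>m n"
    and M: "M \<in> carrier_mat n n" and N: "N \<in> carrier_mat n n" and eq: "Q * M * P = Q * N * P"
  shows "M = N"
proof -
  have r: "P * (Q * M * P) * Q = M" if M: "M \<in> carrier_mat n n" for M
  proof -
    have "P * (Q * M * P) * Q = (P * Q) * M * (P * Q)"
      using P Q M by (simp add: assoc_mult_mat[of _ n n _ n _ n] del: assoc_mult_mat)
    then show ?thesis using PQ M by simp
  qed
  have "M = P * (Q * M * P) * Q" by (rule r[OF M, symmetric])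
  also have "\<dots> = N" unfolding eq by (rule r[OF N])
  finally show ?thesis .
qed

lemma conj_carrier:
  assumes "P \<in> carrier_mat n n" "Q \<in> carrier_mat n n" "M \<in> carrier_mat n n"
  shows "Q * M * P \<in> carrier_mat n n"
  by (rule mult_carrier_mat[OF mult_carrier_mat[OF assms(2,3)] assms(1)])

text \<open>The part of the Askey-Wilson relation that is linear in B. The term A B + B A of the
  general relation has, up to sign, the coefficient
  \<open>th (i-1) - \<beta> * th i + th (Suc i)\<close>, which is zero for a spectrum symmetric
  about 0.\<close>

definition awm :: "'a::field \<Rightarrow> 'a \<Rightarrow> 'a mat \<Rightarrow> 'a mat \<Rightarrow> 'a mat" where
  "awm \<beta> \<rho> A B = A * (A * B) + B * (A * A) + (-\<beta>) \<cdot>\<^sub>m (A * (B * A)) + (-\<rho>) \<cdot>\<^sub>m B"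

lemma awm_carrier [intro]:
  "A \<in> carrier_mat n n \<Longrightarrow> B \<in> carrier_mat n n \<Longrightarrow> awm \<beta> \<rho> A B \<in> carrier_mat n n"
  unfolding awm_def by (intro add_carrier_mat smult_carrier_mat) auto

lemma index_awm:
  assumes A: "A \<in> carrier_mat n n" and B: "B \<in> carrier_mat n n" and ij: "i < n" "j < n"
  shows "awm \<beta> \<rho> A B $$ (i,j) = (A * (A * B)) $$ (i,j) + (B * (A * A)) $$ (i,j)
      - \<beta> * (A * (B * A)) $$ (i,j) - \<rho> * B $$ (i,j)"
  using assms unfolding awm_def by (simp del: index_mult_mat(1))

lemma awm_conj:
  fixes P Q A B :: "'a::field mat"
  assumes P: "P \<in> carrier_mat n n" and Q: "Q \<in> carrier_mat n n" and PQ: "P * Q = 1\<^sub>m n"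
    and A: "A \<in> carrier_mat n n" and B: "B \<in> carrier_mat n n"
  shows "Q * awm \<beta> \<rho> A B * P = awm \<beta> \<rho> (Q * A * P) (Q * B * P)"
proof -
  have AB: "A * B \<in> carrier_mat n n" "B * A \<in> carrier_mat n n" "A * A \<in> carrier_mat n n"
    using A B by auto
  have AAB: "A * (A * B) \<in> carrier_mat n n" "B * (A * A) \<in> carrier_mat n n" "A * (B * A) \<in> carrier_mat n n"
    using A B AB by auto
  note m = conj_mult[OF P Q PQ]
  show ?thesis unfolding awm_def
    using conj_add[OF P Q, of "A * (A * B) + B * (A * A) + (-\<beta>) \<cdot>\<^sub>m (A * (B * A))" "(-\<rho>) \<cdot>\<^sub>m B"]
      conj_add[OF P Q, of "A * (A * B) + B * (A * A)" "(-\<beta>) \<cdot>\<^sub>m (A * (B * A))"]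
      conj_add[OF P Q AAB(1,2)] conj_smult[OF P Q AAB(3), of "-\<beta>"] conj_smult[OF P Q B, of "-\<rho>"]
      m[OF A AB(1)] m[OF B AB(3)] m[OF A AB(2)] m[OF A B] m[OF A A] m[OF B A] AAB B
    by (metis add_carrier_mat smult_carrier_mat)
qed

lemma index_awm_diag:
  assumes B: "B \<in> carrier_mat (Suc d) (Suc d)" and ij: "i \<le> d" "j \<le> d"
  shows "awm \<beta> \<rho> (dg d th) B $$ (i,j)
    = (th i ^ 2 - \<beta> * th i * th j + th j ^ 2 - \<rho>) * B $$ (i,j)"
proof -
  let ?D = "dg d th" let ?n = "Suc d"
  have DB: "?D * B \<in> carrier_mat ?n ?n" "B * ?D \<in> carrier_mat ?n ?n" using B by auto
  have ij': "i < ?n" "j < ?n" using ij by auto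
  have "(B * (?D * ?D)) = (B * ?D) * ?D" using assoc_mult_mat[OF B dg_carrier dg_carrier] by simp
  then show ?thesis
    using dg_mult_left[OF DB(1) ij(1) ij'(2), of th] dg_mult_left[OF B ij(1) ij'(2), of th]
      dg_mult_left[OF DB(2) ij(1) ij'(2), of th]
      dg_mult_right[OF DB(2) ij'(1) ij(2), of th] dg_mult_right[OF B ij'(1) ij(2), of th]
    by (simp add: index_awm[OF dg_carrier B ij'] algebra_simps power2_eq_square del: index_mult_mat(1))
qed

lemma commute_add:
  fixes A M N :: "'a::field mat"
  assumes "A \<in> carrier_mat n n" "M \<in> carrier_mat n n" "N \<in> carrier_mat n n"
    and "A * M = M * A" "A * N = N * A"
  shows "A * (M + N) = (M + N) * A"
  using mult_add_distrib_mat[OF assms(1,2,3)] add_mult_distrib_mat[OF assms(2,3,1)] assms by simp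

lemma commute_smult:
  fixes A M :: "'a::field mat"
  assumes "A \<in> carrier_mat n n" "M \<in> carrier_mat n n" "A * M = M * A"
  shows "A * (k \<cdot>\<^sub>m M) = (k \<cdot>\<^sub>m M) * A"
  using mult_smult_distrib[OF assms(1,2), of k] mult_smult_assoc_mat[OF assms(2,1), of k] assms by simp

text \<open>The 0-th columns of A^2, A and the identity are triangular in the entries 2, 1, 0, so
  some quadratic polynomial in A has the same 0-th column as X. The difference commutes with A and
  therefore vanishes.\<close>

lemma commuting_band_quadratic:
  fixes A X :: "'a::field mat"
  assumes A: "irred_tridiag_mat d A" and X: "X \<in> carrier_mat (Suc d) (Suc d)" and d: "2 \<le> d"
    and comm: "A * X = X * A" and band: "\<And>i. 3 \<le> i \<Longrightarrow> i \<le> d \<Longrightarrow> X $$ (i,0) = 0"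
  shows "\<exists>c2 c1 c0. X = c2 \<cdot>\<^sub>m (A * A) + c1 \<cdot>\<^sub>m A + c0 \<cdot>\<^sub>m 1\<^sub>m (Suc d)"
proof -
  note T = irred_tridiag[OF A]
  have AC: "A \<in> carrier_mat (Suc d) (Suc d)" by (rule tridiag_carrier[OF T])
  have AA: "A * A \<in> carrier_mat (Suc d) (Suc d)" using AC by auto
  define c2 where "c2 = X $$ (2,0) / (A * A) $$ (2,0)"
  define c1 where "c1 = (X $$ (1,0) - c2 * (A * A) $$ (1,0)) / A $$ (1,0)"
  define c0 where "c0 = X $$ (0,0) - c2 * (A * A) $$ (0,0) - c1 * A $$ (0,0)"
  define Y where "Y = X + (-c2) \<cdot>\<^sub>m (A * A) + (-c1) \<cdot>\<^sub>m A + (-c0) \<cdot>\<^sub>m 1\<^sub>m (Suc d)"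
  have Y: "Y \<in> carrier_mat (Suc d) (Suc d)" unfolding Y_def using X AC by auto
  have Yi: "Y $$ (i,j) = X $$ (i,j) - c2 * (A * A) $$ (i,j) - c1 * A $$ (i,j) - (if i = j then c0 else 0)"
    if "i \<le> d" "j \<le> d" for i j
    using that X AC AA unfolding Y_def by (simp del: index_mult_mat(1))
  have A1: "A $$ (1,0) \<noteq> 0" using A d unfolding irred_tridiag_mat_def by force
  have Az: "A $$ (i,0) = 0" if "2 \<le> i" "i \<le> d" for i using T that unfolding tridiag_mat_def by force
  have AAi: "(A * A) $$ (i,0) = lo d A i * A $$ (i-1,0) + A $$ (i,i) * A $$ (i,0) + up d A (Suc i) * A $$ (Suc i,0)"
    if "i \<le> d" for i using tridiag_mult_left[OF T AC that, of 0] by simp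
  have up0: "up d A (Suc i) * A $$ (Suc i,0) = 0" if "1 \<le> i" "i \<le> d" for i
    using Az[of "Suc i"] that by (cases "i = d") auto
  have A2: "(A * A) $$ (2,0) \<noteq> 0"
    using AAi[of 2] up0[of 2] Az[of 2] d A1 irred_lo_nonzero[OF A, of 2] by auto
  have Azz: "(A * A) $$ (i,0) = 0" if "3 \<le> i" "i \<le> d" for i
    using AAi[of i] up0[of i] Az[of "i-1"] Az[of i] that by simp
  have "Y $$ (i,0) = 0" if i: "i \<le> d" for i
  proof -
    consider "i = 0" | "i = 1" | "i = 2" | "3 \<le> i" by linarith
    then show ?thesis
    proof cases
      case 1 then show ?thesis using Yi[of 0 0] by (simp add: c0_def)
    next
      case 2 then show ?thesis using Yi[of 1 0] A1 d by (simp add: c1_def)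
    next
      case 3 then show ?thesis using Yi[of 2 0] A2 Az[of 2] d by (simp add: c2_def)
    next
      case 4 then show ?thesis using Yi[of i 0] Az[of i] Azz[of i] band[of i] i by simp
    qed
  qed
  moreover have "A * Y = Y * A"
    unfolding Y_def using X AC AA comm
    by (intro commute_add[of A "Suc d"] commute_smult[of A "Suc d"]) auto
  ultimately have Y0: "Y $$ (i,j) = 0" if "i \<le> d" "j \<le> d" for i j
    using commuting_irred_col_zero[OF A Y] that by blast
  have "X = c2 \<cdot>\<^sub>m (A * A) + c1 \<cdot>\<^sub>m A + c0 \<cdot>\<^sub>m 1\<^sub>m (Suc d)"
  proof (rule eq_matI)
    fix i j assume "i < dim_row (c2 \<cdot>\<^sub>m (A * A) + c1 \<cdot>\<^sub>m A + c0 \<cdot>\<^sub>m 1\<^sub>m (Suc d))"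
      "j < dim_col (c2 \<cdot>\<^sub>m (A * A) + c1 \<cdot>\<^sub>m A + c0 \<cdot>\<^sub>m 1\<^sub>m (Suc d))"
    then have ij: "i \<le> d" "j \<le> d" by auto
    show "X $$ (i,j) = (c2 \<cdot>\<^sub>m (A * A) + c1 \<cdot>\<^sub>m A + c0 \<cdot>\<^sub>m 1\<^sub>m (Suc d)) $$ (i,j)"
      using Yi[OF ij] Y0[OF ij] ij X AC AA by (auto simp: algebra_simps simp del: index_mult_mat(1))
  qed (use X in auto)
  then show ?thesis by blast
qed

lemma zero_diag_parity_mult:
  assumes A: "zero_diag_TD d A" and N: "N \<in> carrier_mat (Suc d) (Suc d)"
    and par: "\<And>i j. i \<le> d \<Longrightarrow> j \<le> d \<Longrightarrow> even (i + j) = p \<Longrightarrow> N $$ (i,j) = 0"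
    and ij: "i \<le> d" "j \<le> d" "even (i + j) \<noteq> p"
  shows "(A * N) $$ (i,j) = 0"
proof (rule mult_col_zero[OF zero_diagD(3)[OF A] N])
  fix k assume k: "k < Suc d"
  show "A $$ (i,k) * N $$ (k,j) = 0"
  proof (cases "A $$ (i,k) = 0")
    case False
    then have "i = Suc k \<or> k = Suc i" using zero_diagD(5)[OF A] ij k by simp
    then have "even (k + j) = p" using ij(3) by auto
    then show ?thesis using par k ij by simp
  qed simp
qed (use ij in auto)

text \<open>A zero-diagonal tridiagonal matrix changes the parity of the index, and so does every
  term of \<open>awm\<close>, being a product of one or three of them.\<close>

lemma awm_even_zero:
  assumes A: "zero_diag_TD d A" and B: "zero_diag_TD d B" and ij: "i \<le> d" "j \<le> d" "even (i + j)"
  shows "awm \<beta> \<rho> A B $$ (i,j) = 0"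
proof -
  note a = zero_diagD[OF A] and b = zero_diagD[OF B]
  have pA: "A $$ (i,j) = 0" and pB: "B $$ (i,j) = 0" if "i \<le> d" "j \<le> d" "even (i+j) = True" for i j
  proof -
    have "\<not> (i = Suc j \<or> j = Suc i)" using that(3) by auto
    then show "A $$ (i,j) = 0" "B $$ (i,j) = 0"
      using a(5)[OF that(1,2)] b(5)[OF that(1,2)] by blast+
  qed
  have C: "A * A \<in> carrier_mat (Suc d) (Suc d)" "A * B \<in> carrier_mat (Suc d) (Suc d)"
     "B * A \<in> carrier_mat (Suc d) (Suc d)" using a(3) b(3) by auto
  have p2: "(A * A) $$ (i,j) = 0" "(A * B) $$ (i,j) = 0" "(B * A) $$ (i,j) = 0"
    if "i \<le> d" "j \<le> d" "even (i+j) = False" for i j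
    using zero_diag_parity_mult[OF A a(3) pA, where p = True] zero_diag_parity_mult[OF A b(3) pB, where p = True]
      zero_diag_parity_mult[OF B a(3) pA, where p = True] that by auto
  have "(A * (A * B)) $$ (i,j) = 0" "(B * (A * A)) $$ (i,j) = 0" "(A * (B * A)) $$ (i,j) = 0"
    using zero_diag_parity_mult[OF A C(2) p2(2), where p = False] zero_diag_parity_mult[OF B C(1) p2(1), where p = False]
      zero_diag_parity_mult[OF A C(3) p2(3), where p = False] ij by auto
  then show ?thesis using index_awm[OF a(3) b(3)] pB ij by simp
qed

text \<open>The quadratic form is a first integral of the linear recurrence, with constant value
  \<rho>. So the factor that \<open>index_awm_diag\<close> attaches to the entries next to the
  diagonal is zero.\<close>

lemma quadratic_invariant:
  fixes th :: "nat \<Rightarrow> 'a::comm_ring_1"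
  assumes "\<And>i. 1 \<le> i \<Longrightarrow> i < d \<Longrightarrow> th (i-1) + th (Suc i) = \<beta> * th i"
  shows "i < d \<Longrightarrow> th i ^ 2 - \<beta> * th i * th (Suc i) + th (Suc i) ^ 2
       = th 0 ^ 2 - \<beta> * th 0 * th 1 + th 1 ^ 2"
proof (induction i)
  case (Suc i)
  have r: "th (Suc (Suc i)) = \<beta> * th (Suc i) - th i"
    using assms[of "Suc i"] Suc.prems by (simp add: eq_diff_eq add.commute)
  have "th (Suc i) ^ 2 - \<beta> * th (Suc i) * th (Suc (Suc i)) + th (Suc (Suc i)) ^ 2
     = th i ^ 2 - \<beta> * th i * th (Suc i) + th (Suc i) ^ 2"
    unfolding r by (simp add: algebra_simps power2_eq_square)
  then show ?case using Suc by simp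
qed simp

text \<open>In the eigenbasis of A the matrix \<open>awm \<beta> \<rho> A B\<close> is diagonal, so
  it commutes with A; its narrow band in the eigenbasis of B makes it a quadratic polynomial in A;
  parity then removes the even terms of the polynomial.\<close>

lemma aw_relation:
  fixes A B :: "'a::field mat"
  assumes A: "zero_diag_TD d A" and B: "zero_diag_TD d B" and d: "3 \<le> d"
    and E: "eigform d A B th P Q" and Es: "eigform d B A ths Ps Qs"
    and rec: "\<And>i. 1 \<le> i \<Longrightarrow> i < d \<Longrightarrow> th (i-1) + th (Suc i) = \<beta> * th i"
    and \<rho>: "\<rho> = th 0 ^ 2 - \<beta> * th 0 * th 1 + th 1 ^ 2"
  shows "\<exists>\<omega>. awm \<beta> \<rho> A B = \<omega> \<cdot>\<^sub>m A"
proof -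
  let ?n = "Suc d"
  note a = zero_diagD[OF A] and b = zero_diagD[OF B] and e = eigformD[OF E] and es = eigformD[OF Es]
  let ?X = "awm \<beta> \<rho> A B"
  have X: "?X \<in> carrier_mat ?n ?n" using a(3) b(3) by auto
  define B' where "B' = Q * B * P"
  have B': "tridiag_mat d B'" "B' \<in> carrier_mat ?n ?n"
    using irred_tridiag[OF e(7)] tridiag_carrier[OF irred_tridiag[OF e(7)]] by (simp_all add: B'_def)
  have X': "Q * ?X * P = awm \<beta> \<rho> (dg d th) B'"
    using awm_conj[OF e(1,2,3) a(3) b(3)] e(6) by (simp add: B'_def)
  have X'0: "(Q * ?X * P) $$ (i,j) = 0" if ij: "i \<le> d" "j \<le> d" "i \<noteq> j" for i j
  proof -
    consider "B' $$ (i,j) = 0" | "j = Suc i" | "i = Suc j"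
      using B'(1) ij unfolding tridiag_mat_def by (metis Suc_eq_plus1 linorder_neqE_nat not_less_eq)
    then show ?thesis
    proof cases
      case 2
      have "th i ^ 2 - \<beta> * th i * th j + th j ^ 2 = \<rho>"
        using quadratic_invariant[of d th \<beta> i, OF rec] ij 2 \<rho> by simp
      then show ?thesis unfolding X' using index_awm_diag[OF B'(2) ij(1,2), of \<beta> \<rho> th] by simp
    next
      case 3
      have "th j ^ 2 - \<beta> * th j * th i + th i ^ 2 = \<rho>"
        using quadratic_invariant[of d th \<beta> j, OF rec] ij 3 \<rho> by simp
      then have "th i ^ 2 - \<beta> * th i * th j + th j ^ 2 = \<rho>" by (simp add: algebra_simps)
      then show ?thesis unfolding X' using index_awm_diag[OF B'(2) ij(1,2), of \<beta> \<rho> th] by simp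
    qed (simp add: X' index_awm_diag[OF B'(2) ij(1,2)])
  qed
  have X'C: "Q * ?X * P \<in> carrier_mat ?n ?n" by (rule conj_carrier[OF e(1,2) X])
  have "dg d th * (Q * ?X * P) = (Q * ?X * P) * dg d th"
  proof (rule eq_matI)
    fix i j assume "i < dim_row (Q * ?X * P * dg d th)" "j < dim_col (Q * ?X * P * dg d th)"
    then have ij: "i \<le> d" "j \<le> d" "i < ?n" "j < ?n" using X'C e(2) by auto
    show "(dg d th * (Q * ?X * P)) $$ (i,j) = (Q * ?X * P * dg d th) $$ (i,j)"
      using dg_mult_left[OF X'C ij(1,4), of th] dg_mult_right[OF X'C ij(3,2), of th] X'0[OF ij(1,2)]
      by (cases "i = j") simp_all
  qed (use X'C e(1,2) in auto)
  then have "Q * (A * ?X) * P = Q * (?X * A) * P"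
    unfolding conj_mult[OF e(1,2,3) a(3) X] conj_mult[OF e(1,2,3) X a(3)] e(6) .
  then have comm: "A * ?X = ?X * A"
    by (rule conj_inject[OF e(1,2,3) mult_carrier_mat[OF a(3) X] mult_carrier_mat[OF X a(3)]])
  \<comment> \<open>The given basis bounds the band only by 3, since both matrices are tridiagonal
    there. In the eigenbasis of B one of the three factors is diagonal, and the 0-th column stops at
    index 2.\<close>
  define A2 where "A2 = Qs * A * Ps"
  have A2: "irred_tridiag_mat d A2" "tridiag_mat d A2" "A2 \<in> carrier_mat ?n ?n"
    using es(7) irred_tridiag[OF es(7)] tridiag_carrier[OF irred_tridiag[OF es(7)]] by (simp_all add: A2_def)
  let ?D = "dg d ths"
  define X2 where "X2 = Qs * ?X * Ps"
  have X2C: "X2 \<in> carrier_mat ?n ?n" unfolding X2_def by (rule conj_carrier[OF es(1,2) X])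
  have X2: "X2 = awm \<beta> \<rho> A2 ?D"
    using awm_conj[OF es(1,2,3) a(3) b(3)] es(6) by (simp add: A2_def X2_def)
  have comm2: "A2 * X2 = X2 * A2"
    unfolding A2_def X2_def conj_mult[OF es(1,2,3) a(3) X, symmetric]
      conj_mult[OF es(1,2,3) X a(3), symmetric] comm ..
  have "X2 $$ (i,0) = 0" if i: "3 \<le> i" "i \<le> d" for i
  proof -
    have Az: "A2 $$ (k,0) = 0" if "2 \<le> k" "k \<le> d" for k using A2(2) that unfolding tridiag_mat_def by force
    have band: "(A2 * N) $$ (i,0) = 0" if N: "N \<in> carrier_mat ?n ?n" and Nz: "\<And>k. 2 \<le> k \<Longrightarrow> k \<le> d \<Longrightarrow> N $$ (k,0) = 0" for N
    proof -
      have "up d A2 (Suc i) * N $$ (Suc i, 0) = 0" using Nz[of "Suc i"] i by (cases "i = d") auto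
      then show ?thesis using tridiag_mult_left[OF A2(2) N i(2), of 0] Nz[of "i-1"] Nz[of i] i by simp
    qed
    have C: "A2 * ?D \<in> carrier_mat ?n ?n" "?D * A2 \<in> carrier_mat ?n ?n" "A2 * A2 \<in> carrier_mat ?n ?n" using A2(3) by auto
    have "(A2 * (A2 * ?D)) $$ (i,0) = 0"
      by (rule band[OF C(1)]) (use dg_mult_right[OF A2(3)] Az in auto)
    moreover have "(A2 * (?D * A2)) $$ (i,0) = 0"
      by (rule band[OF C(2)]) (use dg_mult_left[OF A2(3)] Az in auto)
    moreover have "(?D * (A2 * A2)) $$ (i,0) = 0"
      using dg_mult_left[OF C(3) i(2), of 0] band[OF A2(3) Az] by simp
    moreover have "?D $$ (i,0) = 0" using i by (simp add: dg_def)
    ultimately show ?thesis unfolding X2 using index_awm[OF A2(3) dg_carrier, of i 0] i by simp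
  qed
  then obtain c2 c1 c0 where c: "X2 = c2 \<cdot>\<^sub>m (A2 * A2) + c1 \<cdot>\<^sub>m A2 + c0 \<cdot>\<^sub>m 1\<^sub>m ?n"
    using commuting_band_quadratic[OF A2(1) X2C _ comm2] d by auto
  have AA: "A * A \<in> carrier_mat ?n ?n" using a(3) by auto
  let ?R = "c2 \<cdot>\<^sub>m (A * A) + c1 \<cdot>\<^sub>m A + c0 \<cdot>\<^sub>m 1\<^sub>m ?n"
  have one: "(1\<^sub>m ?n :: 'a mat) \<in> carrier_mat ?n ?n" by simp
  have R: "?R \<in> carrier_mat ?n ?n" using a(3) AA by auto
  have "Qs * ?R * Ps = Qs * (c2 \<cdot>\<^sub>m (A * A)) * Ps + Qs * (c1 \<cdot>\<^sub>m A) * Ps + Qs * (c0 \<cdot>\<^sub>m 1\<^sub>m ?n) * Ps"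
    using conj_add[OF es(1,2), of "c2 \<cdot>\<^sub>m (A * A) + c1 \<cdot>\<^sub>m A" "c0 \<cdot>\<^sub>m 1\<^sub>m ?n"]
      conj_add[OF es(1,2), of "c2 \<cdot>\<^sub>m (A * A)" "c1 \<cdot>\<^sub>m A"] a(3) AA one
    by (metis add_carrier_mat smult_carrier_mat)
  also have "\<dots> = X2"
    using conj_smult[OF es(1,2) AA, of c2] conj_smult[OF es(1,2) a(3), of c1]
      conj_smult[OF es(1,2) one, of c0] conj_mult[OF es(1,2,3) a(3) a(3)] es(2,4)
    by (simp add: c A2_def)
  finally have XR: "?X = ?R"
    by (intro conj_inject[OF es(1,2,3) X R]) (simp only: X2_def)
  have R': "?R $$ (i,j) = c2 * (A * A) $$ (i,j) + c1 * A $$ (i,j) + (if i = j then c0 else 0)"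
    if "i \<le> d" "j \<le> d" for i j
    using that a(3) AA by (simp del: index_mult_mat(1))
  \<comment> \<open>Entry (2,0) of \<open>awm\<close> vanishes by parity while that of A^2 does not,
    which forces c2 = 0; after that, entry (0,0) forces c0 = 0.\<close>
  have A20: "A $$ (2,0) = 0" using a(2) d unfolding tridiag_mat_def by force
  have A30: "A $$ (3,0) = 0" using a(2) d unfolding tridiag_mat_def by force
  have "(A * A) $$ (2,0) = lo d A 2 * A $$ (1,0)"
    using tridiag_mult_left[OF a(2) a(3), of 2 0] d A20 A30 by (simp add: numeral_eq_Suc)
  also have "\<dots> \<noteq> 0" using irred_lo_nonzero[OF a(1), of 2] irred_lo_nonzero[OF a(1), of 1] d by (simp add: lo_def)
  finally have "(A * A) $$ (2,0) \<noteq> 0" .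
  moreover have "c2 * (A * A) $$ (2,0) = 0"
    using R'[of 2 0] awm_even_zero[OF A B, of 2 0 \<beta> \<rho>] A20 XR d by simp
  ultimately have "c2 = 0" by simp
  moreover from this have "c0 = 0"
    using R'[of 0 0] awm_even_zero[OF A B, of 0 0 \<beta> \<rho>] a(4)[of 0] XR by simp
  ultimately have "?X = c1 \<cdot>\<^sub>m A" using XR a(3) by (auto simp: intro!: eq_matI)
  then show ?thesis by blast
qed

section \<open>Entries of the Askey-Wilson relations\<close>

lemma zero_diag_mult_left:
  assumes "zero_diag_TD d M" "N \<in> carrier_mat (Suc d) m" "i \<le> d" "j < m"
  shows "(M * N) $$ (i,j) = lo d M i * N $$ (i-1,j) + up d M (Suc i) * N $$ (Suc i,j)"
  using tridiag_mult_left[OF zero_diagD(2)[OF assms(1)] assms(2,3,4)] zero_diagD(4)[OF assms(1,3)]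
  by simp

lemma zero_diag_entry:
  assumes "zero_diag_TD d M" "i \<le> d" "j \<le> d"
  shows "M $$ (i,j) = (if i = Suc j then lo d M i else if j = Suc i then up d M j else 0)"
  using zero_diagD(5)[OF assms] assms(2,3) by (auto simp: lo_def up_def)

lemma zero_diag_triple_sub:
  assumes M: "zero_diag_TD d M" and N: "zero_diag_TD d N" and K: "zero_diag_TD d K"
    and i: "1 \<le> i" "i \<le> d"
  shows "(M * (N * K)) $$ (i,i-1) = lo d M i * (lo d N (i-1) * up d K (i-1) + up d N i * lo d K i)
      + up d M (Suc i) * (lo d N (Suc i) * lo d K i)"
proof -
  note KC = zero_diagD(3)[OF K]
  have NK: "N * K \<in> carrier_mat (Suc d) (Suc d)" using zero_diagD(3)[OF N] KC by auto
  have 1: "(N * K) $$ (i-1,i-1) = lo d N (i-1) * up d K (i-1) + up d N i * lo d K i"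
    using zero_diag_mult_left[OF N KC, of "i-1" "i-1"] i zero_diag_entry[OF K, of "i-1-1" "i-1"]
      zero_diag_entry[OF K, of i "i-1"] by (cases "i = 1") auto
  have 2: "up d M (Suc i) * (N * K) $$ (Suc i,i-1) = up d M (Suc i) * (lo d N (Suc i) * lo d K i)"
  proof (cases "i = d")
    case False
    have "up d N (Suc (Suc i)) * K $$ (Suc (Suc i), i-1) = 0"
      using zero_diag_entry[OF K, of "Suc (Suc i)" "i-1"] i False by (cases "Suc i = d") auto
    then show ?thesis
      using zero_diag_mult_left[OF N KC, of "Suc i" "i-1"] i False zero_diag_entry[OF K, of i "i-1"] by simp
  qed simp
  show ?thesis using zero_diag_mult_left[OF M NK, of i "i-1"] i 1 2 by simp
qed

lemma zero_diag_triple_subsub: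
  assumes M: "zero_diag_TD d M" and N: "zero_diag_TD d N" and K: "zero_diag_TD d K"
    and i: "2 \<le> i" "i < d"
  shows "(M * (N * K)) $$ (Suc i,i-2) = lo d M (Suc i) * (lo d N i * lo d K (i-1))"
proof -
  note KC = zero_diagD(3)[OF K]
  have NK: "N * K \<in> carrier_mat (Suc d) (Suc d)" using zero_diagD(3)[OF N] KC by auto
  have 1: "(N * K) $$ (i,i-2) = lo d N i * lo d K (i-1)"
    using zero_diag_mult_left[OF N KC, of "i" "i-2"] i zero_diag_entry[OF K, of "i-1" "i-2"]
      zero_diag_entry[OF K, of "Suc i" "i-2"] by auto
  have 2: "up d M (Suc (Suc i)) * (N * K) $$ (Suc (Suc i),i-2) = 0"
  proof (cases "Suc i = d")
    case False
    have "up d N (Suc (Suc (Suc i))) * K $$ (Suc (Suc (Suc i)), i-2) = 0"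
      using zero_diag_entry[OF K, of "Suc (Suc (Suc i))" "i-2"] i False by (cases "Suc (Suc i) = d") auto
    then show ?thesis
      using zero_diag_mult_left[OF N KC, of "Suc (Suc i)" "i-2"] i False zero_diag_entry[OF K, of "Suc i" "i-2"] by auto
  qed simp
  show ?thesis using zero_diag_mult_left[OF M NK, of "Suc i" "i-2"] i 1 2 by auto
qed

text \<open>The super-diagonal versions of all entry identities follow by transposition.\<close>

lemma transpose_zero_diag:
  "zero_diag_TD d A \<Longrightarrow> zero_diag_TD d (transpose_mat A)"
  using irred_tridiag_transpose[of d A] unfolding zero_diag_TD_def
  by (auto simp: irred_tridiag_mat_def tridiag_mat_def)

lemma lo_transpose: "A \<in> carrier_mat (Suc d) (Suc d) \<Longrightarrow> lo d (transpose_mat A) = up d A"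
  and up_transpose: "A \<in> carrier_mat (Suc d) (Suc d) \<Longrightarrow> up d (transpose_mat A) = lo d A"
  by (auto simp: lo_def up_def fun_eq_iff)

lemma awm_transpose:
  fixes A B :: "'a::field mat"
  assumes A: "A \<in> carrier_mat n n" and B: "B \<in> carrier_mat n n"
  shows "awm \<beta> \<rho> (transpose_mat A) (transpose_mat B) = transpose_mat (awm \<beta> \<rho> A B)"
proof -
  have C: "A * B \<in> carrier_mat n n" "B * A \<in> carrier_mat n n" "A * A \<in> carrier_mat n n"
    "transpose_mat A \<in> carrier_mat n n" "transpose_mat B \<in> carrier_mat n n" using A B by auto
  have t: "transpose_mat A * (transpose_mat A * transpose_mat B) = transpose_mat (B * (A * A))"
    "transpose_mat B * (transpose_mat A * transpose_mat A) = transpose_mat (A * (A * B))"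
    "transpose_mat A * (transpose_mat B * transpose_mat A) = transpose_mat (A * (B * A))"
    using transpose_mult[OF B C(3)] transpose_mult[OF A C(1)] transpose_mult[OF A C(2)]
      transpose_mult[OF A A] transpose_mult[OF A B] transpose_mult[OF B A]
      assoc_mult_mat[OF C(5,4,4)] assoc_mult_mat[OF C(4,4,5)] assoc_mult_mat[OF C(4,5,4)] by simp_all
  show ?thesis
  proof (rule eq_matI)
    fix i j assume "i < dim_row (transpose_mat (awm \<beta> \<rho> A B))" "j < dim_col (transpose_mat (awm \<beta> \<rho> A B))"
    then have ij: "i < n" "j < n" using awm_carrier[OF A B, of \<beta> \<rho>] by auto
    show "awm \<beta> \<rho> (transpose_mat A) (transpose_mat B) $$ (i,j) = transpose_mat (awm \<beta> \<rho> A B) $$ (i,j)"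
      using index_awm[OF C(4,5) ij, of \<beta> \<rho>] index_awm[OF A B ij(2,1), of \<beta> \<rho>] ij A B C
        awm_carrier[OF A B, of \<beta> \<rho>]
      by (simp add: t del: index_mult_mat(1))
  qed (use awm_carrier[OF A B, of \<beta> \<rho>] awm_carrier[OF C(4,5), of \<beta> \<rho>] in auto)
qed

lemma eigform_transpose:
  assumes E: "eigform d A B th P Q" and A: "A \<in> carrier_mat (Suc d) (Suc d)" and B: "B \<in> carrier_mat (Suc d) (Suc d)"
  shows "eigform d (transpose_mat A) (transpose_mat B) th (transpose_mat Q) (transpose_mat P)"
    and "(transpose_mat P * transpose_mat B * transpose_mat Q) = transpose_mat (Q * B * P)"
proof -
  note e = eigformD[OF E]
  have t: "transpose_mat P * transpose_mat M * transpose_mat Q = transpose_mat (Q * M * P)"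
    if M: "M \<in> carrier_mat (Suc d) (Suc d)" for M
    using transpose_mult[OF mult_carrier_mat[OF e(2) M] e(1)] transpose_mult[OF e(2) M]
      assoc_mult_mat[of "transpose_mat P" "Suc d" "Suc d" "transpose_mat M" "Suc d" "transpose_mat Q" "Suc d"] e(1,2) M
    by simp
  show "transpose_mat P * transpose_mat B * transpose_mat Q = transpose_mat (Q * B * P)" by (rule t[OF B])
  show "eigform d (transpose_mat A) (transpose_mat B) th (transpose_mat Q) (transpose_mat P)"
    unfolding eigform_def t[OF A] t[OF B] e(6)
  proof (intro conjI)
    show "transpose_mat Q * transpose_mat P = 1\<^sub>m (Suc d)" "transpose_mat P * transpose_mat Q = 1\<^sub>m (Suc d)"
      unfolding transpose_mult[OF e(1,2), symmetric] transpose_mult[OF e(2,1), symmetric] e(3,4) by simp_all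
    show "transpose_mat (dg d th) = mat (Suc d) (Suc d) (\<lambda>(i,j). if i = j then th i else 0)"
      by (rule eq_matI) (auto simp: dg_def)
  qed (use e(1,2,5) irred_tridiag_transpose[OF e(7)] in auto)
qed

text \<open>Ratios of the off-diagonal entries are invariant under conjugation by diagonal matrices.
  All three functions vanish at the indices 0 and d+1.\<close>

definition xr :: "nat \<Rightarrow> 'a::field mat \<Rightarrow> 'a mat \<Rightarrow> nat \<Rightarrow> 'a" where "xr d A B i = lo d B i / lo d A i"
definition yr :: "nat \<Rightarrow> 'a::field mat \<Rightarrow> 'a mat \<Rightarrow> nat \<Rightarrow> 'a" where "yr d A B i = up d B i / up d A i"
definition zr :: "nat \<Rightarrow> 'a::field mat \<Rightarrow> nat \<Rightarrow> 'a" where "zr d A i = lo d A i * up d A i"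

lemma lo_xr: "zero_diag_TD d A \<Longrightarrow> lo d B i = xr d A B i * lo d A i"
  using irred_lo_nonzero[of d A i] zero_diagD(1)[of d A] by (auto simp: xr_def lo_def)

lemma up_yr: "zero_diag_TD d A \<Longrightarrow> up d B i = yr d A B i * up d A i"
  using irred_up_nonzero[of d A i] zero_diagD(1)[of d A] by (auto simp: yr_def up_def)

text \<open>The two clauses are the entries (i+1, i-2) and (i, i-1) of the Askey-Wilson relation,
  each divided by the subdiagonal entries of A that it contains as a common factor. Exchanging x and
  y gives the entries above the diagonal.\<close>

definition aw_eqs :: "nat \<Rightarrow> (nat \<Rightarrow> 'a::field) \<Rightarrow> (nat \<Rightarrow> 'a) \<Rightarrow> (nat \<Rightarrow> 'a) \<Rightarrow> 'a \<Rightarrow> 'a \<Rightarrow> 'a \<Rightarrow> bool" where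
  "aw_eqs d x y z \<beta> \<rho> \<omega> \<longleftrightarrow>
    (\<forall>i. 2 \<le> i \<and> i < d \<longrightarrow> x (i-1) + x (Suc i) = \<beta> * x i) \<and>
    (\<forall>i. 1 \<le> i \<and> i \<le> d \<longrightarrow> z (i-1) * (x i + y (i-1) - \<beta> * x (i-1)) + z i * (2 * x i - \<beta> * y i)
        + z (Suc i) * (x i + y (Suc i) - \<beta> * x (Suc i)) = \<rho> * x i + \<omega>)"

lemma awm_entries:
  fixes A B :: "'a::field mat"
  assumes A: "zero_diag_TD d A" and B: "zero_diag_TD d B" and W: "awm \<beta> \<rho> A B = \<omega> \<cdot>\<^sub>m A"
  shows "aw_eqs d (xr d A B) (yr d A B) (zr d A) \<beta> \<rho> \<omega>"
proof -
  note a = zero_diagD[OF A] and b = zero_diagD[OF B]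
  define x where "x = xr d A B"
  define y where "y = yr d A B"
  have lB: "lo d B i = x i * lo d A i" and uB: "up d B i = y i * up d A i" for i
    using lo_xr[OF A, of B i] up_yr[OF A, of B i] by (simp_all add: x_def y_def)
  have W': "(A * (A * B)) $$ (i,j) + (B * (A * A)) $$ (i,j) - \<beta> * (A * (B * A)) $$ (i,j) - \<rho> * B $$ (i,j)
     = \<omega> * A $$ (i,j)" if "i \<le> d" "j \<le> d" for i j
    using index_awm[OF a(3) b(3), of i j \<beta> \<rho>] W that a(3) by simp
  have 1: "x (i-1) + x (Suc i) = \<beta> * x i" if i: "2 \<le> i" "i < d" for i
  proof -
    have "lo d A (Suc i) * (lo d A i * lo d A (i-1)) * (x (i-1) + x (Suc i)) = lo d A (Suc i) * (lo d A i * lo d A (i-1)) * (\<beta> * x i)"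
      using W'[of "Suc i" "i-2"] i zero_diag_triple_subsub[OF A A B i] zero_diag_triple_subsub[OF B A A i]
        zero_diag_triple_subsub[OF A B A i] zero_diag_entry[OF A, of "Suc i" "i-2"] zero_diag_entry[OF B, of "Suc i" "i-2"]
      by (auto simp: lB algebra_simps)
    moreover have "lo d A (Suc i) * (lo d A i * lo d A (i-1)) \<noteq> 0"
      using i irred_lo_nonzero[OF a(1)] by auto
    ultimately show ?thesis by (metis mult_cancel_left)
  qed
  have 2: "zr d A (i-1) * (x i + y (i-1) - \<beta> * x (i-1)) + zr d A i * (2 * x i - \<beta> * y i)
        + zr d A (Suc i) * (x i + y (Suc i) - \<beta> * x (Suc i)) = \<rho> * x i + \<omega>" (is "?L = ?R")
    if i: "1 \<le> i" "i \<le> d" for i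
  proof -
    have "lo d A i * ?L = lo d A i * ?R"
      using W'[of i "i-1"] i zero_diag_triple_sub[OF A A B i] zero_diag_triple_sub[OF B A A i]
        zero_diag_triple_sub[OF A B A i] zero_diag_entry[OF A, of i "i-1"] zero_diag_entry[OF B, of i "i-1"]
      by (simp add: lB uB zr_def algebra_simps)
    then show ?thesis using i irred_lo_nonzero[OF a(1)] by (metis mult_cancel_left)
  qed
  show ?thesis unfolding aw_eqs_def using 1 2 unfolding x_def y_def by blast
qed

lemma xr_transpose:
  assumes "A \<in> carrier_mat (Suc d) (Suc d)" "B \<in> carrier_mat (Suc d) (Suc d)"
  shows "xr d (transpose_mat A) (transpose_mat B) = yr d A B" "yr d (transpose_mat A) (transpose_mat B) = xr d A B"
    "zr d (transpose_mat A) = zr d A"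
  using lo_transpose[OF assms(1)] lo_transpose[OF assms(2)] up_transpose[OF assms(1)] up_transpose[OF assms(2)]
  by (auto simp: xr_def yr_def zr_def fun_eq_iff)

lemma awm_entries_transpose:
  fixes A B :: "'a::field mat"
  assumes A: "zero_diag_TD d A" and B: "zero_diag_TD d B" and W: "awm \<beta> \<rho> A B = \<omega> \<cdot>\<^sub>m A"
  shows "aw_eqs d (yr d A B) (xr d A B) (zr d A) \<beta> \<rho> \<omega>"
proof -
  note a = zero_diagD[OF A] and b = zero_diagD[OF B]
  have "awm \<beta> \<rho> (transpose_mat A) (transpose_mat B) = \<omega> \<cdot>\<^sub>m transpose_mat A"
    using awm_transpose[OF a(3) b(3), of \<beta> \<rho>] W a(3) by (auto intro!: eq_matI)
  from awm_entries[OF transpose_zero_diag[OF A] transpose_zero_diag[OF B] this] show ?thesis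
    unfolding xr_transpose[OF a(3) b(3)] .
qed

text \<open>Row 0 of Q is a left eigenvector w of A. Since only E_0 and E_1 occur in w B, the row
  w B (A - th 1) is a multiple of w; this is its 0-th entry.\<close>

lemma corner_equation:
  fixes A B :: "'a::field mat"
  assumes A: "zero_diag_TD d A" and B: "zero_diag_TD d B" and d: "2 \<le> d"
    and E: "eigform d A B th P Q"
  shows "(yr d A B 1 - xr d A B 2) * zr d A 1 + xr d A B 2 * th 0 ^ 2 - th 0 * th 1 * xr d A B 1
     = (Q * B * P) $$ (0,0) * (th 0 - th 1)"
proof -
  note a = zero_diagD[OF A] and b = zero_diagD[OF B] and e = eigformD[OF E]
  define B' where "B' = Q * B * P"
  have B': "tridiag_mat d B'" "B' \<in> carrier_mat (Suc d) (Suc d)"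
    using irred_tridiag[OF e(7)] tridiag_carrier[OF irred_tridiag[OF e(7)]] by (simp_all add: B'_def)
  have MQ: "Q * M = (Q * M * P) * Q" if M: "M \<in> carrier_mat (Suc d) (Suc d)" for M
  proof -
    have "(Q * M * P) * Q = Q * M * (P * Q)"
      using e(1,2) M by (simp add: assoc_mult_mat[of _ "Suc d" "Suc d" _ "Suc d" _ "Suc d"] del: assoc_mult_mat)
    then show ?thesis using e(2,3) M by simp
  qed
  have QA: "Q * A = dg d th * Q" using MQ[OF a(3)] e(6) by simp
  have QB: "Q * B = B' * Q" using MQ[OF b(3)] by (simp add: B'_def)
  have eigQ: "(Q * A) $$ (k,j) = th k * Q $$ (k,j)" if "k \<le> d" "j \<le> d" for k j
    unfolding QA using dg_mult_left[OF e(2), of k j th] that by simp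
  have col: "(Q * M) $$ (k,0) = Q $$ (k,1) * lo d M 1"
     "(Q * M) $$ (k,1) = Q $$ (k,0) * up d M 1 + Q $$ (k,2) * lo d M 2"
    if "zero_diag_TD d M" "k \<le> d" for M k
    using tridiag_mult_right[OF zero_diagD(2)[OF that(1)] e(2), of k 0]
      tridiag_mult_right[OF zero_diagD(2)[OF that(1)] e(2), of k 1] that d zero_diagD(4)[OF that(1)]
    by (simp_all add: numeral_2_eq_2)
  have row: "(B' * Q) $$ (0,j) = B' $$ (0,0) * Q $$ (0,j) + up d B' 1 * Q $$ (1,j)" if "j \<le> d" for j
    using tridiag_mult_left[OF B'(1) e(2), of 0 j] that by simp
  have Q0: "Q $$ (0,0) \<noteq> 0"
  proof
    assume z: "Q $$ (0,0) = 0"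
    have "Q $$ (0,i) = 0" if "i \<le> d" for i
      by (rule irred_left_eigenvector_zero[OF a(1) e(2) _ _ z that, of "th 0"]) (use eigQ in auto)
    then have "(Q * P) $$ (0,0) = 0" by (intro mult_col_zero[OF e(2,1)]) auto
    then show False using e(4) by simp
  qed
  define q0 q1 q2 r0 r1 where "q0 = Q $$ (0,0)" and "q1 = Q $$ (0,1)" and "q2 = Q $$ (0,2)"
    and "r0 = Q $$ (1,0)" and "r1 = Q $$ (1,1)"
  define l1 l2 u1 where "l1 = lo d A 1" and "l2 = lo d A 2" and "u1 = up d A 1"
  define x1 x2 y1 where "x1 = xr d A B 1" and "x2 = xr d A B 2" and "y1 = yr d A B 1"
  define b0 b1 where "b0 = B' $$ (0,0)" and "b1 = up d B' 1"
  have lB: "lo d B 1 = x1 * l1" "lo d B 2 = x2 * l2" "up d B 1 = y1 * u1"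
    unfolding x1_def x2_def y1_def l1_def l2_def u1_def by (rule lo_xr[OF A] up_yr[OF A])+
  have l: "l1 \<noteq> 0" "l2 \<noteq> 0" using irred_lo_nonzero[OF a(1)] d by (auto simp: l1_def l2_def)
  have 1: "q1 * l1 = th 0 * q0" "q0 * u1 + q2 * l2 = th 0 * q1" "r1 * l1 = th 1 * r0"
    using eigQ[of 0 0] eigQ[of 0 1] eigQ[of 1 0] col(1)[OF A, of 0] col(2)[OF A, of 0] col(1)[OF A, of 1] d
    by (simp_all add: q0_def q1_def q2_def r0_def r1_def l1_def l2_def u1_def del: index_mult_mat(1))
  have 2: "q1 * (x1 * l1) = b0 * q0 + b1 * r0" "q0 * (y1 * u1) + q2 * (x2 * l2) = b0 * q1 + b1 * r1"
    using col(1)[OF B, of 0] col(2)[OF B, of 0] row[of 0] row[of 1] d QB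
    by (simp_all add: q0_def q1_def q2_def r0_def r1_def b0_def b1_def lB[symmetric] del: index_mult_mat(1))
  \<comment> \<open>Row 1 of Q enters only through \<open>r1 * l1 - th 1 * r0\<close>, with the
    factor b1, and this is 0 by the eigenvalue equation for \<open>th 1\<close>.\<close>
  have "q0 * ((y1 - x2) * (l1 * u1) + x2 * th 0 ^ 2 - th 0 * th 1 * x1) = q0 * (b0 * (th 0 - th 1))"
  proof -
    have "q0 * ((y1 - x2) * (l1 * u1) + x2 * th 0 ^ 2 - th 0 * th 1 * x1)
       = l1 * (q0 * (y1 * u1)) + x2 * (th 0 * (th 0 * q0) - l1 * (q0 * u1)) - th 1 * x1 * (th 0 * q0)"
      by (simp add: algebra_simps power2_eq_square)
    also have "\<dots> = l1 * (q0 * (y1 * u1)) + x2 * (th 0 * (q1 * l1) - l1 * (th 0 * q1 - q2 * l2)) - th 1 * (q1 * (x1 * l1))"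
    proof -
      have "q0 * u1 = th 0 * q1 - q2 * l2" using 1(2) by (simp add: eq_diff_eq)
      show ?thesis unfolding 1(1)[symmetric] \<open>q0 * u1 = _\<close> by (simp add: algebra_simps)
    qed
    also have "\<dots> = l1 * (q0 * (y1 * u1) + q2 * (x2 * l2)) - th 1 * (q1 * (x1 * l1))"
      by (simp add: algebra_simps)
    also have "\<dots> = b0 * (q1 * l1) + b1 * (r1 * l1) - th 1 * (b0 * q0 + b1 * r0)"
      unfolding 2 by (simp add: algebra_simps)
    also have "\<dots> = q0 * (b0 * (th 0 - th 1))"
      unfolding 1(1,3) by (simp add: algebra_simps)
    finally show ?thesis .
  qed
  then show ?thesis using Q0 by (simp add: q0_def b0_def l1_def u1_def x1_def x2_def y1_def zr_def B'_def)
qed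

text \<open>Transposition exchanges x and y but keeps z, the eigenvalues and the diagonal entries of
  B in the eigenbasis. Hence the right-hand side is the same number as in
  \<open>corner_equation\<close>, and the difference of the two equations is free of it.\<close>

lemma corner_equation_transpose:
  fixes A B :: "'a::field mat"
  assumes A: "zero_diag_TD d A" and B: "zero_diag_TD d B" and d: "2 \<le> d"
    and E: "eigform d A B th P Q"
  shows "(xr d A B 1 - yr d A B 2) * zr d A 1 + yr d A B 2 * th 0 ^ 2 - th 0 * th 1 * yr d A B 1
     = (Q * B * P) $$ (0,0) * (th 0 - th 1)"
proof -
  note a = zero_diagD[OF A] and b = zero_diagD[OF B] and e = eigformD[OF E]
  have "(transpose_mat P * transpose_mat B * transpose_mat Q) $$ (0,0) = (Q * B * P) $$ (0,0)"
    unfolding eigform_transpose(2)[OF E a(3) b(3)] using e(1,2) by simp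
  then show ?thesis
    using corner_equation[OF transpose_zero_diag[OF A] transpose_zero_diag[OF B] d eigform_transpose(1)[OF E a(3) b(3)]]
    unfolding xr_transpose[OF a(3) b(3)] by simp
qed

section \<open>Both Askey-Wilson relations in the eigenbasis of A\<close>

text \<open>These are the entry (i,i) of the first relation and the entries (i,i) and (i,i+1) of the
  second, the last one divided by a superdiagonal entry. The products \<open>p\<close> do not depend
  on the scaling of the eigenvectors, and irreducibility of B says that they are nonzero.\<close>

lemma eigenbasis_equations:
  fixes A B :: "'a::field mat"
  assumes A: "zero_diag_TD d A" and B: "zero_diag_TD d B" and E: "eigform d A B th P Q"
    and W: "awm \<beta> \<rho> A B = \<omega> \<cdot>\<^sub>m A" and Ws: "awm \<beta> \<rho>s B A = \<omega>s \<cdot>\<^sub>m B"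
  defines "al \<equiv> \<lambda>i. (Q * B * P) $$ (i,i)" and "p \<equiv> \<lambda>i. lo d (Q * B * P) i * up d (Q * B * P) i"
  shows "i \<le> d \<Longrightarrow> ((2 - \<beta>) * th i ^ 2 - \<rho>) * al i = \<omega> * th i"
    and "i \<le> d \<Longrightarrow> 2 * th i * (p i + al i ^ 2 + p (Suc i)) - \<beta> * (th (i-1) * p i + th i * al i ^ 2
          + th (Suc i) * p (Suc i)) - \<rho>s * th i = \<omega>s * al i"
    and "1 \<le> i \<Longrightarrow> i < d \<Longrightarrow> (al i + al (Suc i)) * (th i + th (Suc i)) - \<beta> * (al i * th i + al (Suc i) * th (Suc i)) = \<omega>s"
    and "1 \<le> i \<Longrightarrow> i \<le> d \<Longrightarrow> p i \<noteq> 0" and "p 0 = 0"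
proof -
  let ?n = "Suc d" let ?D = "dg d th"
  note a = zero_diagD[OF A] and b = zero_diagD[OF B] and e = eigformD[OF E]
  define B' where "B' = Q * B * P"
  have B': "irred_tridiag_mat d B'" "tridiag_mat d B'" "B' \<in> carrier_mat (Suc d) (Suc d)"
    using e(7) irred_tridiag[OF e(7)] tridiag_carrier[OF irred_tridiag[OF e(7)]] by (simp_all add: B'_def)
  have al: "al i = B' $$ (i,i)" and p: "p i = lo d B' i * up d B' i" for i
    by (simp_all add: al_def p_def B'_def)
  have 1: "awm \<beta> \<rho> ?D B' = \<omega> \<cdot>\<^sub>m ?D"
    using awm_conj[OF e(1,2,3) a(3) b(3), of \<beta> \<rho>] W conj_smult[OF e(1,2) a(3), of \<omega>] e(6) by (simp add: B'_def)
  have 2: "awm \<beta> \<rho>s B' ?D = \<omega>s \<cdot>\<^sub>m B'"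
    using awm_conj[OF e(1,2,3) b(3) a(3), of \<beta> \<rho>s] Ws conj_smult[OF e(1,2) b(3), of \<omega>s] e(6) by (simp add: B'_def)
  have C: "B' * ?D \<in> carrier_mat ?n ?n" "?D * B' \<in> carrier_mat ?n ?n" "B' * B' \<in> carrier_mat ?n ?n" using B'(3) by auto
  have BBD: "B' * (B' * ?D) = (B' * B') * ?D" using assoc_mult_mat[OF B'(3,3) dg_carrier] by simp
  have Di: "?D $$ (i,j) = (if i = j then th i else 0)" if "i \<le> d" "j \<le> d" for i j
    using that by (simp add: dg_def)
  have ent: "(B' * B') $$ (i,j) * th j + th i * (B' * B') $$ (i,j) - \<beta> * (B' * (?D * B')) $$ (i,j)
     - \<rho>s * ?D $$ (i,j) = \<omega>s * B' $$ (i,j)" if "i \<le> d" "j \<le> d" for i j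
  proof -
    have ij: "i < ?n" "j < ?n" using that by auto
    show ?thesis
      using index_awm[OF B'(3) dg_carrier ij, of \<beta> \<rho>s th] 2 BBD dg_mult_right[OF C(3) ij(1) that(2), of th]
        dg_mult_left[OF C(3) that(1) ij(2), of th] B'(3) ij by simp
  qed
  have up_lo: "B' $$ (i-1,i) = up d B' i" "B' $$ (i,i-1) = lo d B' i" if "1 \<le> i" "i \<le> d" for i
    using that by (auto simp: up_def lo_def)
  { assume i: "i \<le> d"
    have "awm \<beta> \<rho> ?D B' $$ (i,i) = \<omega> * th i" unfolding 1 using i Di[OF i i] by simp
    then show "((2 - \<beta>) * th i ^ 2 - \<rho>) * al i = \<omega> * th i"
      using index_awm_diag[OF B'(3) i i, of \<beta> \<rho> th] by (simp add: al algebra_simps power2_eq_square) }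
  { assume i: "i \<le> d"
    have s1: "lo d B' i * B' $$ (i-1,i) = p i"
      using up_lo[of i] i by (cases "i = 0") (simp_all add: p)
    have s2: "up d B' (Suc i) * B' $$ (Suc i,i) = p (Suc i)"
      using up_lo[of "Suc i"] i by (cases "i = d") (simp_all add: p)
    have s3: "lo d B' i * (?D * B') $$ (i-1,i) = th (i-1) * p i"
      using s1 dg_mult_left[OF B'(3), of "i-1" i th] i by (simp add: mult.left_commute)
    have s4: "up d B' (Suc i) * (?D * B') $$ (Suc i,i) = th (Suc i) * p (Suc i)"
      using s2 dg_mult_left[OF B'(3), of "Suc i" i th] i by (cases "i = d") (simp_all add: mult.left_commute p)
    have s5: "(?D * B') $$ (i,i) = th i * al i"
      using dg_mult_left[OF B'(3), of i i th] i by (simp add: al)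
    have BB: "(B' * B') $$ (i,i) = p i + al i ^ 2 + p (Suc i)"
      using tridiag_mult_left[OF B'(2,3), of i i] i s1 s2 by (simp add: al power2_eq_square)
    have BDB: "(B' * (?D * B')) $$ (i,i) = th (i-1) * p i + th i * al i ^ 2 + th (Suc i) * p (Suc i)"
      using tridiag_mult_left[OF B'(2) C(2), of i i] i s3 s4 s5 by (simp add: al power2_eq_square mult.left_commute)
    show "2 * th i * (p i + al i ^ 2 + p (Suc i)) - \<beta> * (th (i-1) * p i + th i * al i ^ 2
          + th (Suc i) * p (Suc i)) - \<rho>s * th i = \<omega>s * al i"
      using ent[OF i i] BB BDB Di[OF i i] by (simp add: al algebra_simps) }
  { assume i: "1 \<le> i" "i < d"
    define u where "u = up d B' (Suc i)"
    have u: "B' $$ (i,Suc i) = u" using up_lo(1)[of "Suc i"] i by (simp add: u_def)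
    have u0: "u \<noteq> 0" using irred_up_nonzero[OF B'(1), of "Suc i"] i by (simp add: u_def)
    have z: "B' $$ (i-1, Suc i) = 0" using B'(2) i unfolding tridiag_mat_def by auto
    have BB: "(B' * B') $$ (i,Suc i) = al i * u + u * al (Suc i)"
      using tridiag_mult_left[OF B'(2,3), of i "Suc i"] i z u by (simp add: al u_def)
    have BDB: "(B' * (?D * B')) $$ (i,Suc i) = al i * (th i * u) + u * (th (Suc i) * al (Suc i))"
      using tridiag_mult_left[OF B'(2) C(2), of i "Suc i"] i z u dg_mult_left[OF B'(3), of _ "Suc i" th]
      by (simp add: al u_def)
    have "u * ((al i + al (Suc i)) * (th i + th (Suc i)) - \<beta> * (al i * th i + al (Suc i) * th (Suc i))) = u * \<omega>s"
      using ent[of i "Suc i"] BB BDB Di[of i "Suc i"] i u by (simp add: algebra_simps)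
    then show "(al i + al (Suc i)) * (th i + th (Suc i)) - \<beta> * (al i * th i + al (Suc i) * th (Suc i)) = \<omega>s"
      using u0 by simp }
  show "1 \<le> i \<Longrightarrow> i \<le> d \<Longrightarrow> p i \<noteq> 0"
    using irred_lo_nonzero[OF B'(1)] irred_up_nonzero[OF B'(1)] by (simp add: p)
  show "p 0 = 0" by (simp add: p)
qed

section \<open>Consequences of irreducibility\<close>

lemma dg_mult: "dg d f * dg d g = (dg d (\<lambda>i. f i * g i) :: 'a::field mat)"
proof (rule eq_matI)
  fix i j assume "i < dim_row (dg d (\<lambda>i. f i * g i))" "j < dim_col (dg d (\<lambda>i. f i * g i))"
  then have ij: "i \<le> d" "j < Suc d" by auto
  show "(dg d f * dg d g) $$ (i,j) = dg d (\<lambda>i. f i * g i) $$ (i,j)"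
    unfolding dg_mult_left[OF dg_carrier ij] using ij by (simp add: dg_def)
qed auto

lemma transpose_dg: "transpose_mat (dg d f) = dg d f"
  by (rule eq_matI) (auto simp: dg_def)

text \<open>For d = 2m+1 the eigenvalues at m and m+1 are neighbours and opposite. In row m and in
  column m of T only the entry at m+1 can be nonzero, so the entry (m,m) of the anticommutation of B
  with T involves just the two entries of B that link m and m+1.\<close>

lemma anti_pair_sign:
  fixes A B :: "'a::field mat"
  assumes A: "zero_diag_TD d A" and B: "zero_diag_TD d B" and E: "eigform d A B th P Q"
    and m: "d = Suc (2 * m)"
  obtains T where "T = Q * dg d (\<lambda>i. (-1)^i) * P" "T $$ (Suc m, m) \<noteq> 0"
    "(Q * B * P) $$ (m, Suc m) * T $$ (Suc m, m) = - (T $$ (m, Suc m) * (Q * B * P) $$ (Suc m, m))"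
proof -
  note e = eigformD[OF E]
  define T where "T = Q * dg d (\<lambda>i. (-1)^i) * P"
  have T: "T \<in> carrier_mat (Suc d) (Suc d)"
    unfolding T_def by (rule conj_carrier[OF e(1,2) dg_carrier])
  define B' where "B' = Q * B * P"
  have B': "B' \<in> carrier_mat (Suc d) (Suc d)"
    unfolding B'_def by (rule conj_carrier[OF e(1,2) zero_diagD(3)[OF B]])
  have DT: "dg d th * T = (-1) \<cdot>\<^sub>m (T * dg d th)"
    using sign_conj[OF e(1,2,3) A] unfolding e(6) T_def .
  have BT: "B' * T = (-1) \<cdot>\<^sub>m (T * B')"
    using sign_conj[OF e(1,2,3) B] unfolding B'_def T_def .
  have TT: "T * T = 1\<^sub>m (Suc d)" unfolding T_def by (rule sign_square[OF e(1,2,3,4)])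
  have flip: "th (Suc m) = - th m" using eigform_flip[OF A B E, of m] m by simp
  have Tz: "T $$ (i,j) = 0" if ij: "i \<le> d" "j \<le> d" "th i \<noteq> - th j" for i j
    using anticommuting_entry[OF T DT ij(1,2)] ij(3) by blast
  have md: "m \<le> d" "Suc m \<le> d" using m by auto
  have T1: "T $$ (k,m) = 0" "T $$ (m,k) = 0" if k: "k \<le> d" "k \<noteq> Suc m" for k
  proof -
    have "th k \<noteq> th (Suc m)" using inj_onD[OF e(5), of k "Suc m"] k md by auto
    then have "th k \<noteq> - th m" "th m \<noteq> - th k" using flip by auto
    then show "T $$ (k,m) = 0" "T $$ (m,k) = 0" using Tz k md by auto
  qed
  have nz: "T $$ (Suc m, m) \<noteq> 0"
  proof
    assume "T $$ (Suc m, m) = 0"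
    then have "T $$ (k,m) = 0" if "k \<le> d" for k using T1 that by metis
    then have "(T * T) $$ (m,m) = 0" by (intro mult_col_zero[OF T T]) (use md in simp_all)
    then show False unfolding TT using md by simp
  qed
  have "(B' * T) $$ (m,m) = (\<Sum>k<Suc d. B' $$ (m,k) * T $$ (k,m))"
    by (rule index_mult_mat_sum[OF B' T]) (use md in simp_all)
  also have "\<dots> = (\<Sum>k\<in>{Suc m}. B' $$ (m,k) * T $$ (k,m))"
    by (rule sum.mono_neutral_right) (use md T1 in auto)
  finally have 1: "(B' * T) $$ (m,m) = B' $$ (m,Suc m) * T $$ (Suc m,m)" by simp
  have "(T * B') $$ (m,m) = (\<Sum>k<Suc d. T $$ (m,k) * B' $$ (k,m))"
    by (rule index_mult_mat_sum[OF T B']) (use md in simp_all)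
  also have "\<dots> = (\<Sum>k\<in>{Suc m}. T $$ (m,k) * B' $$ (k,m))"
    by (rule sum.mono_neutral_right) (use md T1 in auto)
  finally have 2: "(T * B') $$ (m,m) = T $$ (m,Suc m) * B' $$ (Suc m,m)" by simp
  have "(B' * T) $$ (m,m) = - ((T * B') $$ (m,m))"
    unfolding BT using md T B' by (subst index_smult_mat) auto
  then have "B' $$ (m, Suc m) * T $$ (Suc m, m) = - (T $$ (m, Suc m) * B' $$ (Suc m, m))"
    unfolding 1 2 .
  then show ?thesis unfolding B'_def by (rule that[OF T_def nz])
qed

text \<open>If x = y, one diagonal matrix H symmetrizes both A and B. In the eigenbasis the symmetrized
  B is symmetric and the sign matrix T is symmetric, while B anticommutes with T; this kills the
  entry of B linking the two opposite middle eigenvalues.\<close>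

lemma xr_neq_yr_odd:
  fixes A B :: "'a::field mat"
  assumes A: "zero_diag_TD d A" and B: "zero_diag_TD d B" and E: "eigform d A B th P Q"
    and odd: "odd d"
  shows "\<exists>i. 1 \<le> i \<and> i \<le> d \<and> xr d A B i \<noteq> yr d A B i"
proof (rule ccontr)
  assume "\<not> ?thesis"
  then have xy: "xr d A B i = yr d A B i" if "1 \<le> i" "i \<le> d" for i using that by blast
  let ?n = "Suc d"
  obtain m where m: "d = Suc (2 * m)" using odd by (auto elim: oddE)
  note a = zero_diagD[OF A] and b = zero_diagD[OF B] and e = eigformD[OF E]
  have d: "d \<ge> 1" and md: "m \<le> d" "Suc m \<le> d" using m by auto
  \<comment> \<open>Chosen so that h_(i+1) times the subdiagonal entry equals h_i times the
    superdiagonal entry, the condition for \<open>H * A\<close> to be symmetric; under x = y the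
    same h serves B.\<close>
  define h where "h = rec_nat 1 (\<lambda>i r. r * (up d A (Suc i) / lo d A (Suc i)))"
  have h0: "h 0 = 1" and hS: "h (Suc i) = h i * (up d A (Suc i) / lo d A (Suc i))" for i
    by (simp_all add: h_def)
  have lA: "lo d A (Suc i) \<noteq> 0" and uA: "up d A (Suc i) \<noteq> 0" if "i < d" for i
    using irred_lo_nonzero[OF a(1)] irred_up_nonzero[OF a(1)] that by auto
  have hn: "i \<le> d \<Longrightarrow> h i \<noteq> 0" for i
    by (induction i) (use h0 hS lA uA in auto)
  define H where "H = dg d h"
  have H: "H \<in> carrier_mat ?n ?n" by (simp add: H_def)
  have PT: "transpose_mat P \<in> carrier_mat ?n ?n" "transpose_mat Q \<in> carrier_mat ?n ?n" using e by auto
  have sym: "H * M = transpose_mat M * H"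
    if M: "zero_diag_TD d M" and h: "\<And>i. i < d \<Longrightarrow> h (Suc i) * lo d M (Suc i) = h i * up d M (Suc i)" for M
  proof (rule eq_matI)
    note MC = zero_diagD(3)[OF M]
    have MT: "transpose_mat M \<in> carrier_mat ?n ?n" using MC by simp
    fix i j assume "i < dim_row (transpose_mat M * H)" "j < dim_col (transpose_mat M * H)"
    then have ij: "i \<le> d" "j \<le> d" "i < ?n" "j < ?n" using MC H by auto
    have "(H * M) $$ (i,j) = h i * M $$ (i,j)" unfolding H_def by (rule dg_mult_left[OF MC ij(1,4)])
    moreover have "(transpose_mat M * H) $$ (i,j) = M $$ (j,i) * h j"
      unfolding H_def dg_mult_right[OF MT ij(3,2)] using ij MC by simp
    moreover have "h i * M $$ (i,j) = M $$ (j,i) * h j"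
      using zero_diag_entry[OF M ij(1,2)] zero_diag_entry[OF M ij(2,1)] h[of j] h[of i] ij
      by (auto simp: mult.commute)
    ultimately show "(H * M) $$ (i,j) = (transpose_mat M * H) $$ (i,j)" by simp
  qed (use zero_diagD(3)[OF M] H in auto)
  have HA: "H * A = transpose_mat A * H"
    by (rule sym[OF A]) (use hS lA in simp)
  have HB: "H * B = transpose_mat B * H"
  proof (rule sym[OF B])
    fix i assume i: "i < d"
    show "h (Suc i) * lo d B (Suc i) = h i * up d B (Suc i)"
      using lo_xr[OF A, of B "Suc i"] up_yr[OF A, of B "Suc i"] xy[of "Suc i"] i lA[OF i] by (simp add: hS)
  qed
  \<comment> \<open>G is the Gram matrix of the eigenvectors of A for the bilinear form H, with
    respect to which A, B and the sign matrix are self-adjoint. Eigenvectors for distinct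
    eigenvalues are orthogonal, so G is diagonal.\<close>
  define G where "G = transpose_mat P * H * P"
  have G: "G \<in> carrier_mat ?n ?n" unfolding G_def by (rule conj_carrier[OF e(1) PT(1) H])
  have Gsym: "G * (Q * M * P) = transpose_mat (Q * M * P) * G"
    if M: "M \<in> carrier_mat ?n ?n" and HM: "H * M = transpose_mat M * H" for M
  proof -
    note ac = assoc_mult_mat[of _ ?n ?n _ ?n _ ?n]
    have MT: "transpose_mat M \<in> carrier_mat ?n ?n" using M by simp
    have "G * (Q * M * P) = transpose_mat P * H * (P * Q) * M * P"
      unfolding G_def using e(1,2) PT H M by (simp add: ac del: assoc_mult_mat)
    also have "\<dots> = transpose_mat P * (H * M) * P"
      unfolding e(3) using e(1,2) PT H M by (simp add: ac del: assoc_mult_mat)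
    also have "\<dots> = transpose_mat P * transpose_mat M * H * P"
      unfolding HM using e(1,2) PT H MT by (simp add: ac del: assoc_mult_mat)
    also have "\<dots> = transpose_mat P * transpose_mat M * (transpose_mat Q * transpose_mat P) * H * P"
      unfolding transpose_mult[OF e(1,2), symmetric] e(3) using e(1,2) PT H MT
      by (simp add: ac del: assoc_mult_mat)
    also have "\<dots> = (transpose_mat P * (transpose_mat M * transpose_mat Q)) * G"
      unfolding G_def using e(1,2) PT H MT by (simp add: ac del: assoc_mult_mat)
    also have "transpose_mat P * (transpose_mat M * transpose_mat Q) = transpose_mat (Q * M * P)"
      unfolding transpose_mult[OF mult_carrier_mat[OF e(2) M] e(1)] transpose_mult[OF e(2) M] ..
    finally show ?thesis .
  qed
  define B' where "B' = Q * B * P"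
  have B'C: "B' \<in> carrier_mat ?n ?n" unfolding B'_def by (rule conj_carrier[OF e(1,2) b(3)])
  have GD: "G * dg d th = dg d th * G"
    using Gsym[OF a(3) HA] unfolding e(6) transpose_dg .
  have GB: "G * B' = transpose_mat B' * G" using Gsym[OF b(3) HB] unfolding B'_def .
  obtain T where T: "T = Q * dg d (\<lambda>i. (-1)^i) * P" "T $$ (Suc m, m) \<noteq> 0"
    "B' $$ (m, Suc m) * T $$ (Suc m, m) = - (T $$ (m, Suc m) * B' $$ (Suc m, m))"
    using anti_pair_sign[OF A B E m] unfolding B'_def by metis
  have TC: "T \<in> carrier_mat ?n ?n" unfolding T(1) by (rule conj_carrier[OF e(1,2) dg_carrier])
  have GT: "G * T = transpose_mat T * G"
    unfolding T(1) by (rule Gsym[OF dg_carrier]) (simp add: H_def transpose_dg dg_mult mult.commute)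
  have Goff: "G $$ (i,j) = 0" if ij: "i \<le> d" "j \<le> d" "i \<noteq> j" for i j
  proof -
    have "G $$ (i,j) * th j = th i * G $$ (i,j)"
      using arg_cong[OF GD, of "\<lambda>M. M $$ (i,j)"] dg_mult_right[OF G, of i j th] dg_mult_left[OF G, of i j th] ij
      by (simp del: index_mult_mat(1))
    then have "G $$ (i,j) * (th j - th i) = 0" by (simp add: algebra_simps)
    then show ?thesis using inj_onD[OF e(5), of i j] ij by auto
  qed
  have Gdg: "G = dg d (\<lambda>i. G $$ (i,i))"
    by (rule eq_matI) (use G Goff in \<open>auto simp: dg_def\<close>)
  have Gn: "G $$ (i,i) \<noteq> 0" if i: "i \<le> d" for i
  proof
    assume z: "G $$ (i,i) = 0"
    define Hi where "Hi = dg d (\<lambda>i. inverse (h i))"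
    have Hi: "Hi \<in> carrier_mat ?n ?n" by (simp add: Hi_def)
    define K where "K = Q * Hi * transpose_mat Q"
    have K: "K \<in> carrier_mat ?n ?n" unfolding K_def by (rule conj_carrier[OF PT(2) e(2) Hi])
    note ac = assoc_mult_mat[of _ ?n ?n _ ?n _ ?n]
    have "G * K = transpose_mat P * H * (P * Q) * Hi * transpose_mat Q"
      unfolding G_def K_def using e(1,2) PT H Hi by (simp add: ac del: assoc_mult_mat)
    also have "\<dots> = transpose_mat P * (H * Hi) * transpose_mat Q"
      unfolding e(3) using e(1,2) PT H Hi by (simp add: ac del: assoc_mult_mat)
    also have "H * Hi = 1\<^sub>m ?n"
      unfolding H_def Hi_def dg_mult using hn by (intro eq_matI) (auto simp: dg_def)
    also have "transpose_mat P * 1\<^sub>m ?n * transpose_mat Q = transpose_mat P * transpose_mat Q"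
      using PT by simp
    also have "\<dots> = 1\<^sub>m ?n" unfolding transpose_mult[OF e(2,1), symmetric] e(4) by simp
    finally have "(G * K) $$ (i,i) = 1" using i by simp
    moreover have "(G * K) $$ (i,i) = 0"
    proof (rule mult_col_zero[OF G K])
      fix k assume "k < ?n"
      then have "G $$ (i,k) = 0" using z Goff[OF i, of k] by (cases "k = i") auto
      then show "G $$ (i,k) * K $$ (k,i) = 0" by simp
    qed (use i in auto)
    ultimately show False by simp
  qed
  define g where "g i = G $$ (i,i)" for i
  have gd: "G = dg d g" using Gdg by (simp add: g_def[abs_def])
  have ent: "g i * M $$ (i,j) = M $$ (j,i) * g j" if M: "M \<in> carrier_mat ?n ?n" and GM: "G * M = transpose_mat M * G" and ij: "i \<le> d" "j \<le> d" for M i j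
  proof -
    have ij': "i < ?n" "j < ?n" and MT: "transpose_mat M \<in> carrier_mat ?n ?n" using ij M by auto
    have "(G * M) $$ (i,j) = g i * M $$ (i,j)" unfolding gd by (rule dg_mult_left[OF M ij(1) ij'(2)])
    moreover have "(transpose_mat M * G) $$ (i,j) = M $$ (j,i) * g j"
      unfolding gd dg_mult_right[OF MT ij'(1) ij(2)] using ij' M by simp
    ultimately show ?thesis unfolding GM by simp
  qed
  have 1: "g m * B' $$ (m,Suc m) = B' $$ (Suc m,m) * g (Suc m)" by (rule ent[OF B'C GB md])
  have 2: "g m * T $$ (m,Suc m) = T $$ (Suc m,m) * g (Suc m)" by (rule ent[OF TC GT md])
  have g: "g m \<noteq> 0" "g (Suc m) \<noteq> 0" using Gn md by (auto simp: g_def)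
  \<comment> \<open>Self-adjointness of B and of T combines to the equation of
    \<open>anti_pair_sign\<close> with the opposite sign, so twice a product of nonzero entries is
    0.\<close>
  have "g m * g (Suc m) * (B' $$ (m, Suc m) * T $$ (Suc m, m))
      = g (Suc m) * (g m * B' $$ (m, Suc m)) * T $$ (Suc m, m)" by (simp add: mult_ac)
  also have "\<dots> = g (Suc m) * B' $$ (Suc m,m) * (T $$ (Suc m,m) * g (Suc m))" unfolding 1 by (simp add: mult_ac)
  also have "\<dots> = g m * g (Suc m) * (T $$ (m,Suc m) * B' $$ (Suc m,m))" unfolding 2[symmetric] by (simp add: mult_ac)
  finally have "B' $$ (m, Suc m) * T $$ (Suc m, m) = T $$ (m,Suc m) * B' $$ (Suc m,m)" using g by simp
  then have "2 * (B' $$ (m, Suc m) * T $$ (Suc m, m)) = 0" using T(3) by (metis add.right_inverse mult_2)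
  moreover have "B' $$ (m, Suc m) \<noteq> 0"
    using irred_up_nonzero[OF e(7), of "Suc m"] md by (simp add: up_def B'_def)
  ultimately show False using eigform_char_not_2[OF A E d] T(2) by simp
qed

text \<open>Otherwise B would be a multiple of A and hence diagonal in the eigenbasis of A, where
  its subdiagonal does not vanish.\<close>

lemma not_proportional:
  fixes A B :: "'a::field mat"
  assumes A: "zero_diag_TD d A" and B: "zero_diag_TD d B" and E: "eigform d A B th P Q" and d: "1 \<le> d"
  shows "\<not> (\<exists>s. \<forall>i. 1 \<le> i \<and> i \<le> d \<longrightarrow> xr d A B i = s \<and> yr d A B i = s)"
proof
  assume "\<exists>s. \<forall>i. 1 \<le> i \<and> i \<le> d \<longrightarrow> xr d A B i = s \<and> yr d A B i = s"
  then obtain s where s: "\<And>i. 1 \<le> i \<Longrightarrow> i \<le> d \<Longrightarrow> xr d A B i = s \<and> yr d A B i = s" by blast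
  note a = zero_diagD[OF A] and b = zero_diagD[OF B] and e = eigformD[OF E]
  have "B = s \<cdot>\<^sub>m A"
  proof (rule eq_matI)
    fix i j assume "i < dim_row (s \<cdot>\<^sub>m A)" "j < dim_col (s \<cdot>\<^sub>m A)"
    then have ij: "i \<le> d" "j \<le> d" using a(3) by auto
    show "B $$ (i,j) = (s \<cdot>\<^sub>m A) $$ (i,j)"
      using zero_diag_entry[OF B ij] zero_diag_entry[OF A ij] lo_xr[OF A, of B i] up_yr[OF A, of B j]
        s[of i] s[of j] ij a(3) by auto
  qed (use a(3) b(3) in auto)
  then have "Q * B * P = s \<cdot>\<^sub>m dg d th" using conj_smult[OF e(1,2) a(3), of s] e(6) by simp
  then have "(Q * B * P) $$ (1,0) = 0" using d by (simp add: dg_def)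
  then show False using irred_lo_nonzero[OF e(7), of 1] d by (simp add: lo_def)
qed

text \<open>The equations \<open>dia\<close> form a first-order recurrence for \<open>p\<close> with
  \<open>p 0 = 0\<close>. Its solution has the factor \<open>\<rho>s * t i - g^2 * \<rho>\<close>,
  where t_i = (th_i - th_(i-1))^2; equality in the claim would make this factor, and with it p_i,
  zero.\<close>

lemma nondegeneracy:
  fixes th :: "nat \<Rightarrow> 'a::field"
  assumes d: "3 \<le> d" and inj: "inj_on th {0..d}"
    and rec: "\<And>i. 1 \<le> i \<Longrightarrow> i < d \<Longrightarrow> th (i-1) + th (Suc i) = \<beta> * th i"
    and \<rho>: "\<rho> = th 0 ^ 2 - \<beta> * th 0 * th 1 + th 1 ^ 2"
    and al: "\<And>i. i \<le> d \<Longrightarrow> ((2 - \<beta>) * th i ^ 2 - \<rho>) * al i = \<omega> * th i"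
    and dia: "\<And>i. i \<le> d \<Longrightarrow> 2 * th i * (p i + al i ^ 2 + p (Suc i)) - \<beta> * (th (i-1) * p i + th i * al i ^ 2
          + th (Suc i) * p (Suc i)) - \<rho>s * th i = \<omega> * al i"
    and p: "\<And>i. 1 \<le> i \<Longrightarrow> i \<le> d \<Longrightarrow> p i \<noteq> 0" and p0: "p 0 = 0" and th0: "th 0 \<noteq> 0"
    and i: "1 \<le> i" "i < d" and \<beta>: "\<beta> \<noteq> 2"
  shows "\<rho>s * (th i - th (i-1)) ^ 2 * th 0 ^ 2 \<noteq> (al 0 * (th 0 - th 1)) ^ 2 * \<rho>"
proof -
  \<comment> \<open>\<open>\<beta> * th 0 - th 1\<close> is the value that the recurrence assigns to
    th_(-1), and \<open>t0\<close> is (th_0 - th_(-1))^2. The scalar g is normalized so that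
    \<omega> = g (th_0 - th_(-1)).\<close>
  define g where "g = al 0 * (th 0 - th 1) / th 0"
  define t0 where "t0 = (\<beta> * th 0 - th 1 - th 0)^2"
  define t where "t i = (th i - th (i-1))^2" for i
  have inv: "th i ^ 2 - \<beta> * th i * th (Suc i) + th (Suc i) ^ 2 = \<rho>" if "i < d" for i
    using quadratic_invariant[of d th \<beta> i, OF rec that] \<rho> by simp
  have thS: "th (Suc i) = \<beta> * th i - th (i-1)" if "1 \<le> i" "i < d" for i
    using rec[OF that] by (simp add: eq_diff_eq add.commute)
  have neq: "th j \<noteq> th k" if "j \<le> d" "k \<le> d" "j \<noteq> k" for j k
    using inj_onD[OF inj, of j k] that by auto
  have om: "\<omega> = g * (th 0 - (\<beta> * th 0 - th 1))"
  proof -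
    have "\<omega> * th 0 = ((2 - \<beta>) * th 0 ^ 2 - \<rho>) * al 0" using al[of 0] by simp
    also have "\<dots> = al 0 * (th 0 - th 1) * (th 0 - (\<beta> * th 0 - th 1))"
      unfolding \<rho> by (simp add: algebra_simps power2_eq_square)
    also have "\<dots> = th 0 * (g * (th 0 - (\<beta> * th 0 - th 1)))" using th0 by (simp add: g_def)
    finally show ?thesis using th0 by simp
  qed
  have om2: "\<omega>^2 = g^2 * t0" unfolding om t0_def by (simp add: algebra_simps power2_eq_square)
  have p1: "p 1 * (2 * th 0 - \<beta> * th 1) = th 0 * (\<rho>s - g^2 * \<rho> / t 1)"
  proof -
    have t1: "t 1 \<noteq> 0" using neq[of 0 1] d by (simp add: t_def)
    define u where "u = th 0 - th 1"
    define c where "c = th 0 - (\<beta> * th 0 - th 1)"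
    have u: "u \<noteq> 0" using neq[of 0 1] d by (simp add: u_def)
    have tu: "t 1 = u^2" by (simp add: t_def u_def power2_commute)
    have a0: "al 0 = g * th 0 / u" using u th0 by (simp add: g_def u_def)
    have "p 1 * (2 * th 0 - \<beta> * th 1) = \<rho>s * th 0 + \<omega> * al 0 + (\<beta> - 2) * th 0 * al 0 ^ 2"
      using dia[of 0] p0 by (simp add: algebra_simps)
    also have "\<omega> * al 0 = g^2 * th 0 * (c * u) / t 1"
      using u unfolding om a0 tu c_def[symmetric] by (simp add: power2_eq_square)
    also have "(\<beta> - 2) * th 0 * al 0 ^ 2 = g^2 * th 0 * ((\<beta> - 2) * th 0^2) / t 1"
      using u unfolding a0 tu by (simp add: power2_eq_square)
    also have "\<rho>s * th 0 + g^2 * th 0 * (c * u) / t 1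
        + g^2 * th 0 * ((\<beta> - 2) * th 0^2) / t 1
      = \<rho>s * th 0 + g^2 * th 0 * (c * u + (\<beta> - 2) * th 0^2) / t 1"
      by (simp add: add_divide_distrib distrib_left)
    also have "c * u + (\<beta> - 2) * th 0^2 = - \<rho>"
      unfolding \<rho> c_def u_def by (simp add: algebra_simps power2_eq_square)
    finally show ?thesis by (simp add: algebra_simps)
  qed
  \<comment> \<open>Kept free of division: the two linear factors on the left are th_(i-1) -
    th_(i+1) and th_(i-2) - th_i, whose outer indices may leave the range 0..d.\<close>
  have main: "1 \<le> i \<Longrightarrow> i \<le> d \<Longrightarrow> p i * (2 * th (i-1) - \<beta> * th i) * (\<beta> * th (i-1) - 2 * th i) * (2 - \<beta>) * t i
      = (t i - t0) * (\<rho>s * t i - g^2 * \<rho>)" for i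
  proof (induction i rule: dec_induct)
    case base
    have t1: "t 1 \<noteq> 0" using neq[of 0 1] d by (simp add: t_def)
    have "(t 1 - t0) = th 0 * (\<beta> * th 0 - 2 * th 1) * (2 - \<beta>)"
      unfolding t_def t0_def by (simp add: algebra_simps power2_eq_square)
    moreover have "p 1 * (2 * th 0 - \<beta> * th 1) * t 1 = th 0 * (\<rho>s * t 1 - g^2 * \<rho>)"
      unfolding p1 using t1 by (simp add: field_simps)
    ultimately show ?case by (simp add: mult_ac)
  next
    case (step k)
    define r where "r = th (k-1)"
    define s where "s = th k"
    define w where "w = th (Suc k)"
    have k: "1 \<le> k" "k < d" using step by auto
    have w: "w = \<beta> * s - r" using thS[OF k] by (simp add: r_def s_def w_def)
    have rs: "s^2 - \<beta> * s * r + r^2 = \<rho>"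
      using inv[of "k-1"] k by (simp add: r_def s_def algebra_simps)
    have ne: "s - r \<noteq> 0" "w - s \<noteq> 0" using neq[of k "k-1"] neq[of "Suc k" k] k by (auto simp: r_def s_def w_def)
    have tk: "t k = (s - r)^2" "t (Suc k) = (w - s)^2" by (simp_all add: t_def r_def s_def w_def)
    have IH: "p k * (2 * r - \<beta> * s) * (\<beta> * r - 2 * s) * (2 - \<beta>) * (s-r)^2 = ((s-r)^2 - t0) * (\<rho>s * (s-r)^2 - g^2 * \<rho>)"
      using step by (simp add: r_def s_def tk[symmetric] t_def)
    define X where "X = (s - r) * (w - s)"
    have X0: "X \<noteq> 0" using ne by (simp add: X_def)
    have X: "(2 - \<beta>) * s ^ 2 - \<rho> = - X"
      unfolding rs[symmetric] w X_def by (simp add: algebra_simps power2_eq_square)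
    have "- X * al k = \<omega> * s" using al[of k] k X by (simp add: s_def)
    then have alk: "al k = - (\<omega> * s) / X" using X0 by (metis mult_minus_left nonzero_mult_div_cancel_left minus_equation_iff)
    have D: "p k * (2 * s - \<beta> * r) + p (Suc k) * (2 * s - \<beta> * w) = \<rho>s * s + \<omega> * al k + (\<beta> - 2) * s * al k ^ 2"
      using dia[of k] k by (simp add: r_def s_def w_def algebra_simps)
    have aa: "(\<omega> * al k + (\<beta> - 2) * s * al k ^ 2) * ((s-r)^2 * (w-s)^2) = - (g^2 * t0 * \<rho> * s)"
    proof -
      have "(\<omega> * al k + (\<beta> - 2) * s * al k ^ 2) * X^2 = \<omega>^2 * s * ((\<beta> - 2) * s^2 - X)"
        using X0 unfolding alk by (simp add: field_simps power2_eq_square)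
      also have "(\<beta> - 2) * s^2 - X = - \<rho>" using X by (simp add: algebra_simps)
      also have "X^2 = (s-r)^2 * (w-s)^2" by (simp add: X_def power_mult_distrib)
      finally show ?thesis unfolding om2 by (simp add: mult_ac)
    qed
    have D2: "(p k * (2 * s - \<beta> * r) + p (Suc k) * (2 * s - \<beta> * w)) * ((s-r)^2 * (w-s)^2)
        = \<rho>s * s * ((s-r)^2 * (w-s)^2) - g^2 * t0 * \<rho> * s"
      unfolding D using aa by (simp add: algebra_simps)
    have c: "2 * r - \<beta> * s = r - w" "\<beta> * s - 2 * w = r - w" unfolding w by (simp_all add: algebra_simps)
    \<comment> \<open>multiply D2 by (r - w)(2 - beta) and eliminate p k with IH\<close>
    have "p (Suc k) * (2 * s - \<beta> * w) * (\<beta> * s - 2 * w) * (2 - \<beta>) * (w-s)^2 * (s-r)^2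
        = (r - w) * (2 - \<beta>) * (\<rho>s * s * ((s-r)^2 * (w-s)^2) - g^2 * t0 * \<rho> * s)
          + ((s-r)^2 - t0) * (\<rho>s * (s-r)^2 - g^2 * \<rho>) * (w-s)^2"
    proof -
      have "p (Suc k) * (2 * s - \<beta> * w) * (\<beta> * s - 2 * w) * (2 - \<beta>) * (w-s)^2 * (s-r)^2
        = (r - w) * (2 - \<beta>) * ((p k * (2 * s - \<beta> * r) + p (Suc k) * (2 * s - \<beta> * w)) * ((s-r)^2 * (w-s)^2))
          + (p k * (2 * r - \<beta> * s) * (\<beta> * r - 2 * s) * (2 - \<beta>) * (s-r)^2) * (w-s)^2"
        unfolding c by (simp add: algebra_simps)
      then show ?thesis unfolding D2 IH .
    qed
    also have "\<dots> = ((w-s)^2 - t0) * (\<rho>s * (w-s)^2 - g^2 * \<rho>) * (s-r)^2"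
    proof -
      have e: "(r - w) * (2 - \<beta>) * s = (w-s)^2 - (s-r)^2" unfolding w by (simp add: algebra_simps power2_eq_square)
      have "(r - w) * (2 - \<beta>) * (\<rho>s * s * ((s-r)^2 * (w-s)^2) - g^2 * t0 * \<rho> * s)
        = ((r - w) * (2 - \<beta>) * s) * (\<rho>s * ((s-r)^2 * (w-s)^2) - g^2 * t0 * \<rho>)" by (simp add: algebra_simps)
      then show ?thesis unfolding e by (simp add: algebra_simps)
    qed
    finally show ?case using ne by (simp add: tk s_def[symmetric] w_def[symmetric])
  qed
  show ?thesis
  proof
    assume "\<rho>s * (th i - th (i-1)) ^ 2 * th 0 ^ 2 = (al 0 * (th 0 - th 1)) ^ 2 * \<rho>"
    then have "\<rho>s * t i * th 0 ^ 2 = g^2 * \<rho> * th 0 ^ 2" using th0 by (simp add: g_def t_def power_divide)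
    then have z: "\<rho>s * t i = g^2 * \<rho>" using th0 by simp
    have ti: "t i \<noteq> 0" using neq[of i "i-1"] i by (simp add: t_def)
    have a: "2 * th (i-1) - \<beta> * th i \<noteq> 0" using thS[OF i] neq[of "i-1" "Suc i"] i by auto
    show False
    \<comment> \<open>For i = 1 the factor th_(-1) - th_1 may vanish, so the equation
      \<open>p1\<close>, which lacks this factor, takes the place of \<open>main\<close>.\<close>
    proof (cases "i = 1")
      case True
      then have "p 1 * (2 * th 0 - \<beta> * th 1) = 0" unfolding p1 using z ti by (simp add: field_simps)
      then show False using p[of 1] a True d by simp
    next
      case False
      then obtain j where j: "i = Suc (Suc j)" using i by (metis One_nat_def Suc_le_D less_Suc_eq_0_disj not_less_eq_eq old.nat.exhaust)
      have "th i = \<beta> * th (i-1) - th (i-2)" using thS[of "i-1"] j i by simp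
      then have b: "\<beta> * th (i-1) - 2 * th i \<noteq> 0" using neq[of "i-2" i] i j by (auto simp: algebra_simps)
      have "2 - \<beta> \<noteq> 0" using \<beta> by simp
      then show False using main[of i] z p[of i] i a b ti by simp
    qed
  qed
qed

section \<open>The scalar problem\<close>

text \<open>The invariants of the pair under diagonal conjugation, with all that the classification
  uses about them. The exchanged pair has ratios 1/x, 1/y and products x y z, whence
  \<open>eqxs\<close> and \<open>eqys\<close>. The scalar c is the diagonal entry of B at
  \<open>th 0\<close> times \<open>th 0 - th 1\<close>; through it \<open>corner1\<close>,
  \<open>corner2\<close> and \<open>nondeg\<close> refer to the eigenbasis.\<close>

locale td_data =
  fixes d :: nat and \<beta> \<rho> \<rho>s \<omega> c :: "'a::field" and th ths x y z :: "nat \<Rightarrow> 'a"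
  assumes d3: "3 \<le> d"
    and two: "(2::'a) \<noteq> 0"
    and inj: "inj_on th {0..d}" and injs: "inj_on ths {0..d}"
    and flip: "i \<le> d \<Longrightarrow> th (d - i) = - th i" and flips: "i \<le> d \<Longrightarrow> ths (d - i) = - ths i"
    and rec: "1 \<le> i \<Longrightarrow> i < d \<Longrightarrow> th (i-1) + th (Suc i) = \<beta> * th i"
    and recs: "1 \<le> i \<Longrightarrow> i < d \<Longrightarrow> ths (i-1) + ths (Suc i) = \<beta> * ths i"
    and rho: "\<rho> = th 0 ^ 2 - \<beta> * th 0 * th 1 + th 1 ^ 2"
    and rhos: "\<rho>s = ths 0 ^ 2 - \<beta> * ths 0 * ths 1 + ths 1 ^ 2"
    and nonzero: "1 \<le> i \<Longrightarrow> i \<le> d \<Longrightarrow> x i \<noteq> 0 \<and> y i \<noteq> 0 \<and> z i \<noteq> 0"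
    and z0: "z 0 = 0" and zd: "z (Suc d) = 0"
    and eqx: "aw_eqs d x y z \<beta> \<rho> \<omega>" and eqy: "aw_eqs d y x z \<beta> \<rho> \<omega>"
    and eqxs: "aw_eqs d (\<lambda>i. inverse (x i)) (\<lambda>i. inverse (y i)) (\<lambda>i. x i * y i * z i) \<beta> \<rho>s \<omega>"
    and eqys: "aw_eqs d (\<lambda>i. inverse (y i)) (\<lambda>i. inverse (x i)) (\<lambda>i. x i * y i * z i) \<beta> \<rho>s \<omega>"
    and corner1: "(y 1 - x 2) * z 1 + x 2 * th 0 ^ 2 - th 0 * th 1 * x 1 = c"
    and corner2: "(x 1 - y 2) * z 1 + y 2 * th 0 ^ 2 - th 0 * th 1 * y 1 = c"
    and nondeg: "\<beta> \<noteq> 2 \<Longrightarrow> 1 \<le> i \<Longrightarrow> i < d \<Longrightarrow> \<rho>s * (th i - th (i-1)) ^ 2 * th 0 ^ 2 \<noteq> c ^ 2 * \<rho>"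
    and odd_neq: "odd d \<Longrightarrow> \<exists>i. 1 \<le> i \<and> i \<le> d \<and> x i \<noteq> y i"
    and nonprop: "\<not> (\<exists>s. \<forall>i. 1 \<le> i \<and> i \<le> d \<longrightarrow> x i = s \<and> y i = s)"

section \<open>From the matrix pair to scalar data and back\<close>

text \<open>The hypothesis on ratios says only that th_(j-1) - \<beta> th_j + th_(j+1) does not
  depend on j. Reversal of the spectrum negates this number, so it is 0 because 2 is not.\<close>

lemma eigform_recurrence:
  fixes th :: "nat \<Rightarrow> 'a::field"
  assumes d: "3 \<le> d" and two: "(2::'a) \<noteq> 0" and inj: "inj_on th {0..d}"
    and flip: "\<And>i. i \<le> d \<Longrightarrow> th (d - i) = - th i"
    and ratio: "\<And>i. 2 \<le> i \<Longrightarrow> i \<le> d - 1 \<Longrightarrow> (th (i-2) - th (i+1)) / (th (i-1) - th i) = \<beta> + 1"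
    and i: "1 \<le> i" "i < d"
  shows "th (i-1) + th (Suc i) = \<beta> * th i"
proof -
  define g where "g j = th (j-1) - \<beta> * th j + th (Suc j)" for j
  have step: "g (Suc j) = g j" if j: "1 \<le> j" "Suc j < d" for j
  proof -
    have "th j - th (Suc j) \<noteq> 0" using inj_onD[OF inj, of j "Suc j"] j by auto
    then have "th (j-1) - th (Suc (Suc j)) = (\<beta> + 1) * (th j - th (Suc j))"
      using ratio[of "Suc j"] j by (simp add: divide_eq_eq)
    then show ?thesis by (simp add: g_def algebra_simps)
  qed
  have g1: "1 \<le> j \<Longrightarrow> j < d \<Longrightarrow> g j = g 1" for j
    by (induction j rule: dec_induct) (use step in auto)
  have "g (d - 1) = - g 1"
  proof -
    have e: "d - 1 - 1 = d - 2" "Suc (d - 1) = d - 0" using d by auto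
    have "th (d - 2) = - th 2" "th (d - 1) = - th 1" "th (d - 0) = - th 0"
      using flip[of 2] flip[of 1] flip[of 0] d by auto
    then show ?thesis unfolding g_def e by (simp add: algebra_simps numeral_2_eq_2)
  qed
  moreover have "g (d - 1) = g 1" using g1[of "d-1"] d by auto
  ultimately have "2 * g 1 = 0" by (metis add.right_inverse mult_2)
  then have "g i = 0" using g1[OF i] two by simp
  then show ?thesis by (simp add: g_def algebra_simps)
qed

text \<open>In the eigenbasis of B the entry (i-1, i+1) of the relation is a product of two
  superdiagonal entries of A times the asserted combination, while A itself has entry 0 there. This
  is how \<open>ths\<close> inherits \<beta>, which is defined through \<open>th\<close>
  alone.\<close>

lemma dual_recurrence:
  fixes A B :: "'a::field mat"
  assumes A: "zero_diag_TD d A" and B: "zero_diag_TD d B" and Es: "eigform d B A ths Ps Qs"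
    and W: "awm \<beta> \<rho> A B = \<omega> \<cdot>\<^sub>m A" and i: "1 \<le> i" "i < d"
  shows "ths (i-1) + ths (Suc i) = \<beta> * ths i"
proof -
  let ?n = "Suc d" let ?D = "dg d ths"
  note a = zero_diagD[OF A] and b = zero_diagD[OF B] and e = eigformD[OF Es]
  define A' where "A' = Qs * A * Ps"
  have A': "irred_tridiag_mat d A'" "tridiag_mat d A'" "A' \<in> carrier_mat ?n ?n"
    using e(7) irred_tridiag[OF e(7)] tridiag_carrier[OF irred_tridiag[OF e(7)]] by (simp_all add: A'_def)
  have W': "awm \<beta> \<rho> A' ?D = \<omega> \<cdot>\<^sub>m A'"
    using awm_conj[OF e(1,2,3) a(3) b(3), of \<beta> \<rho>] W conj_smult[OF e(1,2) a(3), of \<omega>] e(6) by (simp add: A'_def)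
  have C: "?D * A' \<in> carrier_mat ?n ?n" "A' * A' \<in> carrier_mat ?n ?n" using A'(3) by auto
  have AAD: "A' * (A' * ?D) = (A' * A') * ?D" using assoc_mult_mat[OF A'(3,3) dg_carrier] by simp
  have ij: "i - 1 \<le> d" "Suc i \<le> d" "i - 1 < ?n" "Suc i < ?n" "i \<le> d" using i by auto
  define u where "u = up d A' i"
  define v where "v = up d A' (Suc i)"
  have uv: "u \<noteq> 0" "v \<noteq> 0" using irred_up_nonzero[OF A'(1)] i by (auto simp: u_def v_def)
  have en: "A' $$ (i, Suc i) = v" "A' $$ (i - 1, Suc i) = 0"
    using i A'(2) by (auto simp: v_def up_def tridiag_mat_def)
  have en2: "A' $$ (i - 1 - 1, Suc i) = 0" using i A'(2) by (auto simp: tridiag_mat_def)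
  have AA: "(A' * A') $$ (i-1, Suc i) = u * v"
    using tridiag_mult_left[OF A'(2,3) ij(1,4)] i en en2 by (simp add: u_def)
  have "(?D * A') $$ (i-1-1, Suc i) = 0" "(?D * A') $$ (i-1, Suc i) = 0" "(?D * A') $$ (i, Suc i) = ths i * v"
    using dg_mult_left[OF A'(3) _ ij(4), of "i-1-1" ths] dg_mult_left[OF A'(3) _ ij(4), of "i-1" ths]
      dg_mult_left[OF A'(3) _ ij(4), of i ths] en en2 i by simp_all
  then have ADA: "(A' * (?D * A')) $$ (i-1, Suc i) = u * (ths i * v)"
    using tridiag_mult_left[OF A'(2) C(1) ij(1,4)] i by (simp add: u_def)
  have "awm \<beta> \<rho> A' ?D $$ (i-1, Suc i) = 0" unfolding W' using en(2) ij A'(3) by simp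
  moreover have "?D $$ (i-1, Suc i) = 0" using i by (simp add: dg_def)
  ultimately have "u * v * ths (Suc i) + ths (i-1) * (u * v) - \<beta> * (u * (ths i * v)) = 0"
    using index_awm[OF A'(3) dg_carrier ij(3,4), of \<beta> \<rho> ths] dg_mult_right[OF C(2) ij(3,2), of ths]
      dg_mult_left[OF C(2) ij(1,4), of ths] AAD AA ADA by simp
  then have "u * v * (ths (i-1) + ths (Suc i) - \<beta> * ths i) = 0" by (simp add: algebra_simps)
  then show ?thesis using uv by simp
qed

lemma xr_swap:
  "xr d B A = (\<lambda>i. inverse (xr d A B i))" "yr d B A = (\<lambda>i. inverse (yr d A B i))"
  by (auto simp: xr_def yr_def)

lemma zr_swap:
  "zero_diag_TD d A \<Longrightarrow> zr d B = (\<lambda>i. xr d A B i * yr d A B i * zr d A i)"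
  by (rule ext) (simp add: zr_def lo_xr[of d A B] up_yr[of d A B])

lemma pair_td_data:
  fixes A B :: "'a::field mat"
  assumes A: "zero_diag_TD d A" and B: "zero_diag_TD d B" and d: "3 \<le> d"
    and E: "eigform d A B th P Q" and Es: "eigform d B A ths Ps Qs"
    and ratio: "\<And>i. 2 \<le> i \<Longrightarrow> i \<le> d - 1 \<Longrightarrow> (th (i-2) - th (i+1)) / (th (i-1) - th i) = \<beta> + 1"
  shows "\<exists>\<rho> \<rho>s \<omega> c. td_data d \<beta> \<rho> \<rho>s \<omega> c th ths (xr d A B) (yr d A B) (zr d A)"
proof -
  note a = zero_diagD[OF A] and b = zero_diagD[OF B] and e = eigformD[OF E] and es = eigformD[OF Es]
  have d1: "1 \<le> d" and d2: "2 \<le> d" using d by auto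
  have two: "(2::'a) \<noteq> 0" by (rule eigform_char_not_2[OF A E d1])
  note flip = eigform_flip[OF A B E d1] and flips = eigform_flip[OF B A Es d1]
  have rec: "th (i-1) + th (Suc i) = \<beta> * th i" if "1 \<le> i" "i < d" for i
    by (rule eigform_recurrence[OF d two e(5) flip ratio that])
  define \<rho> where "\<rho> = th 0 ^ 2 - \<beta> * th 0 * th 1 + th 1 ^ 2"
  define \<rho>s where "\<rho>s = ths 0 ^ 2 - \<beta> * ths 0 * ths 1 + ths 1 ^ 2"
  obtain \<omega> where W: "awm \<beta> \<rho> A B = \<omega> \<cdot>\<^sub>m A"
    using aw_relation[OF A B d E Es rec \<rho>_def] by blast
  have recs: "ths (i-1) + ths (Suc i) = \<beta> * ths i" if "1 \<le> i" "i < d" for i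
    by (rule dual_recurrence[OF A B Es W that])
  obtain \<omega>s where Ws: "awm \<beta> \<rho>s B A = \<omega>s \<cdot>\<^sub>m B"
    using aw_relation[OF B A d Es E recs \<rho>s_def] by blast
  define al where "al i = (Q * B * P) $$ (i,i)" for i
  define p where "p i = lo d (Q * B * P) i * up d (Q * B * P) i" for i
  note eb = eigenbasis_equations[OF A B E W Ws, folded al_def p_def]
  have neq: "th j - th k \<noteq> 0" if "j \<le> d" "k \<le> d" "j \<noteq> k" for j k
    using inj_onD[OF e(5), of j k] that by auto
  \<comment> \<open>Entry (1,2) of the second relation expresses \<omega>s through
    \<open>al 1\<close> and \<open>al 2\<close>, which the first relation expresses through
    \<omega>. The indices 1 and 2 involve th_0, ..., th_3, all available as d is at least 3.\<close>
  have om: "\<omega>s = \<omega>"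
  proof -
    have t: "th 2 = \<beta> * th 1 - th 0" "th 3 = \<beta> * th 2 - th 1"
      using rec[of 1] rec[of 2] d by (simp_all add: eq_diff_eq add.commute numeral_eq_Suc)
    have q: "th 1 ^ 2 - \<beta> * th 1 * th 2 + th 2 ^ 2 = \<rho>"
      using quadratic_invariant[of d th \<beta> 1, OF rec] d by (simp add: \<rho>_def numeral_2_eq_2)
    have a1: "al 1 * ((th 1 - th 2) * (th 1 - th 0)) = \<omega> * th 1"
    proof -
      have "(2 - \<beta>) * th 1 ^ 2 - \<rho> = (th 1 - th 2) * (th 1 - th 0)"
        unfolding q[symmetric] t(1) by (simp add: algebra_simps power2_eq_square)
      then show ?thesis using eb(1)[of 1] d by (simp add: mult.commute)
    qed
    have a2: "al 2 * ((th 2 - th 3) * (th 2 - th 1)) = \<omega> * th 2"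
    proof -
      have "(2 - \<beta>) * th 2 ^ 2 - \<rho> = (th 2 - th 3) * (th 2 - th 1)"
        unfolding q[symmetric] t(2) by (simp add: algebra_simps power2_eq_square)
      then show ?thesis using eb(1)[of 2] d by (simp add: mult.commute)
    qed
    have "\<omega>s = (al 1 + al 2) * (th 1 + th 2) - \<beta> * (al 1 * th 1 + al 2 * th 2)"
      using eb(3)[of 1] d by (simp add: numeral_2_eq_2)
    also have "\<dots> = al 1 * (th 1 + th 2 - \<beta> * th 1) + al 2 * (th 1 + th 2 - \<beta> * th 2)"
      by (simp add: algebra_simps)
    also have "th 1 + th 2 - \<beta> * th 1 = th 1 - th 0" unfolding t(1) by simp
    also have "th 1 + th 2 - \<beta> * th 2 = th 2 - th 3" unfolding t(2) by simp
    finally have "\<omega>s = al 1 * (th 1 - th 0) + al 2 * (th 2 - th 3)" .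
    then have "\<omega>s * (th 1 - th 2) = (al 1 * (th 1 - th 0) + al 2 * (th 2 - th 3)) * (th 1 - th 2)" by simp
    also have "\<dots> = al 1 * ((th 1 - th 2) * (th 1 - th 0)) - al 2 * ((th 2 - th 3) * (th 2 - th 1))"
      by (simp add: algebra_simps)
    also have "\<dots> = \<omega> * (th 1 - th 2)" unfolding a1 a2 by (simp add: algebra_simps)
    finally show ?thesis using neq[of 1 2] d by simp
  qed
  have th0: "th 0 \<noteq> 0" using flip[of 0] flip[of d] neq[of 0 d] d by auto
  define c where "c = al 0 * (th 0 - th 1)"
  have "td_data d \<beta> \<rho> \<rho>s \<omega> c th ths (xr d A B) (yr d A B) (zr d A)"
  proof
    show "aw_eqs d (xr d A B) (yr d A B) (zr d A) \<beta> \<rho> \<omega>" by (rule awm_entries[OF A B W])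
    show "aw_eqs d (yr d A B) (xr d A B) (zr d A) \<beta> \<rho> \<omega>" by (rule awm_entries_transpose[OF A B W])
    show "aw_eqs d (\<lambda>i. inverse (xr d A B i)) (\<lambda>i. inverse (yr d A B i)) (\<lambda>i. xr d A B i * yr d A B i * zr d A i) \<beta> \<rho>s \<omega>"
      using awm_entries[OF B A Ws] unfolding xr_swap[of d B A] zr_swap[OF A, of B] om .
    show "aw_eqs d (\<lambda>i. inverse (yr d A B i)) (\<lambda>i. inverse (xr d A B i)) (\<lambda>i. xr d A B i * yr d A B i * zr d A i) \<beta> \<rho>s \<omega>"
      using awm_entries_transpose[OF B A Ws] unfolding xr_swap[of d B A] zr_swap[OF A, of B] om .
    show "(yr d A B 1 - xr d A B 2) * zr d A 1 + xr d A B 2 * th 0 ^ 2 - th 0 * th 1 * xr d A B 1 = c"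
      unfolding c_def al_def by (rule corner_equation[OF A B d2 E])
    show "(xr d A B 1 - yr d A B 2) * zr d A 1 + yr d A B 2 * th 0 ^ 2 - th 0 * th 1 * yr d A B 1 = c"
      unfolding c_def al_def by (rule corner_equation_transpose[OF A B d2 E])
    show "\<rho>s * (th i - th (i-1)) ^ 2 * th 0 ^ 2 \<noteq> c ^ 2 * \<rho>" if "\<beta> \<noteq> 2" "1 \<le> i" "i < d" for i
      unfolding c_def
      by (rule nondegeneracy[OF d e(5) rec \<rho>_def eb(1) eb(2)[unfolded om] eb(4,5) th0 that(2,3,1)])
    show "\<exists>i. 1 \<le> i \<and> i \<le> d \<and> xr d A B i \<noteq> yr d A B i" if "odd d" by (rule xr_neq_yr_odd[OF A B E that])
    show "\<not> (\<exists>s. \<forall>i. 1 \<le> i \<and> i \<le> d \<longrightarrow> xr d A B i = s \<and> yr d A B i = s)"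
      by (rule not_proportional[OF A B E d1])
    show "xr d A B i \<noteq> 0 \<and> yr d A B i \<noteq> 0 \<and> zr d A i \<noteq> 0" if "1 \<le> i" "i \<le> d" for i
      using irred_lo_nonzero[OF a(1) that] irred_up_nonzero[OF a(1) that]
        irred_lo_nonzero[OF b(1) that] irred_up_nonzero[OF b(1) that] by (simp add: xr_def yr_def zr_def)
    show "zr d A 0 = 0" "zr d A (Suc d) = 0" by (simp_all add: zr_def)
    show "\<rho> = th 0 ^ 2 - \<beta> * th 0 * th 1 + th 1 ^ 2" by (rule \<rho>_def)
    show "\<rho>s = ths 0 ^ 2 - \<beta> * ths 0 * ths 1 + ths 1 ^ 2" by (rule \<rho>s_def)
  qed (fact d two e(5) es(5) flip flips rec recs)+
  then show ?thesis by blast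
qed

text \<open>The diagonal conjugation is chosen to make the subdiagonal of the scaled A equal to 1;
  all other entries are then forced by the invariants x, y, z.\<close>

lemma diag_equiv_Tpair:
  fixes A B :: "'a::field mat"
  assumes A: "zero_diag_TD d A" and B: "zero_diag_TD d B" and \<xi>: "\<xi> \<noteq> 0"
    and X: "\<And>i. 1 \<le> i \<Longrightarrow> i \<le> d \<Longrightarrow> \<xi>s * xr d A B i = \<xi> * X i"
    and Y: "\<And>i. 1 \<le> i \<Longrightarrow> i \<le> d \<Longrightarrow> \<xi>s * yr d A B i = \<xi> * Y i"
    and Z: "\<And>i. 1 \<le> i \<Longrightarrow> i \<le> d \<Longrightarrow> \<xi> ^ 2 * zr d A i = Z i"
  shows "diag_equiv d (\<xi> \<cdot>\<^sub>m A, \<xi>s \<cdot>\<^sub>m B) (Tpair d X Y Z)"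
proof -
  note a = zero_diagD[OF A] and b = zero_diagD[OF B]
  let ?n = "Suc d"
  define h where "h = rec_nat 1 (\<lambda>i r. \<xi> * lo d A (Suc i) * r)"
  have h0: "h 0 = 1" and hS: "h (Suc i) = \<xi> * lo d A (Suc i) * h i" for i
    by (simp_all add: h_def)
  have hn: "i \<le> d \<Longrightarrow> h i \<noteq> 0" for i
    by (induction i) (use h0 hS \<xi> irred_lo_nonzero[OF a(1)] in auto)
  define D where "D = dg d h"
  define Di where "Di = dg d (\<lambda>i. inverse (h i))"
  have DC: "D \<in> carrier_mat ?n ?n" "Di \<in> carrier_mat ?n ?n" by (simp_all add: D_def Di_def)
  have inv: "D * Di = 1\<^sub>m ?n" "Di * D = 1\<^sub>m ?n"
    unfolding D_def Di_def dg_mult using hn by (auto simp: dg_def intro!: eq_matI)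
  have diag: "diagonal_mat D" by (auto simp: diagonal_mat_def D_def dg_def)
  have ent: "(Di * (k \<cdot>\<^sub>m M) * D) $$ (i,j) = inverse (h i) * (k * M $$ (i,j)) * h j"
    if M: "M \<in> carrier_mat ?n ?n" and ij: "i \<le> d" "j \<le> d" for k M i j
  proof -
    have kM: "k \<cdot>\<^sub>m M \<in> carrier_mat ?n ?n" using M by simp
    have ij': "i < ?n" "j < ?n" using ij by auto
    have "(Di * (k \<cdot>\<^sub>m M) * D) $$ (i,j) = (Di * (k \<cdot>\<^sub>m M)) $$ (i,j) * h j"
      unfolding D_def by (rule dg_mult_right[OF mult_carrier_mat[OF DC(2) kM] ij'(1) ij(2)])
    also have "(Di * (k \<cdot>\<^sub>m M)) $$ (i,j) = inverse (h i) * (k \<cdot>\<^sub>m M) $$ (i,j)"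
      unfolding Di_def by (rule dg_mult_left[OF kM ij(1) ij'(2)])
    finally show ?thesis using ij' M by simp
  qed
  have C: "Di * (k \<cdot>\<^sub>m M) * D \<in> carrier_mat ?n ?n" if "M \<in> carrier_mat ?n ?n" for k M
    by (rule conj_carrier[OF DC]) (use that in simp)
  have sub: "inverse (h (Suc j)) * (\<xi> * lo d A (Suc j)) * h j = 1"
    and sup: "inverse (h j) * (\<xi> * up d A (Suc j)) * h (Suc j) = Z (Suc j)"
    and subB: "inverse (h (Suc j)) * (\<xi>s * lo d B (Suc j)) * h j = X (Suc j)"
    and supB: "inverse (h j) * (\<xi>s * up d B (Suc j)) * h (Suc j) = Y (Suc j) * Z (Suc j)"
    if j: "Suc j \<le> d" for j
  proof -
    have n: "h j \<noteq> 0" "lo d A (Suc j) \<noteq> 0" using hn j irred_lo_nonzero[OF a(1)] by auto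
    show 1: "inverse (h (Suc j)) * (\<xi> * lo d A (Suc j)) * h j = 1"
      using n \<xi> by (simp add: hS field_simps)
    show 2: "inverse (h j) * (\<xi> * up d A (Suc j)) * h (Suc j) = Z (Suc j)"
      using n Z[of "Suc j"] j by (simp add: hS zr_def power2_eq_square field_simps)
    have "\<xi>s * lo d B (Suc j) = \<xi>s * xr d A B (Suc j) * lo d A (Suc j)"
      by (subst lo_xr[OF A, of B]) (rule mult.assoc[symmetric])
    also have "\<dots> = X (Suc j) * (\<xi> * lo d A (Suc j))"
      using X[of "Suc j"] j by (simp add: mult_ac)
    finally have "inverse (h (Suc j)) * (\<xi>s * lo d B (Suc j)) * h j
       = X (Suc j) * (inverse (h (Suc j)) * (\<xi> * lo d A (Suc j)) * h j)" by (simp only: mult_ac)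
    then show "inverse (h (Suc j)) * (\<xi>s * lo d B (Suc j)) * h j = X (Suc j)"
      unfolding 1 by simp
    have "\<xi>s * up d B (Suc j) = \<xi>s * yr d A B (Suc j) * up d A (Suc j)"
      by (subst up_yr[OF A, of B]) (rule mult.assoc[symmetric])
    also have "\<dots> = Y (Suc j) * (\<xi> * up d A (Suc j))"
      using Y[of "Suc j"] j by (simp add: mult_ac)
    finally have "inverse (h j) * (\<xi>s * up d B (Suc j)) * h (Suc j)
       = Y (Suc j) * (inverse (h j) * (\<xi> * up d A (Suc j)) * h (Suc j))" by (simp only: mult_ac)
    then show "inverse (h j) * (\<xi>s * up d B (Suc j)) * h (Suc j) = Y (Suc j) * Z (Suc j)"
      unfolding 2 .
  qed
  have eA: "Di * (\<xi> \<cdot>\<^sub>m A) * D = fst (Tpair d X Y Z)"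
  proof (rule eq_matI)
    fix i j assume "i < dim_row (fst (Tpair d X Y Z))" "j < dim_col (fst (Tpair d X Y Z))"
    then have ij: "i \<le> d" "j \<le> d" by (auto simp: Tpair_def)
    show "(Di * (\<xi> \<cdot>\<^sub>m A) * D) $$ (i,j) = fst (Tpair d X Y Z) $$ (i,j)"
      unfolding ent[OF a(3) ij] zero_diag_entry[OF A ij] using ij sub sup by (auto simp: Tpair_def)
  qed (use C[OF a(3)] DC in \<open>auto simp: Tpair_def\<close>)
  have eB: "Di * (\<xi>s \<cdot>\<^sub>m B) * D = snd (Tpair d X Y Z)"
  proof (rule eq_matI)
    fix i j assume "i < dim_row (snd (Tpair d X Y Z))" "j < dim_col (snd (Tpair d X Y Z))"
    then have ij: "i \<le> d" "j \<le> d" by (auto simp: Tpair_def)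
    show "(Di * (\<xi>s \<cdot>\<^sub>m B) * D) $$ (i,j) = snd (Tpair d X Y Z) $$ (i,j)"
      unfolding ent[OF b(3) ij] zero_diag_entry[OF B ij] using ij subB supB by (auto simp: Tpair_def)
  qed (use C[OF b(3)] DC in \<open>auto simp: Tpair_def\<close>)
  show ?thesis unfolding diag_equiv_def
    by (rule exI[of _ D], rule exI[of _ Di]) (use DC inv diag eA eB in simp)
qed

section \<open>Recurrences for x, y and z; the case beta = 2\<close>

lemma geometric_of_squares:
  fixes f :: "nat \<Rightarrow> 'a::field"
  assumes nz: "\<And>i. 1 \<le> i \<Longrightarrow> i \<le> d \<Longrightarrow> f i \<noteq> 0"
    and sq: "\<And>i. 2 \<le> i \<Longrightarrow> i < d \<Longrightarrow> f i ^ 2 = f (i-1) * f (Suc i)"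
  shows "1 \<le> i \<Longrightarrow> i \<le> d \<Longrightarrow> f i = f 1 * (f 2 / f 1) ^ (i-1)"
proof (induction i rule: less_induct)
  case (less i)
  consider "i = 1" | "i = 2" | j where "i = Suc (Suc (Suc j))"
    using less.prems by (metis One_nat_def Suc_1 not0_implies_Suc not_one_le_zero)
  then show ?case
  proof cases
    case 2 then show ?thesis using nz[of 1] less.prems by simp
  next
    case 3
    define r where "r = f 2 / f 1"
    have f1: "f (Suc j) = f 1 * r ^ j" and f2: "f (Suc (Suc j)) = f 1 * r ^ Suc j"
      using less.IH[of "Suc j"] less.IH[of "Suc (Suc j)"] less.prems 3 by (simp_all add: r_def)
    have nz': "f (Suc j) \<noteq> 0" using nz less.prems 3 by simp
    have "f (Suc j) * f i = (f (Suc (Suc j)))^2"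
      using sq[of "Suc (Suc j)"] less.prems 3 by simp
    also have "\<dots> = f (Suc j) * (f 1 * r ^ (i-1))"
      unfolding f1 f2 3 by (simp add: power2_eq_square mult_ac)
    finally show ?thesis using nz' by (simp add: r_def)
  qed simp
qed

context td_data
begin

lemma th_neq: "j \<le> d \<Longrightarrow> k \<le> d \<Longrightarrow> j \<noteq> k \<Longrightarrow> th j \<noteq> th k"
  using inj_onD[OF inj, of j k] by auto

text \<open>For \<beta> = 0 the eigenvalues satisfy th_(i+2) = - th_i and repeat with period 4,
  which is impossible for d at least 4; for d = 3 the reversal th_3 = - th_0 gives th_0 =
  th_1.\<close>

lemma beta_nonzero: "\<beta> \<noteq> 0"
proof
  assume "\<beta> = 0"
  then have r: "th (Suc i) = - th (i-1)" if "1 \<le> i" "i < d" for i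
    using rec[OF that] by (simp add: eq_neg_iff_add_eq_0 add.commute)
  show False
  proof (cases "d = 3")
    case True
    then have "th 3 = - th 0" "th 3 = - th 1" using flip[of 0] r[of 2] by (simp_all add: numeral_3_eq_3)
    then show False using th_neq[of 0 1] d3 by simp
  next
    case False
    then have "th 4 = th 0" using r[of 3] r[of 1] d3 by (simp add: numeral_eq_Suc)
    then show False using th_neq[of 0 4] d3 False by simp
  qed
qed

text \<open>The recurrence for f and the same one for 1/f combine to \<beta> f_i^2 = \<beta> f_(i-1)
  f_(i+1), so f is geometric, and its ratio solves the characteristic equation.\<close>

lemma ratio_root:
  assumes nz: "\<And>i. 1 \<le> i \<Longrightarrow> i \<le> d \<Longrightarrow> f i \<noteq> 0"
    and r1: "\<And>i. 2 \<le> i \<Longrightarrow> i < d \<Longrightarrow> f (i-1) + f (Suc i) = \<beta> * f i"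
    and r2: "\<And>i. 2 \<le> i \<Longrightarrow> i < d \<Longrightarrow> inverse (f (i-1)) + inverse (f (Suc i)) = \<beta> * inverse (f i)"
  shows "\<exists>r. r^2 - \<beta> * r + 1 = 0 \<and> (\<forall>i. 1 \<le> i \<and> i \<le> d \<longrightarrow> f i = f 1 * r ^ (i-1))"
proof -
  have sq: "f i ^ 2 = f (i-1) * f (Suc i)" if i: "2 \<le> i" "i < d" for i
  proof -
    have n: "f (i-1) \<noteq> 0" "f i \<noteq> 0" "f (Suc i) \<noteq> 0" using nz i by auto
    have "f i * (f (i-1) + f (Suc i)) = \<beta> * (f (i-1) * f (Suc i))"
      using r2[OF i] n by (simp add: field_simps)
    then have "\<beta> * f i ^ 2 = \<beta> * (f (i-1) * f (Suc i))"
      unfolding r1[OF i] by (simp add: power2_eq_square mult_ac)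
    then show ?thesis using beta_nonzero by simp
  qed
  have g: "f i = f 1 * (f 2 / f 1) ^ (i-1)" if "1 \<le> i" "i \<le> d" for i
    by (rule geometric_of_squares[of d f]) (use nz sq that in auto)
  define r where "r = f 2 / f 1"
  have n: "f 1 \<noteq> 0" using nz d3 by auto
  have "f 1 * (1 + r^2) = f 1 * (\<beta> * r)"
    using r1[of 2] g[of 3] d3 n by (simp add: r_def algebra_simps numeral_eq_Suc)
  then have "1 + r^2 = \<beta> * r" using n by simp
  then have "r^2 - \<beta> * r + 1 = 0" by (simp add: algebra_simps)
  then show ?thesis using g unfolding r_def by blast
qed

lemma x_ratio: "\<exists>r. r^2 - \<beta> * r + 1 = 0 \<and> (\<forall>i. 1 \<le> i \<and> i \<le> d \<longrightarrow> x i = x 1 * r ^ (i-1))"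
  by (rule ratio_root) (use nonzero eqx eqxs in \<open>auto simp: aw_eqs_def\<close>)

lemma y_ratio: "\<exists>r. r^2 - \<beta> * r + 1 = 0 \<and> (\<forall>i. 1 \<le> i \<and> i \<le> d \<longrightarrow> y i = y 1 * r ^ (i-1))"
  by (rule ratio_root) (use nonzero eqy eqys in \<open>auto simp: aw_eqs_def\<close>)

lemma eqx': "1 \<le> i \<Longrightarrow> i \<le> d \<Longrightarrow> z (i-1) * (x i + y (i-1) - \<beta> * x (i-1)) + z i * (2 * x i - \<beta> * y i)
        + z (Suc i) * (x i + y (Suc i) - \<beta> * x (Suc i)) = \<rho> * x i + \<omega>"
  and eqy': "1 \<le> i \<Longrightarrow> i \<le> d \<Longrightarrow> z (i-1) * (y i + x (i-1) - \<beta> * y (i-1)) + z i * (2 * y i - \<beta> * x i)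
        + z (Suc i) * (y i + x (Suc i) - \<beta> * y (Suc i)) = \<rho> * y i + \<omega>"
  using eqx eqy unfolding aw_eqs_def by auto

text \<open>Subtracting the two sub- and super-diagonal identities eliminates omega; only the differences
  x - y survive. Replacing x and y outside of 1..d does no harm because z vanishes there.\<close>

lemma difference_equation:
  assumes X: "\<And>i. 1 \<le> i \<Longrightarrow> i \<le> d \<Longrightarrow> x i - y i = D i"
    and D: "\<And>i. D i + D (Suc (Suc i)) = \<beta> * D (Suc i)" and i: "1 \<le> i" "i \<le> d"
  shows "z (Suc i) * (D (Suc (Suc i)) + D (Suc i))
    = z i * (2 + \<beta>) * D i - z (i-1) * (D (i-1) + D (i-2)) - \<rho> * D i"
proof -
  have 1: "z (i-1) * ((x i - y i) - (1 + \<beta>) * (x (i-1) - y (i-1))) + z i * (2 + \<beta>) * (x i - y i)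
      + z (Suc i) * ((x i - y i) - (1 + \<beta>) * (x (Suc i) - y (Suc i))) = \<rho> * (x i - y i)"
    using arg_cong2[OF eqx'[OF i] eqy'[OF i], of minus] by (simp add: algebra_simps)
  have 2: "z (i-1) * ((x i - y i) - (1 + \<beta>) * (x (i-1) - y (i-1))) = - (z (i-1) * (D (i-1) + D (i-2)))"
  proof (cases "i = 1")
    case False
    then obtain j where j: "i = Suc (Suc j)" using i by (metis One_nat_def Suc_le_D not_one_le_zero le_SucE old.nat.exhaust)
    have "(x i - y i) - (1 + \<beta>) * (x (i-1) - y (i-1)) = - (D (i-1) + D (i-2))"
      using X[of i] X[of "i-1"] D[of j] i j by (simp add: algebra_simps)
    then show ?thesis by (simp only: mult_minus_right)
  qed (simp add: z0)
  have 3: "z (Suc i) * ((x i - y i) - (1 + \<beta>) * (x (Suc i) - y (Suc i)))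
      = - (z (Suc i) * (D (Suc (Suc i)) + D (Suc i)))"
  proof (cases "i = d")
    case False
    have "(x i - y i) - (1 + \<beta>) * (x (Suc i) - y (Suc i)) = - (D (Suc (Suc i)) + D (Suc i))"
      using X[of i] X[of "Suc i"] D[of i] i False by (simp add: algebra_simps)
    then show ?thesis by (simp only: mult_minus_right)
  qed (simp add: zd)
  show ?thesis using 1[unfolded 2 3, unfolded X[OF i]] by (simp add: eq_diff_eq diff_eq_eq add_ac)
qed

text \<open>The difference of \<open>corner1\<close> and \<open>corner2\<close>, in which c cancels.
  It supplies the initial value z_1 for \<open>difference_equation\<close>.\<close>

lemma difference_corner:
  assumes X: "\<And>i. 1 \<le> i \<Longrightarrow> i \<le> d \<Longrightarrow> x i - y i = D i"
  shows "z 1 * (D 2 + D 1) = th 0 * (th 0 * D 2 - th 1 * D 1)"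
proof -
  have D: "D 1 = x 1 - y 1" "D 2 = x 2 - y 2" using X d3 by auto
  have "(y 1 - x 2) * z 1 + x 2 * th 0 ^ 2 - th 0 * th 1 * x 1
      = (x 1 - y 2) * z 1 + y 2 * th 0 ^ 2 - th 0 * th 1 * y 1"
    using corner1 corner2 by simp
  then show ?thesis unfolding D by (simp add: algebra_simps power2_eq_square)
qed

text \<open>Scaling A by \<xi> and B by \<xi>s multiplies the ratios x, y by \<xi>s / \<xi> and the
  products z by \<xi>^2; the conditions are those of \<open>diag_equiv_Tpair\<close>.\<close>

definition fits :: "'a \<Rightarrow> 'a \<Rightarrow> (nat \<Rightarrow> 'a) \<Rightarrow> (nat \<Rightarrow> 'a) \<Rightarrow> (nat \<Rightarrow> 'a) \<Rightarrow> bool" where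
  "fits \<xi> \<xi>s X Y Z \<longleftrightarrow> \<xi> \<noteq> 0 \<and> \<xi>s \<noteq> 0 \<and>
     (\<forall>i. 1 \<le> i \<and> i \<le> d \<longrightarrow> \<xi>s * x i = \<xi> * X i \<and> \<xi>s * y i = \<xi> * Y i \<and> \<xi> ^ 2 * z i = Z i)"

lemma th_arith: "\<beta> = 2 \<Longrightarrow> \<exists>g. g \<noteq> 0 \<and> (\<forall>i\<le>d. th i = g * (2 * of_nat i - of_nat d))"
proof -
  assume \<beta>: "\<beta> = 2"
  define h where "h = th 1 - th 0"
  have "i \<le> d \<Longrightarrow> th i = th 0 + of_nat i * h" for i
  proof (induction i rule: less_induct)
    case (less i)
    consider "i = 0" | "i = 1" | j where "i = Suc (Suc j)" by (metis One_nat_def not0_implies_Suc)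
    then show ?case
    proof cases
      case 3
      then have "th i = 2 * th (Suc j) - th j" using rec[of "Suc j"] less.prems \<beta> by (simp add: algebra_simps)
      then show ?thesis using less.IH[of j] less.IH[of "Suc j"] less.prems 3 by (simp add: algebra_simps)
    qed (simp_all add: h_def)
  qed
  note th = this
  define g where "g = h / 2"
  have h: "h = 2 * g" using two by (simp add: g_def)
  have "2 * (th 0 + of_nat d * g) = 0"
    using th[of d] flip[of 0] by (simp add: h algebra_simps eq_neg_iff_add_eq_0)
  then have "th 0 + of_nat d * g = 0" using two mult_eq_0_iff by blast
  then have "th 0 = - (of_nat d * g)" by (simp add: eq_neg_iff_add_eq_0)
  note th0 = this
  have "th i = g * (2 * of_nat i - of_nat d)" if "i \<le> d" for i
  proof -
    have "th i = th 0 + of_nat i * h" by (rule th[OF that])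
    also have "\<dots> = g * (2 * of_nat i - of_nat d)" unfolding th0 h by (simp add: algebra_simps)
    finally show ?thesis .
  qed
  then have "\<forall>i\<le>d. th i = g * (2 * of_nat i - of_nat d)" by blast
  moreover have "g \<noteq> 0" using th_neq[of 0 1] d3 h by (auto simp: h_def)
  ultimately show ?thesis by blast
qed

text \<open>The characteristic equation has the double root 1, so x, y and D = x - y are constant,
  and D is nonzero because the pair is not proportional. The recurrence then says that z has
  constant second difference.\<close>

lemma family_K_fits:
  assumes root: "\<And>a :: 'a. \<exists>s. s^2 = a" and \<beta>: "\<beta> = 2"
  shows "\<exists>\<xi> \<xi>s X Y Z. fits \<xi> \<xi>s X Y Z \<and> family_K d (Tpair d X Y Z)"
proof -
  obtain g where g: "g \<noteq> 0" and th: "\<And>i. i \<le> d \<Longrightarrow> th i = g * (2 * of_nat i - of_nat d)"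
    using th_arith[OF \<beta>] by blast
  have one: "r = 1" if "r^2 - \<beta> * r + 1 = 0" for r
  proof -
    have "(r - 1)^2 = 0" using that \<beta> by (simp add: power2_eq_square algebra_simps)
    then show ?thesis by simp
  qed
  have x: "x i = x 1" and y: "y i = y 1" if "1 \<le> i" "i \<le> d" for i
  proof -
    obtain r t where "r^2 - \<beta> * r + 1 = 0" "\<forall>i. 1 \<le> i \<and> i \<le> d \<longrightarrow> x i = x 1 * r ^ (i-1)"
      "t^2 - \<beta> * t + 1 = 0" "\<forall>i. 1 \<le> i \<and> i \<le> d \<longrightarrow> y i = y 1 * t ^ (i-1)"
      using x_ratio y_ratio by blast
    then show "x i = x 1" "y i = y 1" using one[of r] one[of t] that by (metis mult.right_neutral power_one)+
  qed
  have n1: "x 1 \<noteq> 0" "y 1 \<noteq> 0" using nonzero[of 1] d3 by auto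
  have xy: "x 1 \<noteq> y 1"
  proof
    assume e: "x 1 = y 1"
    have "x i = x 1 \<and> y i = x 1" if "1 \<le> i \<and> i \<le> d" for i
      unfolding e using x[of i, unfolded e] y[of i] that by blast
    then show False using nonprop by blast
  qed
  define D where "D = x 1 - y 1"
  have D: "D \<noteq> 0" using xy by (simp add: D_def)
  have XD: "\<And>i. 1 \<le> i \<Longrightarrow> i \<le> d \<Longrightarrow> x i - y i = (\<lambda>_. D) i" unfolding D_def by (metis x y)
  have t0: "th 0 = - (g * of_nat d)" and t1: "th 1 = g * (2 - of_nat d)"
    using th[of 0] th[of 1] d3 by simp_all
  have rho4: "\<rho> = 4 * g^2"
    unfolding rho \<beta> t0 t1 by (simp add: power2_eq_square algebra_simps)
  have z1: "z 1 = g^2 * of_nat d"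
  proof -
    have "2 * D * z 1 = 2 * D * (g^2 * of_nat d)"
      using difference_corner[of "\<lambda>_. D", OF XD] unfolding t0 t1
      by (simp add: power2_eq_square algebra_simps)
    then show ?thesis using D two by simp
  qed
  have z: "i \<le> d \<Longrightarrow> z i = g^2 * (of_nat i * (of_nat d - of_nat i + 1))" for i
  proof (induction i rule: less_induct)
    case (less i)
    consider "i = 0" | "i = 1" | j where "i = Suc (Suc j)" by (metis One_nat_def not0_implies_Suc)
    then show ?case
    proof cases
      case 3
      have "z i * (D + D) = z (Suc j) * (2 + \<beta>) * D - z j * (D + D) - \<rho> * D"
        using difference_equation[of "\<lambda>_. D" "Suc j", OF XD] less.prems 3 \<beta> by simp
      also have "\<dots> = (g^2 * (of_nat i * (of_nat d - of_nat i + 1))) * (D + D)"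
      proof -
        have zj: "z j = g^2 * (of_nat j * (of_nat d - of_nat j + 1))"
          "z (Suc j) = g^2 * (of_nat (Suc j) * (of_nat d - of_nat (Suc j) + 1))"
          using less.IH[of j] less.IH[of "Suc j"] less.prems 3 by simp_all
        show ?thesis unfolding rho4 \<beta> zj 3 by (simp add: power2_eq_square algebra_simps)
      qed
      finally have "z i * (2 * D) = (g^2 * (of_nat i * (of_nat d - of_nat i + 1))) * (2 * D)"
        by (simp only: mult_2)
      then show ?thesis using D two by simp
    qed (use z0 z1 in simp_all)
  qed
  \<comment> \<open>Scaling changes x and y only by a common factor; a square root of x_1 / y_1
    brings them to the form s and 1/s.\<close>
  obtain s where s: "s^2 = x 1 / y 1" using root by blast
  have s0: "s \<noteq> 0" using s n1 by auto
  have s1: "s^2 \<noteq> 1" using s n1 xy by auto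
  \<comment> \<open>A characteristic p with 0 < p \<le> d would give th_p = th_0.\<close>
  have char: "char_ok d TYPE('a)"
  proof (rule ccontr)
    assume "\<not> ?thesis"
    then have c: "CHAR('a) \<noteq> 0" "CHAR('a) \<le> d" by (auto simp: char_ok_def)
    then have "th CHAR('a) = th 0" using th[of "CHAR('a)"] th[of 0] by simp
    then show False using th_neq[of "CHAR('a)" 0] c by auto
  qed
  have "fits (1 / g) (s / (g * x 1)) (\<lambda>i. s) (\<lambda>i. inverse s) (\<lambda>i. of_nat (i * (d - i + 1)))"
    (is "fits _ _ ?X ?Y ?Z")
    unfolding fits_def
  proof (intro conjI allI impI)
    show "1 / g \<noteq> 0" "s / (g * x 1) \<noteq> 0" using g s0 n1 by auto
    fix i assume "1 \<le> i \<and> i \<le> d"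
    then have i: "1 \<le> i" "i \<le> d" by auto
    show "s / (g * x 1) * x i = 1 / g * s" using x[OF i] n1 g by simp
    have "s * s * y 1 = x 1" using s n1 by (simp add: power2_eq_square)
    then show "s / (g * x 1) * y i = 1 / g * inverse s" using y[OF i] n1 g s0 by (simp add: field_simps)
    show "(1 / g)\<^sup>2 * z i = of_nat (i * (d - i + 1))"
      using z[OF i(2)] i g by (simp add: power_divide of_nat_diff distrib_left)
  qed
  moreover have "family_K d (Tpair d ?X ?Y ?Z)"
    unfolding family_K_def by (rule exI[of _ s]) (use s0 s1 char in simp)
  ultimately show ?thesis by blast
qed

end

section \<open>The case beta = -2\<close>

context td_data
begin

text \<open>With the signs (-1)^i the eigenvalues become an arithmetic progression u. For odd d the
  reversal gives u_d = u_0 and u_(d-1) = u_1, so d = 0 and d - 1 = 1 in the field, whence 2 =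
  0.\<close>

lemma th_alternating:
  assumes \<beta>: "\<beta> = -2"
  shows "even d" "\<exists>g. g \<noteq> 0 \<and> (\<forall>i\<le>d. th i = (-1)^i * g * (2 * of_nat i - of_nat d))"
proof -
  define u where "u i = (-1)^i * th i" for i
  have thu: "th i = (-1)^i * u i" for i by (simp add: u_def flip: power_add mult.assoc)
  define h where "h = u 1 - u 0"
  have u: "i \<le> d \<Longrightarrow> u i = u 0 + of_nat i * h" for i
  proof (induction i rule: less_induct)
    case (less i)
    consider "i = 0" | "i = 1" | j where "i = Suc (Suc j)" by (metis One_nat_def not0_implies_Suc)
    then show ?case
    proof cases
      case 3
      have "th i = - 2 * th (Suc j) - th j" using rec[of "Suc j"] less.prems 3 \<beta> by (simp add: eq_diff_eq add.commute)
      then have "u i = (-1)^i * (- 2 * th (Suc j) - th j)" by (simp only: u_def)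
      also have "\<dots> = 2 * u (Suc j) - u j" unfolding u_def 3 by (simp add: algebra_simps)
      also have "\<dots> = u 0 + of_nat i * h"
      proof -
        have uj: "u (Suc j) = u 0 + of_nat (Suc j) * h" "u j = u 0 + of_nat j * h"
          using less.IH[of j] less.IH[of "Suc j"] less.prems 3 by simp_all
        show ?thesis unfolding uj 3 by (simp add: algebra_simps)
      qed
      finally show ?thesis .
    qed (simp_all add: h_def)
  qed
  have h0: "h \<noteq> 0"
  proof
    assume "h = 0"
    then have "u 0 = u 2" using u[of 2] d3 by simp
    then have "th 0 = th 2" by (simp add: u_def)
    then show False using th_neq[of 0 2] d3 by simp
  qed
  show ev: "even d"
  proof (rule ccontr)
    assume o: "odd d"
    have "th d = - th 0" "th (d-1) = - th 1" using flip[of 0] flip[of 1] d3 by auto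
    then have "u d = u 0" "u (d-1) = u 1" using o by (simp_all add: u_def)
    moreover have "u 1 = u 0 + h" by (simp add: h_def)
    ultimately have "u 0 + of_nat d * h = u 0" "u 0 + of_nat (d-1) * h = u 0 + h"
      using u[of d] u[of "d-1"] by (metis diff_le_self order_refl)+
    then have "of_nat d * h = 0" "of_nat (d-1) * h = h" by (metis add_cancel_right_right, metis add_left_cancel)
    then have "(of_nat d :: 'a) = 0" "(of_nat (d-1) :: 'a) = 1" using h0 by simp_all
    moreover have "(of_nat d :: 'a) = of_nat (d-1) + 1" using d3 by (simp add: of_nat_diff)
    ultimately show False using two by simp
  qed
  define g where "g = h / 2"
  have h: "h = 2 * g" using two by (simp add: g_def)
  have "th d = - th 0" using flip[of 0] d3 by auto
  then have "u d = - u 0" using ev by (simp add: u_def)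
  then have "2 * (u 0 + of_nat d * g) = 0" using u[of d] by (simp add: h algebra_simps eq_neg_iff_add_eq_0)
  then have "u 0 + of_nat d * g = 0" using two mult_eq_0_iff by blast
  then have u0: "u 0 = - (of_nat d * g)" by (simp add: eq_neg_iff_add_eq_0)
  have "th i = (-1)^i * g * (2 * of_nat i - of_nat d)" if "i \<le> d" for i
  proof -
    have "th i = (-1)^i * (u 0 + of_nat i * h)" unfolding thu[of i] u[OF that] ..
    also have "\<dots> = (-1)^i * g * (2 * of_nat i - of_nat d)" unfolding u0 h by (simp add: algebra_simps)
    finally show ?thesis .
  qed
  moreover have "g \<noteq> 0" using h0 h by auto
  ultimately show "\<exists>g. g \<noteq> 0 \<and> (\<forall>i\<le>d. th i = (-1)^i * g * (2 * of_nat i - of_nat d))" by blast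
qed

text \<open>Since x and y alternate in sign, both equations depend on z only through the second
  difference, with the same factor a + b. Comparing them gives \<rho> a = \<rho> b, hence a = b;
  there remains a second-order recurrence for z with an alternating source.\<close>

lemma family_BI_fits:
  assumes \<beta>: "\<beta> = -2"
  shows "\<exists>\<xi> \<xi>s X Y Z. fits \<xi> \<xi>s X Y Z \<and> family_BI d (Tpair d X Y Z)"
proof -
  have ev: "even d" by (rule th_alternating(1)[OF \<beta>])
  obtain g where g: "g \<noteq> 0" and th: "\<And>i. i \<le> d \<Longrightarrow> th i = (-1)^i * g * (2 * of_nat i - of_nat d)"
    using th_alternating(2)[OF \<beta>] by blast
  have one: "r = - 1" if "r^2 - \<beta> * r + 1 = 0" for r
  proof -
    have "(r + 1)^2 = 0" using that \<beta> by (simp add: power2_eq_square algebra_simps)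
    then show ?thesis by (simp add: eq_neg_iff_add_eq_0)
  qed
  define a where "a = x 1"
  define b where "b = y 1"
  have x: "x i = a * (-1)^(i-1)" and y: "y i = b * (-1)^(i-1)" if "1 \<le> i" "i \<le> d" for i
  proof -
    obtain r t where "r^2 - \<beta> * r + 1 = 0" "\<forall>i. 1 \<le> i \<and> i \<le> d \<longrightarrow> x i = x 1 * r ^ (i-1)"
      "t^2 - \<beta> * t + 1 = 0" "\<forall>i. 1 \<le> i \<and> i \<le> d \<longrightarrow> y i = y 1 * t ^ (i-1)"
      using x_ratio y_ratio by blast
    then show "x i = a * (-1)^(i-1)" "y i = b * (-1)^(i-1)" using one[of r] one[of t] that
      unfolding a_def b_def by blast+
  qed
  have n1: "a \<noteq> 0" "b \<noteq> 0" using nonzero[of 1] d3 by (auto simp: a_def b_def)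
  have t0: "th 0 = - (g * of_nat d)" and t1: "th 1 = - (g * (2 - of_nat d))"
    using th[of 0] th[of 1] d3 by simp_all
  have rho4: "\<rho> = 4 * g^2"
    unfolding rho \<beta> t0 t1 by (simp add: power2_eq_square algebra_simps)
  have four: "(4::'a) \<noteq> 0" using two by (metis mult_2 mult_eq_0_iff numeral_Bit0 numeral_code(2))
  have rho0: "\<rho> \<noteq> 0" using rho4 four g by simp
  have sg: "(- 1 :: 'a) ^ k * (-1) ^ k = 1" for k by (simp flip: power_add)
  have prev: "z (i-1) * x (i-1) = - z (i-1) * a * (-1)^(i-1)" "z (i-1) * y (i-1) = - z (i-1) * b * (-1)^(i-1)"
    if i: "1 \<le> i" "i \<le> d" for i
  proof -
    have "z (i-1) * x (i-1) = - z (i-1) * a * (-1)^(i-1) \<and> z (i-1) * y (i-1) = - z (i-1) * b * (-1)^(i-1)"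
    proof (cases "i = 1")
      case False
      then obtain j where j: "i = Suc (Suc j)" using i by (metis One_nat_def Suc_le_D not_one_le_zero le_SucE old.nat.exhaust)
      show ?thesis using x[of "Suc j"] y[of "Suc j"] i j by simp
    qed (simp add: z0)
    then show "z (i-1) * x (i-1) = - z (i-1) * a * (-1)^(i-1)" "z (i-1) * y (i-1) = - z (i-1) * b * (-1)^(i-1)" by auto
  qed
  have nxt: "z (Suc i) * x (Suc i) = - z (Suc i) * a * (-1)^(i-1)" "z (Suc i) * y (Suc i) = - z (Suc i) * b * (-1)^(i-1)"
    if i: "1 \<le> i" "i \<le> d" for i
  proof -
    have "z (Suc i) * x (Suc i) = - z (Suc i) * a * (-1)^(i-1) \<and> z (Suc i) * y (Suc i) = - z (Suc i) * b * (-1)^(i-1)"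
    proof (cases "i = d")
      case False
      obtain j where j: "i = Suc j" using i by (cases i) auto
      show ?thesis using x[of "Suc i"] y[of "Suc i"] i j False by simp
    qed (simp add: zd)
    then show "z (Suc i) * x (Suc i) = - z (Suc i) * a * (-1)^(i-1)" "z (Suc i) * y (Suc i) = - z (Suc i) * b * (-1)^(i-1)" by auto
  qed
  have E: "(a + b) * (2 * z i - z (i-1) - z (Suc i)) = \<rho> * a + \<omega> * (-1)^(i-1)"
    "(a + b) * (2 * z i - z (i-1) - z (Suc i)) = \<rho> * b + \<omega> * (-1)^(i-1)"
    if i: "1 \<le> i" "i \<le> d" for i
  proof -
    define e :: 'a where "e = (-1)^(i-1)"
    have ee: "e * e = 1" using sg[of "i-1"] by (simp add: e_def)
    have p: "z (i-1) * x (i-1) = - z (i-1) * a * e" "z (i-1) * y (i-1) = - z (i-1) * b * e"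
      "z (Suc i) * x (Suc i) = - z (Suc i) * a * e" "z (Suc i) * y (Suc i) = - z (Suc i) * b * e"
      "x i = a * e" "y i = b * e" using prev[OF i] nxt[OF i] x[OF i] y[OF i] by (simp_all add: e_def)
    have "z (i-1) * (x i) + z (i-1) * y (i-1) + 2 * (z (i-1) * x (i-1)) + z i * (2 * x i + 2 * y i)
        + z (Suc i) * x i + z (Suc i) * y (Suc i) + 2 * (z (Suc i) * x (Suc i)) = \<rho> * x i + \<omega>"
      using eqx'[OF i] unfolding \<beta> by (simp add: algebra_simps)
    then have "e * ((a + b) * (2 * z i - z (i-1) - z (Suc i))) = e * (\<rho> * a) + \<omega>"
      unfolding p by (simp add: algebra_simps)
    then have "e * (e * ((a + b) * (2 * z i - z (i-1) - z (Suc i)))) = e * (e * (\<rho> * a) + \<omega>)" by simp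
    then show "(a + b) * (2 * z i - z (i-1) - z (Suc i)) = \<rho> * a + \<omega> * (-1)^(i-1)"
      unfolding distrib_left mult.assoc[symmetric] ee e_def[symmetric] by (simp add: mult_ac)
    have "z (i-1) * (y i) + z (i-1) * x (i-1) + 2 * (z (i-1) * y (i-1)) + z i * (2 * y i + 2 * x i)
        + z (Suc i) * y i + z (Suc i) * x (Suc i) + 2 * (z (Suc i) * y (Suc i)) = \<rho> * y i + \<omega>"
      using eqy'[OF i] unfolding \<beta> by (simp add: algebra_simps)
    then have "e * ((a + b) * (2 * z i - z (i-1) - z (Suc i))) = e * (\<rho> * b) + \<omega>"
      unfolding p by (simp add: algebra_simps)
    then have "e * (e * ((a + b) * (2 * z i - z (i-1) - z (Suc i)))) = e * (e * (\<rho> * b) + \<omega>)" by simp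
    then show "(a + b) * (2 * z i - z (i-1) - z (Suc i)) = \<rho> * b + \<omega> * (-1)^(i-1)"
      unfolding distrib_left mult.assoc[symmetric] ee e_def[symmetric] by (simp add: mult_ac)
  qed
  have "\<rho> * a = \<rho> * b" using E[of 1] d3 by simp
  then have ab: "b = a" using rho0 by simp
  \<comment> \<open>This \<epsilon> is the amplitude of the alternating part of z and not the sign
    in the family, for which 1 is taken below. The linear coefficient \<mu> is fitted to
    z_1.\<close>
  define \<epsilon> where "\<epsilon> = - \<omega> / (8 * a)"
  define \<mu> where "\<mu> = z 1 + g^2 + 2 * \<epsilon>"
  have eight: "(8::'a) \<noteq> 0" using two four by (metis mult_2 mult_eq_0_iff numeral_Bit0)
  have om: "\<omega> = - 8 * a * \<epsilon>" using n1 eight by (simp add: \<epsilon>_def)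
  have rec2: "z (Suc i) = 2 * z i - z (i-1) - 2 * g^2 + 4 * \<epsilon> * (-1)^(i-1)" if i: "1 \<le> i" "i \<le> d" for i
  proof -
    have "(2 * a) * (2 * z i - z (i-1) - z (Suc i)) = (2 * a) * (2 * g^2 - 4 * \<epsilon> * (-1)^(i-1))"
      using E(1)[OF i] unfolding ab rho4 om by (simp add: algebra_simps)
    then have "2 * z i - z (i-1) - z (Suc i) = 2 * g^2 - 4 * \<epsilon> * (-1)^(i-1)" using n1 two by simp
    then show ?thesis by (simp add: algebra_simps)
  qed
  have z: "i \<le> Suc d \<Longrightarrow> z i = - (g^2 * of_nat i ^ 2) + \<mu> * of_nat i - \<epsilon> + \<epsilon> * (-1)^i" for i
  proof (induction i rule: less_induct)
    case (less i)
    consider "i = 0" | "i = 1" | j where "i = Suc (Suc j)" by (metis One_nat_def not0_implies_Suc)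
    then show ?case
    proof cases
      case 1 then show ?thesis using z0 by simp
    next
      case 2 then show ?thesis by (simp add: \<mu>_def)
    next
      case 3
      have zj: "z j = - (g^2 * of_nat j ^ 2) + \<mu> * of_nat j - \<epsilon> + \<epsilon> * (-1)^j"
        "z (Suc j) = - (g^2 * of_nat (Suc j) ^ 2) + \<mu> * of_nat (Suc j) - \<epsilon> + \<epsilon> * (-1)^(Suc j)"
        using less.IH[of j] less.IH[of "Suc j"] less.prems 3 by simp_all
      have "z i = 2 * z (Suc j) - z j - 2 * g^2 + 4 * \<epsilon> * (-1)^j"
        using rec2[of "Suc j"] less.prems 3 by simp
      then show ?thesis unfolding zj 3 by (simp add: power2_eq_square algebra_simps)
    qed
  qed
  define N :: 'a where "N = of_nat (Suc d)"
  have Nd: "of_nat d = N - 1" by (simp add: N_def)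
  \<comment> \<open>The boundary value z_(d+1) = 0, at an odd index, eliminates \<epsilon>. The one
    free parameter \<mu> then turns into \<tau>.\<close>
  have eps: "2 * \<epsilon> = - (g^2 * N^2) + \<mu> * N"
    using z[of "Suc d"] zd ev by (simp add: N_def algebra_simps)
  define M where "M = \<mu> / g^2"
  have M: "\<mu> = g^2 * M" using g by (simp add: M_def)
  define \<tau> where "\<tau> = N - M"
  have M': "M = N - \<tau>" by (simp add: \<tau>_def)
  have ze: "z i = g^2 * (of_nat i * (N - of_nat i - \<tau>))" if "i \<le> d" "even i" for i
    using z[of i] that unfolding M M' by (simp add: algebra_simps power2_eq_square)
  have zo: "z i = g^2 * ((N - of_nat i) * (of_nat i + \<tau>))" if "i \<le> d" "odd i" for i
  proof -
    have "z i = - (g^2 * of_nat i ^ 2) + \<mu> * of_nat i - 2 * \<epsilon>" using z[of i] that by simp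
    then show ?thesis unfolding eps M M' by (simp add: algebra_simps power2_eq_square)
  qed
  have N': "N - of_nat i = of_nat (d - i + 1)" if "i \<le> d" for i
    using that by (simp add: N_def of_nat_diff)
  have tau: "\<tau> \<noteq> of_int (2 * int k + 1 - int d)" if k: "k < d" for k
  proof
    assume t: "\<tau> = of_int (2 * int k + 1 - int d)"
    then have t': "\<tau> = 2 * of_nat k + 2 - N" by (simp add: Nd)
    show False
    \<comment> \<open>A forbidden \<tau> annihilates the factor \<open>of_nat i + \<tau>\<close> at
      the odd index i = d - 2k - 1, or the factor \<open>N - of_nat i - \<tau>\<close> at the even
      index i = 2(d - k).\<close>
    proof (cases "2 * k < d")
      case True
      obtain e where e: "d = 2 * e" using ev by (rule evenE)
      then have "k < e" using True by simp
      then obtain j where j: "e = Suc (k + j)" using less_imp_Suc_add by blast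
      define i where "i = 2 * j + 1"
      have i: "1 \<le> i" "i \<le> d" "odd i" by (simp_all add: i_def e j)
      have "of_nat i = N - 2 * of_nat k - 2" by (simp add: i_def N_def e j algebra_simps)
      then have "z i = 0" using zo[OF i(2,3)] t' by simp
      then show False using nonzero[OF i(1,2)] by simp
    next
      case False
      obtain j where j: "d = Suc (k + j)" using less_imp_Suc_add[OF k] by blast
      define i where "i = 2 * j + 2"
      have i: "1 \<le> i" "i \<le> d" "even i" using False by (simp_all add: i_def j)
      have "of_nat i = 2 * N - 2 * of_nat k - 2" by (simp add: i_def N_def j algebra_simps)
      then have "z i = 0" using ze[OF i(2,3)] t' by simp
      then show False using nonzero[OF i(1,2)] by simp
    qed
  qed
  \<comment> \<open>A characteristic p with 0 < p \<le> d is odd because 2 is not 0, and then th_p =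
    th_d although p and d differ in parity.\<close>
  have char: "char_ok d TYPE('a)"
  proof (rule ccontr)
    assume "\<not> ?thesis"
    then have c: "CHAR('a) \<noteq> 0" "CHAR('a) \<le> d" by (auto simp: char_ok_def)
    define p where "p = CHAR('a)"
    have odd: "odd p"
    proof
      assume "even p"
      then obtain k where k: "p = 2 * k" by blast
      have "(of_nat p :: 'a) = 0" by (simp add: p_def)
      then have "2 * (of_nat k :: 'a) = 0" unfolding k by simp
      then have "(of_nat k :: 'a) = 0" using two by simp
      then have "CHAR('a) dvd k" by (simp add: of_nat_eq_0_iff_char_dvd)
      then have "p dvd k" by (simp add: p_def)
      moreover have "0 < k" using c k by (auto simp: p_def)
      ultimately have "p \<le> k" by (rule dvd_imp_le)
      then show False using k \<open>0 < k\<close> by simp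
    qed
    have "th p = g * of_nat d" using th[of p] c odd by (simp add: p_def)
    moreover have "th d = g * of_nat d" using th[of d] ev by simp
    ultimately have "p = d" using th_neq[of p d] c by (auto simp: p_def)
    then show False using odd ev by simp
  qed
  have "fits (1 / g) (1 / (g * a)) (\<lambda>i. (-1)^(i-1)) (\<lambda>i. (-1)^(i-1))
      (\<lambda>i. if even i then of_nat i * (of_nat (d - i + 1) - \<tau>) else of_nat (d - i + 1) * (of_nat i + \<tau>))"
    (is "fits _ _ ?X ?Y ?Z")
    unfolding fits_def
  proof (intro conjI allI impI)
    show "1 / g \<noteq> 0" "1 / (g * a) \<noteq> 0" using g n1 by auto
    fix i assume "1 \<le> i \<and> i \<le> d"
    then have i: "1 \<le> i" "i \<le> d" by auto
    show "1 / (g * a) * x i = 1 / g * (-1)^(i-1)" "1 / (g * a) * y i = 1 / g * (-1)^(i-1)"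
      using x[OF i] y[OF i] n1 g unfolding ab by simp_all
    show "(1 / g)\<^sup>2 * z i = (if even i then of_nat i * (of_nat (d - i + 1) - \<tau>) else of_nat (d - i + 1) * (of_nat i + \<tau>))"
      using ze[OF i(2)] zo[OF i(2)] g unfolding N'[OF i(2)] by (simp add: power_divide)
  qed
  moreover have "family_BI d (Tpair d ?X ?Y ?Z)"
    unfolding family_BI_def by (rule exI[of _ \<tau>], rule exI[of _ 1], unfold mult_1_left mult_1_right) (use ev char tau in blast)
  ultimately show ?thesis by blast
qed

end

section \<open>The generic case\<close>

text \<open>The general solution is A q^i + B q^(-i). With Q = q^d, the reversal at the indices 0
  and 1 gives (A + B/Q)(Q + 1) = 0 and (A + B/Q)(Q/q + q) = 0, and the second factors cannot both
  vanish unless q^2 = 1.\<close>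

lemma q_sequence:
  fixes th :: "nat \<Rightarrow> 'a::field"
  assumes d: "3 \<le> d" and inj: "inj_on th {0..d}"
    and flip: "\<And>i. i \<le> d \<Longrightarrow> th (d - i) = - th i"
    and rec: "\<And>i. 1 \<le> i \<Longrightarrow> i < d \<Longrightarrow> th (i-1) + th (Suc i) = (q + 1/q) * th i"
    and q: "q \<noteq> 0" "q^2 \<noteq> 1"
  shows "\<exists>k. k \<noteq> 0 \<and> (\<forall>i\<le>d. th i = k * (q^i - q^(d-i)))"
proof -
  define w where "w = q - 1/q"
  have w: "w \<noteq> 0" using q by (simp add: w_def field_simps power2_eq_square)
  define A where "A = (th 1 - th 0 / q) / w"
  define B where "B = th 0 - A"
  have th0: "th 0 = A + B" by (simp add: B_def)
  have th1: "th 1 = A * q + B / q"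
  proof -
    have "A * w = th 1 - th 0 / q" using w by (simp add: A_def)
    then have "th 1 = A * (q - 1/q) + th 0 / q" by (simp add: w_def)
    then show ?thesis unfolding th0 by (simp add: algebra_simps add_divide_distrib)
  qed
  have th: "i \<le> d \<Longrightarrow> th i = A * q^i + B / q^i" for i
  proof (induction i rule: less_induct)
    case (less i)
    consider "i = 0" | "i = 1" | j where "i = Suc (Suc j)" by (metis One_nat_def not0_implies_Suc)
    then show ?case
    proof cases
      case 1 then show ?thesis using th0 by simp
    next
      case 2 then show ?thesis using th1 by simp
    next
      case 3
      have tj: "th j = A * q^j + B / q^j" "th (Suc j) = A * q^Suc j + B / q^Suc j"
        using less.IH[of j] less.IH[of "Suc j"] less.prems 3 by simp_all
      have "th i = (q + 1/q) * th (Suc j) - th j" using rec[of "Suc j"] less.prems 3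
        by (simp add: eq_diff_eq add.commute)
      also have "\<dots> = A * q^i + B / q^i" unfolding tj 3 using q by (simp add: field_simps)
      finally show ?thesis .
    qed
  qed
  define Q where "Q = q^d"
  have Q0: "Q \<noteq> 0" using q by (simp add: Q_def)
  have "th d = - th 0" "th (d - 1) = - th 1" using flip[of 0] flip[of 1] d by auto
  moreover have "q^(d-1) = Q / q" using d q by (simp add: Q_def power_diff)
  ultimately have e: "A * Q + B / Q = - (A + B)" "A * (Q / q) + B / (Q / q) = - (A * q + B / q)"
    using th[of d] th[of "d-1"] th0 th1 by (simp_all add: Q_def)
  have "(A + B / Q) * (Q + 1) = 0" using e(1) Q0 by (simp add: field_simps)
  moreover have "(A + B / Q) * (Q / q + q) = 0"
  proof -
    have "(A + B / Q) * (Q / q + q) = (A * (Q / q) + B / (Q / q)) + (A * q + B / q)"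
      using Q0 q by (simp add: field_simps)
    then show ?thesis unfolding e(2) by simp
  qed
  ultimately have AB: "A + B / Q = 0"
  proof -
    have "\<not> (Q + 1 = 0 \<and> Q / q + q = 0)"
    proof
      assume "Q + 1 = 0 \<and> Q / q + q = 0"
      then have "Q = - 1" "Q + q * q = 0" using q by (auto simp: field_simps eq_neg_iff_add_eq_0)
      then have "q^2 = 1" by (simp add: power2_eq_square)
      then show False using q by simp
    qed
    then show ?thesis using \<open>(A + B / Q) * (Q + 1) = 0\<close> \<open>(A + B / Q) * (Q / q + q) = 0\<close> by auto
  qed
  then have "A = - (B / Q)" by (simp add: eq_neg_iff_add_eq_0)
  then have B: "B = - A * Q" using Q0 by simp
  have "th i = A * (q^i - q^(d-i))" if "i \<le> d" for i
    using th[OF that] that q unfolding B by (simp add: Q_def power_diff algebra_simps)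
  moreover have "A \<noteq> 0"
  proof
    assume "A = 0"
    then have "th 0 = th 1" using th0 th1 B by simp
    then show False using inj_onD[OF inj, of 0 1] d by simp
  qed
  ultimately show ?thesis by blast
qed

context td_data
begin

definition qform :: "'a \<Rightarrow> 'a \<Rightarrow> bool" where
  "qform q k \<longleftrightarrow> q \<noteq> 0 \<and> q^2 \<noteq> 1 \<and> \<beta> = q + 1/q \<and> k \<noteq> 0 \<and> (\<forall>i\<le>d. th i = k * (q^i - q^(d-i)))"

lemma qform_exists: "q \<noteq> 0 \<Longrightarrow> q^2 \<noteq> 1 \<Longrightarrow> \<beta> = q + 1/q \<Longrightarrow> \<exists>k. qform q k"
  unfolding qform_def using q_sequence[OF d3 inj flip, of q] rec by simp

lemma rhos_nonzero:
  assumes q: "q \<noteq> 0" "q^2 \<noteq> 1" "\<beta> = q + 1/q"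
  shows "\<rho>s \<noteq> 0"
proof -
  obtain k where k: "k \<noteq> 0" "\<And>i. i \<le> d \<Longrightarrow> ths i = k * (q^i - q^(d-i))"
    using q_sequence[OF d3 injs flips, of q] recs q by auto
  define Q where "Q = q^d"
  have "q^(d-1) = Q / q" using d3 q by (simp add: Q_def power_diff)
  then have t: "ths 0 = k * (1 - Q)" "ths 1 = k * (q - Q / q)" using k(2)[of 0] k(2)[of 1] d3 by (simp_all add: Q_def)
  have "\<rho>s = k^2 * Q * (q - 1/q)^2"
    unfolding rhos q(3) t using q(1) by (simp add: field_simps power2_eq_square)
  moreover have "q - 1/q \<noteq> 0" using q by (simp add: field_simps power2_eq_square)
  ultimately show ?thesis using k q by (simp add: Q_def)
qed

text \<open>The conditions on the powers of q express that th_i differs from th_0, as th_i - th_0 =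
  k (q^i - 1)(q^(d-i) + 1).\<close>

lemma qform_facts:
  assumes qf: "qform q k"
  shows "1 \<le> i \<Longrightarrow> i \<le> d \<Longrightarrow> q^i \<noteq> 1" "i < d \<Longrightarrow> q^i \<noteq> -1"
    "th 0 = k * (1 - q^d)" "th 1 = k * (q - q^d / q)" "\<rho> = k^2 * q^d * (q - 1/q)^2"
    "q \<noteq> 1" "q \<noteq> -1" "2 + \<beta> = (1 + q)^2 / q" "\<beta> \<noteq> 2"
proof -
  note qf = qf[unfolded qform_def]
  then have q: "q \<noteq> 0" "q^2 \<noteq> 1" "\<beta> = q + 1/q" "k \<noteq> 0" and th: "\<And>i. i \<le> d \<Longrightarrow> th i = k * (q^i - q^(d-i))" by auto
  show "q^i \<noteq> 1" if "1 \<le> i" "i \<le> d"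
  proof
    assume "q^i = 1"
    moreover have "q^d = q^i * q^(d-i)" using that by (simp flip: power_add)
    ultimately have "th i = th 0" using th[of i] th[of 0] that by simp
    then show False using th_neq[of i 0] that by auto
  qed
  show "q^i \<noteq> -1" if "i < d"
  proof
    assume "q^i = -1"
    moreover have "q^d = q^i * q^(d-i)" using that by (simp flip: power_add)
    ultimately have "th (d-i) = th 0" using th[of "d-i"] th[of 0] that by simp
    then show False using th_neq[of "d-i" 0] that by auto
  qed
  show t: "th 0 = k * (1 - q^d)" "th 1 = k * (q - q^d / q)"
    using th[of 0] th[of 1] d3 q by (simp_all add: power_diff)
  show "\<rho> = k^2 * q^d * (q - 1/q)^2"
    unfolding rho q(3) t using q(1) by (simp add: field_simps power2_eq_square)
  show "q \<noteq> 1" "q \<noteq> -1" using q by auto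
  show "2 + \<beta> = (1 + q)^2 / q" unfolding q(3) using q(1) by (simp add: field_simps power2_eq_square)
  show "\<beta> \<noteq> 2"
  proof
    assume "\<beta> = 2"
    then have "(q - 1)^2 = 0" using q by (simp add: field_simps power2_eq_square)
    then show False using \<open>q \<noteq> 1\<close> by simp
  qed
qed

section \<open>Family C: equal ratios of x and y, distinct initial values\<close>

text \<open>Here x - y is geometric and the solution z involves neither x_1 nor y_1, so its
  nonvanishing cannot restrict s. The inequalities for s come from \<open>nondeg\<close>, once c and
  \<rho>s are computed.\<close>

lemma family_C_fits:
  assumes root: "\<And>a :: 'a. \<exists>s. s^2 = a" and qf: "qform q k"
    and x: "\<And>i. 1 \<le> i \<Longrightarrow> i \<le> d \<Longrightarrow> x i = x 1 / q^(i-1)"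
    and y: "\<And>i. 1 \<le> i \<Longrightarrow> i \<le> d \<Longrightarrow> y i = y 1 / q^(i-1)" and xy: "x 1 \<noteq> y 1"
  shows "\<exists>\<xi> \<xi>s X Y Z. fits \<xi> \<xi>s X Y Z \<and> family_C d (Tpair d X Y Z)"
proof -
  have q: "q \<noteq> 0" "q^2 \<noteq> 1" "\<beta> = q + 1/q" "k \<noteq> 0" using qf by (auto simp: qform_def)
  have th: "th i = k * (q^i - q^(d-i))" if "i \<le> d" for i using qf that by (auto simp: qform_def)
  note f = qform_facts[OF qf]
  define Q where "Q = q^d"
  have Q0: "Q \<noteq> 0" using q by (simp add: Q_def)
  have Q1: "Q \<noteq> 1" using f(1)[of d] d3 by (simp add: Q_def)
  have q1: "1 + q \<noteq> 0" "q - 1 \<noteq> 0" using f(6,7) by (auto simp: add_eq_0_iff)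
  define a where "a = x 1"
  define b where "b = y 1"
  have ab: "a \<noteq> 0" "b \<noteq> 0" "a - b \<noteq> 0" using nonzero[of 1] d3 xy by (auto simp: a_def b_def)
  define D where "D i = (a - b) * q / q^i" for i
  have xj: "x (Suc j) = a / q^j" "y (Suc j) = b / q^j" if "Suc j \<le> d" for j
    using x[of "Suc j"] y[of "Suc j"] that by (simp_all add: a_def b_def)
  have XD: "x i - y i = D i" if i: "1 \<le> i" "i \<le> d" for i
  proof -
    obtain j where j: "i = Suc j" using i by (cases i) auto
    show ?thesis using xj[of j] i q unfolding D_def j by (simp add: diff_divide_distrib)
  qed
  have rD: "D i + D (Suc (Suc i)) = \<beta> * D (Suc i)" for i
    unfolding D_def q(3) using q by (simp add: field_simps power2_eq_square)
  define F where "F i = k^2 * (q^i - 1) * (Q - q^i / q)" for i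
  have z1: "z 1 = F 1"
  proof -
    have D12: "D 1 = a - b" "D 2 = (a - b) / q" using q by (simp_all add: D_def power2_eq_square)
    have "z 1 * ((a - b) * (1 + q) / q) = z 1 * (D 2 + D 1)"
      unfolding D12 using q by (simp add: field_simps)
    also have "\<dots> = th 0 * (th 0 * D 2 - th 1 * D 1)" by (rule difference_corner[OF XD])
    also have "\<dots> = F 1 * ((a - b) * (1 + q) / q)"
      unfolding f(3,4) D12 F_def Q_def[symmetric] using q by (simp add: field_simps power2_eq_square)
    finally have "z 1 * ((a - b) * (1 + q) / q) = F 1 * ((a - b) * (1 + q) / q)" .
    moreover have "(a - b) * (1 + q) / q \<noteq> 0" using ab q q1 by simp
    ultimately show ?thesis by (metis mult_cancel_right)
  qed
  have z: "i \<le> d \<Longrightarrow> z i = F i" for i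
  proof (induction i rule: less_induct)
    case (less i)
    consider "i = 0" | "i = 1" | j where "i = Suc (Suc j)" by (metis One_nat_def not0_implies_Suc)
    then show ?case
    proof cases
      case 1 then show ?thesis using z0 by (simp add: F_def)
    next
      case 2 then show ?thesis using z1 by simp
    next
      case 3
      have zj: "z j = F j" "z (Suc j) = F (Suc j)"
        using less.IH[of j] less.IH[of "Suc j"] less.prems 3 by simp_all
      define u where "u = q^j"
      have u: "u \<noteq> 0" using q by (simp add: u_def)
      define G where "G = (a - b) / (q * q * u)"
      have DE: "D (Suc (Suc (Suc j))) + D (Suc (Suc j)) = G * (1 + q)" "D (Suc j) = G * (q * q)"
        unfolding G_def D_def using q u by (simp_all add: u_def field_simps)
      have zD: "z j * (D j + D (j-1)) = F j * (G * (1 + q) * (q * q * q))"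
      proof (cases j)
        case 0 then show ?thesis by (simp add: z0 F_def)
      next
        case (Suc m)
        have "D j + D (j-1) = G * (1 + q) * (q * q * q)"
          unfolding G_def D_def u_def Suc using q by (simp add: field_simps)
        then show ?thesis unfolding zj by simp
      qed
      have E0: "G * (1 + q) \<noteq> 0" using ab q u q1 by (simp add: G_def)
      have "z i * (G * (1 + q)) = z (Suc (Suc j)) * (D (Suc (Suc (Suc j))) + D (Suc (Suc j)))"
        unfolding 3 DE ..
      also have "\<dots> = F (Suc j) * ((1 + q)^2 / q) * (G * (q * q)) - F j * (G * (1 + q) * (q * q * q)) - \<rho> * (G * (q * q))"
        using difference_equation[of D "Suc j", OF XD rD] less.prems 3 zD f(8) DE(2) zj(2) by simp
      also have "\<dots> = F i * (G * (1 + q))"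
        unfolding f(5) F_def 3 Q_def[symmetric] using q
        by (simp add: u_def[symmetric] field_simps power2_eq_square)
      finally show ?thesis using E0 by simp
    qed
  qed
  \<comment> \<open>When x_1 is scaled to s, the family prescribes y_1 = q^(d-1) / s, that is x_1 /
    y_1 = s^2 q / Q.\<close>
  obtain s where s: "s^2 = a / b * (Q / q)" using root by blast
  have s0: "s \<noteq> 0" using s ab q Q0 by auto
  have ab_s: "a * Q = b * q * s^2" using s ab q by (simp add: field_simps)
  have corner: "c = k^2 * (Q - 1) * (q - 1) * (a + b)"
  proof -
    have x2: "x 2 = a / q" using x[of 2] d3 by (simp add: a_def)
    have "c = (b - a / q) * F 1 + a / q * (k * (1 - Q))^2 - (k * (1 - Q)) * (k * (q - Q / q)) * a"
      using corner1 x2 z1 f(3,4) by (simp add: a_def b_def Q_def)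
    also have "\<dots> = k^2 * (Q - 1) * (q - 1) * (a + b)"
      unfolding F_def using q by (simp add: field_simps power2_eq_square)
    finally show ?thesis .
  qed
  \<comment> \<open>The two dual equations at i = 1 have a difference free of \<omega>, from which
    \<rho>s can be read off.\<close>
  have rhos': "\<rho>s = a * b * k^2 * (q - 1/q)^2 * q"
  proof -
    have x2: "x 2 = a / q" "y 2 = b / q" using x[of 2] y[of 2] d3 by (simp_all add: a_def b_def)
    have z2: "z 2 = k^2 * (q*q - 1) * (Q - q)" using z[of 2] d3 q by (simp add: F_def power2_eq_square)
    have z1': "z 1 = k^2 * (q - 1) * (Q - 1)" using z1 q by (simp add: F_def)
    have e1: "a * b * z 1 * (2 * inverse a - \<beta> * inverse b) + (a / q) * (b / q) * z 2 * (inverse a + inverse (b / q) - \<beta> * inverse (a / q)) = \<rho>s * inverse a + \<omega>"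
      using eqxs x2 z0 d3 unfolding aw_eqs_def by (auto simp: a_def b_def numeral_2_eq_2)
    have e2: "a * b * z 1 * (2 * inverse b - \<beta> * inverse a) + (a / q) * (b / q) * z 2 * (inverse b + inverse (a / q) - \<beta> * inverse (b / q)) = \<rho>s * inverse b + \<omega>"
      using eqys x2 z0 d3 unfolding aw_eqs_def by (auto simp: a_def b_def numeral_2_eq_2 mult.commute[of "x _" "y _"])
    have "(\<rho>s * inverse a + \<omega>) - (\<rho>s * inverse b + \<omega>) = \<rho>s * (b - a) / (a * b)"
      using ab by (simp add: field_simps)
    moreover have "(a * b * z 1 * (2 * inverse a - \<beta> * inverse b) + (a / q) * (b / q) * z 2 * (inverse a + inverse (b / q) - \<beta> * inverse (a / q)))
       - (a * b * z 1 * (2 * inverse b - \<beta> * inverse a) + (a / q) * (b / q) * z 2 * (inverse b + inverse (a / q) - \<beta> * inverse (b / q)))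
      = a * b * k^2 * (q - 1/q)^2 * q * (b - a) / (a * b)"
      unfolding z1' z2 q(3) using ab q by (simp add: field_simps power2_eq_square)
    ultimately have "\<rho>s * ((b - a) / (a * b)) = a * b * k^2 * (q - 1/q)^2 * q * ((b - a) / (a * b))"
      unfolding e1 e2 by simp
    moreover have "(b - a) / (a * b) \<noteq> 0" using ab by auto
    ultimately show ?thesis by (metis mult_cancel_right)
  qed
  \<comment> \<open>With u = q^i and v = Q/(u q), \<open>nondeg\<close> at i+1 amounts to s^2 (u +
    v)^2 being different from (s^2 + u v)^2. The difference of these two is (s^2 - u^2)(s^2 - v^2)
    up to sign.\<close>
  have degenerate: "s^2 \<noteq> q^(2*i)" "s^2 \<noteq> (Q / q^(Suc i))^2" if i: "Suc i < d" for i
  proof -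
    define u where "u = q^i"
    have u: "u \<noteq> 0" using q by (simp add: u_def)
    have qd: "q^(d-i) = Q / u" "q^(d - Suc i) = Q / (u * q)"
      using i q by (simp_all add: Q_def u_def power_diff mult.commute)
    have "th (Suc i) - th i = k * (q^Suc i - q^(d - Suc i)) - k * (q^i - q^(d-i))"
      using th[of i] th[of "Suc i"] i by simp
    also have "\<dots> = k * (q - 1) * (u + Q / (u * q))"
      unfolding qd power_Suc u_def[symmetric] using q u by (simp add: field_simps)
    finally have dth: "th (Suc i) - th i = k * (q - 1) * (u + Q / (u * q))" .
    have nd: "\<rho>s * (k * (q - 1) * (u + Q / (u * q)))^2 * (k * (1 - Q))^2 \<noteq> (k^2 * (Q - 1) * (q - 1) * (a + b))^2 * \<rho>"
      using nondeg[OF f(9), of "Suc i"] i dth f(3) corner by (simp add: Q_def)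
    have key: "s^2 \<noteq> u^2 \<and> s^2 \<noteq> (Q / (u * q))^2"
    proof (rule ccontr)
      assume H: "\<not> ?thesis"
      have "s^2 * (u + Q / (u * q))^2 = (s^2 + Q / q)^2"
      proof -
        define v where "v = Q / (u * q)"
        have v: "Q / q = u * v" using u q by (simp add: v_def)
        from H have "s^2 = u^2 \<or> s^2 = v^2" by (auto simp: v_def)
        then show ?thesis unfolding v v_def[symmetric] by (auto simp: algebra_simps power2_eq_square)
      qed
      then have e: "(b * q)^2 * (s^2 * (u + Q / (u * q))^2) = (b * q * s^2 + b * Q)^2"
        using q by (simp add: field_simps power2_eq_square)
      have "a * b * q * (u + Q / (u * q))^2 * Q = (a + b)^2 * Q^2"
      proof -
        have "a * b * q * (u + Q / (u * q))^2 * Q = (b * q) * (u + Q / (u * q))^2 * (a * Q)" by (simp add: mult_ac)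
        also have "\<dots> = (b * q)^2 * (s^2 * (u + Q / (u * q))^2)" unfolding ab_s by (simp add: power2_eq_square mult_ac)
        also have "\<dots> = (a + b)^2 * Q^2" unfolding e ab_s[symmetric] by (simp add: power2_eq_square algebra_simps)
        finally show ?thesis .
      qed
      then have e2: "a * b * q * (u + Q / (u * q))^2 = (a + b)^2 * Q"
        using Q0 by (simp add: power2_eq_square mult.assoc[symmetric])
      have "\<rho>s * (k * (q - 1) * (u + Q / (u * q)))^2 * (k * (1 - Q))^2
        = (a * b * q * (u + Q / (u * q))^2) * (k^2 * (q - 1/q)^2 * (k * (q-1))^2 * (k * (1-Q))^2)"
        unfolding rhos' power_mult_distrib by (simp only: mult_ac)
      also have "\<dots> = (k^2 * (Q - 1) * (q - 1) * (a + b))^2 * \<rho>"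
        unfolding e2 f(5) Q_def[symmetric] by (simp add: power_mult_distrib mult_ac power2_commute[of 1 Q] power2_eq_square[of "k^2"])
      finally show False using nd by blast
    qed
    show "s^2 \<noteq> q^(2*i)" using key by (simp add: u_def power_mult[symmetric] mult.commute flip: power_mult)
    show "s^2 \<noteq> (Q / q^(Suc i))^2" using key by (simp add: u_def mult.commute)
  qed
  \<comment> \<open>For i = d - 1 the power arises not as u^2 but as v^2, from the index 0.\<close>
  have "s^2 \<noteq> q^(2*i)" if i: "i < d" for i
  proof (cases "Suc i < d")
    case False
    then have "i = d - 1" using i by simp
    then have "q^i = Q / q^(Suc 0)" using d3 q by (simp add: Q_def power_diff)
    then have "q^(2*i) = (Q / q^(Suc 0))^2" by (metis power_even_eq)
    then show ?thesis using degenerate(2)[of 0] d3 by simp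
  qed (rule degenerate)
  then have qc: "q_cond d q s" unfolding q_cond_def using q s0 f(1,2) by blast
  have "fits (1 / k) (s / (k * a)) (\<lambda>i. s * q powi (1 - int i)) (\<lambda>i. inverse s * q^(d-i))
       (\<lambda>i. q^(i-1) * (q^i - 1) * (q^(d-i+1) - 1))"
    (is "fits _ _ ?X ?Y ?Z")
    unfolding fits_def
  proof (intro conjI allI impI)
    show "1 / k \<noteq> 0" "s / (k * a) \<noteq> 0" using q s0 ab by auto
    fix i assume "1 \<le> i \<and> i \<le> d"
    then have i: "1 \<le> i" "i \<le> d" by auto
    then obtain j where j: "i = Suc j" by (cases i) auto
    have p: "q powi (1 - int i) = 1 / q^j" unfolding j by (simp add: power_int_minus field_simps)
    have xi: "x i = a / q^j" "y i = b / q^j" using xj[of j] i j by simp_all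
    have zi: "z i = F i" by (rule z[OF i(2)])
    have qd: "q^(d-i) = Q / (q * q^j)" using i q unfolding j by (simp add: Q_def power_diff)
    have qd': "q^(d-i+1) = Q / q^j" unfolding power_add qd using q by simp
    show "s / (k * a) * x i = 1 / k * (s * q powi (1 - int i))"
      unfolding p xi using ab q by simp
    have "s / (k * a) * (b / q^j) = (b * q * s^2) / (k * a * q * q^j * s)"
      using ab q s0 by (simp add: field_simps power2_eq_square)
    also have "\<dots> = 1 / k * (inverse s * (Q / (q * q^j)))"
      unfolding ab_s[symmetric] using ab q s0 by (simp add: field_simps)
    finally show "s / (k * a) * y i = 1 / k * (inverse s * q^(d-i))" unfolding xi qd .
    show "(1 / k)\<^sup>2 * z i = q^(i-1) * (q^i - 1) * (q^(d-i+1) - 1)"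
      unfolding qd' zi unfolding F_def j using q by (simp add: field_simps)
  qed
  moreover have "family_C d (Tpair d ?X ?Y ?Z)"
    unfolding family_C_def by (rule exI[of _ q], rule exI[of _ s]) (use qc in blast)
  ultimately show ?thesis by blast
qed


section \<open>Family LT: reciprocal ratios of x and y\<close>

text \<open>The coefficient D_i + D_(i+1) in the recurrence for z is no longer a multiple of a power
  of q and might vanish. So the recurrence is summed twice in multiplied form, and the nonvanishing
  is deduced from the resulting product formula.\<close>

lemma family_LT_fits:
  assumes root: "\<And>a :: 'a. \<exists>s. s^2 = a" and qf: "qform q k"
    and x: "\<And>i. 1 \<le> i \<Longrightarrow> i \<le> d \<Longrightarrow> x i = x 1 / q^(i-1)"
    and y: "\<And>i. 1 \<le> i \<Longrightarrow> i \<le> d \<Longrightarrow> y i = y 1 * q^(i-1)"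
  shows "\<exists>\<xi> \<xi>s X Y Z. fits \<xi> \<xi>s X Y Z \<and> family_LT d (Tpair d X Y Z)"
proof -
  have q: "q \<noteq> 0" "q^2 \<noteq> 1" "\<beta> = q + 1/q" "k \<noteq> 0" using qf by (auto simp: qform_def)
  have th: "th i = k * (q^i - q^(d-i))" if "i \<le> d" for i using qf that by (auto simp: qform_def)
  note f = qform_facts[OF qf]
  define Q where "Q = q^d"
  have Q0: "Q \<noteq> 0" using q by (simp add: Q_def)
  have Q1: "Q \<noteq> 1" using f(1)[of d] d3 by (simp add: Q_def)
  have q1: "1 + q \<noteq> 0" "q - 1 \<noteq> 0" using f(6,7) by (auto simp: add_eq_0_iff)
  define a where "a = x 1"
  define b where "b = y 1"
  have ab: "a \<noteq> 0" "b \<noteq> 0" using nonzero[of 1] d3 by (auto simp: a_def b_def)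
  have xj: "x (Suc j) = a / q^j" "y (Suc j) = b * q^j" if "Suc j \<le> d" for j
    using x[of "Suc j"] y[of "Suc j"] that by (simp_all add: a_def b_def)
  define D where "D i = a * q / q^i - b * q^i / q" for i
  have XD: "x i - y i = D i" if i: "1 \<le> i" "i \<le> d" for i
  proof -
    obtain j where j: "i = Suc j" using i by (cases i) auto
    show ?thesis using xj[of j] i q unfolding D_def j by simp
  qed
  have rD: "D i + D (Suc (Suc i)) = \<beta> * D (Suc i)" for i
    unfolding D_def q(3) using q by (simp add: field_simps power2_eq_square)
  \<comment> \<open>\<open>e i\<close> is D_i + D_(i+1) up to a unit. It vanishes when x_1 / y_1 =
    q^(2i-1), so these are the denominators of the family.\<close>
  define e where "e i = a - b * q^i * q^i / q" for i
  have sn: "D (Suc i) + D i = (1 + q) / q^i * e i" for i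
    unfolding D_def e_def using q by (simp add: field_simps)
  \<comment> \<open>The right-hand side after one summation of the recurrence: its value at 1 comes
    from the corner equation, and it drops by \<rho> D_i in each step.\<close>
  define W where "W i = k^2 * (q - 1/q) * (Q * (q + 1) * (a * q / q^i + b * q^i / (q * q)) - (a + b * Q / q) * (1 + Q * q))" for i
  have W1: "W 1 = k^2 * (1 - Q) * (q - 1/q) * (Q * b - a)"
    unfolding W_def using q by (simp add: field_simps power2_eq_square)
  have z1: "z 1 * ((1 + q) / q * e 1) = W 1"
  proof -
    have "z 1 * (D 2 + D 1) = th 0 * (th 0 * D 2 - th 1 * D 1)" by (rule difference_corner[OF XD])
    also have "D 2 + D 1 = (1 + q) / q * e 1" using sn[of 1] by (simp add: numeral_2_eq_2)
    also have "th 0 * (th 0 * D 2 - th 1 * D 1) = W 1"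
      unfolding W1 f(3,4) D_def Q_def[symmetric] using q by (simp add: field_simps power2_eq_square)
    finally show ?thesis .
  qed
  have Wstep: "W (Suc i) = W i - \<rho> * D i" for i
    unfolding W_def D_def f(5) Q_def[symmetric] using q by (simp add: field_simps power2_eq_square)
  have zW: "i \<le> d \<Longrightarrow> z (Suc i) * (D (Suc (Suc i)) + D (Suc i)) - z i * (D i + D (i-1)) = W (Suc i)" for i
  proof (induction i)
    case 0
    then show ?case using z1 sn[of 1] z0 by simp
  next
    case (Suc i)
    have IH: "z (Suc i) * (D (Suc (Suc i)) + D (Suc i)) - z i * (D i + D (i-1)) = W (Suc i)"
      using Suc by simp
    have "z (Suc (Suc i)) * (D (Suc (Suc (Suc i))) + D (Suc (Suc i)))
      = z (Suc i) * ((2 + \<beta>) * D (Suc i)) - z i * (D i + D (i-1)) - \<rho> * D (Suc i)"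
      using difference_equation[of D "Suc i", OF XD rD] Suc.prems by (simp add: mult.assoc)
    also have "(2 + \<beta>) * D (Suc i) = (D (Suc (Suc i)) + D (Suc i)) + (D (Suc i) + D i)"
      using rD[of i] by (simp add: algebra_simps)
    finally show ?case unfolding Wstep[of "Suc i"] IH[symmetric] by (simp add: algebra_simps)
  qed
  \<comment> \<open>With S_i = D_i + D_(i+1), \<open>zW\<close> reads z_(i+1) S_(i+1) - z_i S_(i-1)
    = W_(i+1). Multiplied by S_i, its left side telescopes again; F, as a function of v = q^i, is
    the closed form of z_(i+1) S_(i+1) S_i.\<close>
  define F where "F v = k^2 * (1 + q)^2 / (q * v * v) * (v * q - 1) * (Q - v) * (a - b * v / q) * (a - b * Q * v)" for v
  have P: "Suc i \<le> d \<Longrightarrow> z (Suc i) * ((1 + q) / q^Suc i * e (Suc i)) * ((1 + q) / q^i * e i) = F (q^i)" for i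
  proof (induction i)
    case 0
    have A: "z (Suc 0) * ((1 + q) / q^Suc 0 * e (Suc 0)) = W 1" using z1 by simp
    have "W 1 * ((1 + q) / q^0 * e 0) = F (q^0)"
      unfolding F_def e_def W1 using q by (simp add: field_simps power2_eq_square)
    then show ?case unfolding A .
  next
    case (Suc i)
    define u where "u = q^i"
    have u: "u \<noteq> 0" using q by (simp add: u_def)
    have "z (Suc (Suc i)) * (D (Suc (Suc (Suc i))) + D (Suc (Suc i))) - z (Suc i) * (D (Suc i) + D i) = W (Suc (Suc i))"
      using zW[of "Suc i"] Suc.prems by simp
    then have A: "z (Suc (Suc i)) * ((1 + q) / q^Suc (Suc i) * e (Suc (Suc i))) = W (Suc (Suc i)) + z (Suc i) * ((1 + q) / q^i * e i)"
      unfolding sn by (simp only: diff_eq_eq)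
    have "z (Suc (Suc i)) * ((1 + q) / q^Suc (Suc i) * e (Suc (Suc i))) * ((1 + q) / q^Suc i * e (Suc i))
      = W (Suc (Suc i)) * ((1 + q) / q^Suc i * e (Suc i)) + z (Suc i) * ((1 + q) / q^Suc i * e (Suc i)) * ((1 + q) / q^i * e i)"
      unfolding A by (simp only: distrib_right distrib_left mult_ac add_ac)
    also have "z (Suc i) * ((1 + q) / q^Suc i * e (Suc i)) * ((1 + q) / q^i * e i) = F (q^i)"
      by (rule Suc.IH) (use Suc.prems in simp)
    also have "W (Suc (Suc i)) * ((1 + q) / q^Suc i * e (Suc i)) + F (q^i) = F (q^Suc i)"
      unfolding W_def e_def F_def power_Suc u_def[symmetric] using q u by (simp add: field_simps power2_eq_square)
    finally show ?case .
  qed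
  \<comment> \<open>If e_i = 0, then F vanishes at q^i by \<open>P\<close>. But with a = b q^(2i-1)
    every factor of F there is, up to units, some 1 - q^m with m between 1 and d.\<close>
  have e_nz: "e i \<noteq> 0" if i: "1 \<le> i" "i < d" for i
  proof
    assume e0: "e i = 0"
    define v where "v = q^i"
    have v: "v \<noteq> 0" using q by (simp add: v_def)
    have av: "a = b * v * v / q" using e0 by (simp add: e_def v_def)
    have Qv: "Q = v * q^(d-i)" using i by (simp add: Q_def v_def flip: power_add)
    have "F v = 0" using P[of i] i e0 by (simp add: v_def)
    moreover have "v * q - 1 \<noteq> 0" using f(1)[of "Suc i"] i by (simp add: v_def mult.commute)
    moreover have "Q - v \<noteq> 0" unfolding Qv using f(1)[of "d-i"] i v by simp
    moreover have "a - b * v / q \<noteq> 0"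
    proof -
      have "a - b * v / q = b * v / q * (v - 1)" unfolding av by (simp add: algebra_simps diff_divide_distrib)
      then show ?thesis using ab q v f(1)[of i] i by (simp add: v_def)
    qed
    moreover have "a - b * Q * v \<noteq> 0"
    proof -
      have "a - b * Q * v = b * v * v / q * (1 - q^(d-i) * q)" unfolding av Qv using q by (simp add: field_simps)
      moreover have "q^(d-i) * q \<noteq> 1" using f(1)[of "Suc (d-i)"] i by (simp add: mult.commute)
      ultimately show ?thesis using ab q v by simp
    qed
    ultimately show False using q q1 v unfolding F_def by simp
  qed
  obtain s where s: "s^2 = a / b" using root by blast
  have s0: "s \<noteq> 0" using s ab by auto
  have sm: "s^2 - t = (a - b * t) / b" for t unfolding s using ab by (simp add: field_simps)
  have c1: "t * (u / b) / (v / b) = t * u / v" for t u v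
    using ab by (simp add: divide_simps)
  have c2: "t * (u / b) * (u' / b) / ((v / b) * (v' / b)) = t * u * u' / (v * v')" for t u u' v v'
    using ab by (simp add: divide_simps)
  have sneq: "s^2 \<noteq> t" if "a - b * t \<noteq> 0" for t using that ab unfolding s by (auto simp: field_simps)
  \<comment> \<open>At i = d the product formula contains e_d, which may vanish, so z_d is obtained
    from \<open>zW\<close> at d and z_(d+1) = 0. Likewise z_1 comes from the corner, as e_0 may
    vanish; hence the separate cases in the family.\<close>
  have zd': "z d * ((1 + q) * q / Q * (a - b * Q * Q / (q * q * q))) = - (k^2 * (q - 1/q) * q * (1 - Q) * (a - b * Q / (q * q)))"
  proof -
    obtain n where n: "d = Suc n" using d3 by (cases d) auto
    have qn: "q^n = Q / q" using q by (simp add: Q_def n)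
    have "W (Suc d) = - (z d * (D d + D (d-1)))" using zW[of d] zd by simp
    moreover have "D d + D (d-1) = (1 + q) * q / Q * (a - b * Q * Q / (q * q * q))"
      using sn[of n] unfolding n e_def qn using q Q0 by (simp add: field_simps)
    moreover have "W (Suc d) = k^2 * (q - 1/q) * q * (1 - Q) * (a - b * Q / (q * q))"
      unfolding W_def power_Suc Q_def[symmetric] using q Q0 by (simp add: field_simps power2_eq_square)
    ultimately show ?thesis by simp
  qed
  have mid: "a - b * q^m \<noteq> 0" "a - b * Q * (q * q^m) \<noteq> 0" if m: "Suc (Suc m) < d" for m
  proof -
    have "z (Suc (Suc m)) \<noteq> 0" "e (Suc m) \<noteq> 0" "e (Suc (Suc m)) \<noteq> 0"
      using nonzero[of "Suc (Suc m)"] e_nz[of "Suc m"] e_nz[of "Suc (Suc m)"] m by auto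
    then have "F (q^Suc m) \<noteq> 0" using P[of "Suc m"] m q q1 by (metis Suc_lessD divide_eq_0_iff less_imp_le_nat mult_eq_0_iff power_not_zero)
    then have "a - b * q^Suc m / q \<noteq> 0" "a - b * Q * q^Suc m \<noteq> 0" by (auto simp: F_def)
    then show "a - b * q^m \<noteq> 0" "a - b * Q * (q * q^m) \<noteq> 0" using q by auto
  qed
  \<comment> \<open>For odd d the value q^(d-1) is neither a zero of some z_i nor of some e_i. It is
    excluded by \<open>nondeg\<close> at the two middle eigenvalues, which are opposite.\<close>
  have middle_odd: "s^2 \<noteq> q^(d-1)" if od: "odd d"
  proof
    assume H: "s^2 = q^(d-1)"
    obtain h where h: "d = 2 * h + 1" using od by (rule oddE)
    define v where "v = q^h"
    have v: "v \<noteq> 0" using q by (simp add: v_def)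
    have Qv: "Q = v * v * q" by (simp add: Q_def v_def h flip: power_add mult_2)
    have "q^(d-1) = v * v" by (simp add: v_def h flip: power_add mult_2)
    then have av: "a = b * v * v" using H s ab by (simp add: field_simps)
    \<comment> \<open>Since x_i y_i = a b is constant, 1/x_i = y_i / (a b), and the dual equation
      turns into the original one with x and y exchanged.\<close>
    have rhos': "\<rho>s = a * b * \<rho>"
    proof -
      have x2: "x 2 = a / q" "y 2 = b * q" using xj[of 1] d3 by (simp_all add: numeral_2_eq_2)
      have e1: "a * b * z 1 * (2 * inverse a - \<beta> * inverse b) + (a / q) * (b * q) * z 2 * (inverse a + inverse (b * q) - \<beta> * inverse (a / q)) = \<rho>s * inverse a + \<omega>"
        using eqxs x2 z0 d3 unfolding aw_eqs_def by (auto simp: a_def b_def numeral_2_eq_2)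
      have e2: "z 1 * (2 * b - \<beta> * a) + z 2 * (b + a / q - \<beta> * (b * q)) = \<rho> * b + \<omega>"
        using eqy'[of 1] x2 z0 d3 by (simp add: a_def b_def numeral_2_eq_2)
      have "a * b * z 1 * (2 * inverse a - \<beta> * inverse b) + (a / q) * (b * q) * z 2 * (inverse a + inverse (b * q) - \<beta> * inverse (a / q))
        = z 1 * (2 * b - \<beta> * a) + z 2 * (b + a / q - \<beta> * (b * q))"
        using ab q(1) by (simp add: field_simps)
      then have "\<rho>s * inverse a = \<rho> * b" unfolding e1 e2 by simp
      then show ?thesis using ab by (simp add: field_simps)
    qed
    have corner: "c = 2 * k^2 * (1 - Q) * b * v * v * (1 - q)"
    proof -
      have x2: "x 2 = a / q" using xj[of 1] d3 by (simp add: numeral_2_eq_2)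
      have "z 1 * ((1 + q) / q * e 1) / (1 + q) = z 1 * (e 1 / q)" using q1 by simp
      then have "z 1 * (e 1 / q) = W 1 / (1 + q)" unfolding z1 by (rule sym)
      moreover have e1: "b - a / q = - (e 1 / q)" unfolding e_def using q(1) by (simp add: field_simps)
      ultimately have "(b - a / q) * z 1 = - (W 1 / (1 + q))"
        by (metis mult.commute mult_minus_left)
      also have "W 1 = (1 + q) * (k^2 * (1 - Q) * (b * v * v) * ((q - 1)^2 / q))"
        unfolding W1 av Qv using q(1) by (simp add: field_simps power2_eq_square)
      also have "- ((1 + q) * (k^2 * (1 - Q) * (b * v * v) * ((q - 1)^2 / q)) / (1 + q)) = - (k^2 * (1 - Q) * (b * v * v) * ((q - 1)^2 / q))"
        using q1 by simp
      finally have "c = - (k^2 * (1 - Q) * (b * v * v) * ((q - 1)^2 / q)) + a / q * (k * (1 - Q))^2 - (k * (1 - Q)) * (k * (q - Q / q)) * a"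
        using corner1 x2 f(3,4) by (simp add: a_def b_def Q_def)
      also have "\<dots> = k^2 * (1 - Q) * (b * v * v) * (- ((q - 1)^2 / q) + (1 - Q) / q - (q - Q / q))"
        unfolding av using q(1) by (simp add: field_simps power2_eq_square)
      also have "- ((q - 1)^2 / q) + (1 - Q) / q - (q - Q / q) = 2 * (1 - q)"
        using q by (simp add: field_simps power2_eq_square)
      finally show ?thesis by (simp add: mult_ac)
    qed
    have "d - Suc h = h" "d - h = Suc h" using h by auto
    then have tt: "th (Suc h) = k * (q * v - v)" "th h = k * (v - q * v)"
      using th[of "Suc h"] th[of h] h by (simp_all add: v_def)
    have "th (Suc h) - th h = 2 * k * v * (q - 1)" unfolding tt by (simp add: algebra_simps)
    moreover have "\<rho>s * (2 * k * v * (q - 1))^2 * (k * (1 - Q))^2 = (2 * k^2 * (1 - Q) * b * v * v * (1 - q))^2 * \<rho>"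
      unfolding rhos' av by (simp add: algebra_simps power2_eq_square)
    ultimately show False
      using nondeg[OF f(9), of "Suc h"] h d3 corner f(3) by (simp add: Q_def)
  qed
  \<comment> \<open>Exponents below d - 2 and above d are excluded by the interior z_i, the exponent
    d - 2 by z_d and d by z_1; for d - 1 with d even it is e_(d/2).\<close>
  have s_neq: "s^2 \<noteq> q^m" if m: "m \<le> 2 * d - 2" for m
  proof -
    consider "Suc (Suc m) < d" | "m = d - 2" | "m = d - 1" | "m = d" | j where "m = d + Suc j" "Suc (Suc j) < d"
    proof -
      have "Suc (Suc m) < d \<or> m = d - 2 \<or> m = d - 1 \<or> m = d \<or> (\<exists>j. m = d + Suc j \<and> Suc (Suc j) < d)"
      proof (cases "m \<le> d")
        case False
        then obtain j where j: "m = Suc (d + j)" using less_imp_Suc_add[of d m] by auto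
        then show ?thesis using m by auto
      qed (use d3 in arith)
      then show ?thesis using that by blast
    qed
    then show ?thesis
    proof cases
      case 1 then show ?thesis using sneq mid(1) by blast
    next
      case 2
      have "z d \<noteq> 0" using nonzero[of d] d3 by auto
      moreover have "a - b * Q * Q / (q * q * q) \<noteq> 0"
      proof -
        obtain n where n: "d = Suc n" using d3 by (cases d) auto
        have qn: "q^n = Q / q" using q by (simp add: Q_def n)
        show ?thesis using e_nz[of n] d3 n unfolding e_def qn by (simp add: mult_ac)
      qed
      ultimately have "a - b * Q / (q * q) \<noteq> 0" using zd' q q1 Q0 by auto
      moreover have "q^(d-2) = Q / (q * q)" using d3 q by (simp add: Q_def power_diff power2_eq_square)
      ultimately show ?thesis using 2 sneq[of "q^m"] by simp
    next
      case 3
      show ?thesis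
      proof (cases "odd d")
        case True then show ?thesis using middle_odd 3 by simp
      next
        case False
        then obtain h where h: "d = 2 * h" by (auto elim: evenE)
        obtain n where n: "h = Suc n" using h d3 by (cases h) auto
        have "e h \<noteq> 0" using e_nz[of h] h d3 by simp
        moreover have "q^(d-1) = q^h * q^h / q" using q unfolding h n by (simp add: mult_2 power_add)
        ultimately show ?thesis using sneq[of "q^m"] 3 by (simp add: e_def mult.assoc)
      qed
    next
      case 4
      have "z 1 \<noteq> 0" "e 1 \<noteq> 0" using nonzero[of 1] e_nz[of 1] d3 by auto
      then have "W 1 \<noteq> 0" using z1 q q1 by auto
      then have "a - b * Q \<noteq> 0" unfolding W1 by (auto simp: mult.commute)
      then show ?thesis using sneq[of "q^m"] 4 by (simp add: Q_def)
    next
      case 5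
      have "q^m = Q * (q * q^j)" unfolding 5 by (simp add: power_add Q_def)
      then show ?thesis using sneq[of "q^m"] mid(2)[OF 5(2)] by (simp add: mult.assoc)
    qed
  qed
  have qc: "q_cond d q s" unfolding q_cond_def
  proof (intro conjI allI impI)
    fix i assume "i < d" then show "s^2 \<noteq> q^(2 * i)" by (intro s_neq) auto
  qed (use q s0 f(1,2) in auto)
  have "fits (1 / k) (s / (k * a)) (\<lambda>i. s * q powi (1 - int i)) (\<lambda>i. inverse s * q^(i-1))
       (\<lambda>i. if i = 1 then (q - 1) * (q^d - 1) * (s^2 - q^d) / (s^2 - q)
            else if i = d then q^(d-1) * (q - 1) * (q^d - 1) * (s^2 - q^(d-2)) / (s^2 - q^(2*d-3))
            else q^(i-1) * (q^i - 1) * (q^(d-i+1) - 1) * (s^2 - q^(i-2)) * (s^2 - q^(d+i-1))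
                 / ((s^2 - q^(2*i-3)) * (s^2 - q^(2*i-1))))"
    (is "fits _ _ ?X ?Y ?Z")
    unfolding fits_def
  proof (intro conjI allI impI)
    show "1 / k \<noteq> 0" "s / (k * a) \<noteq> 0" using q s0 ab by auto
    fix i assume "1 \<le> i \<and> i \<le> d"
    then have i: "1 \<le> i" "i \<le> d" by auto
    then obtain j where j: "i = Suc j" by (cases i) auto
    have p: "q powi (1 - int i) = 1 / q^j" unfolding j by (simp add: power_int_minus field_simps)
    have xi: "x i = a / q^j" "y i = b * q^j" using xj[of j] i j by simp_all
    have j': "i - 1 = j" using j by simp
    show "s / (k * a) * x i = 1 / k * (s * q powi (1 - int i))"
      unfolding p xi using ab q by simp
    have bs: "a = b * s^2" using s ab by simp
    have "s / (k * a) * (b * q^j) = 1 / k * (inverse s * q^j)"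
      unfolding bs using ab q s0 by (simp add: field_simps power2_eq_square)
    then show "s / (k * a) * y i = 1 / k * (inverse s * q^(i-1))" unfolding xi j' .
    have "z i = k^2 * (if i = 1 then (q - 1) * (Q - 1) * (s^2 - Q) / (s^2 - q)
            else if i = d then q^(d-1) * (q - 1) * (Q - 1) * (s^2 - q^(d-2)) / (s^2 - q^(2*d-3))
            else q^(i-1) * (q^i - 1) * (q^(d-i+1) - 1) * (s^2 - q^(i-2)) * (s^2 - q^(d+i-1))
                 / ((s^2 - q^(2*i-3)) * (s^2 - q^(2*i-1))))"
    proof -
      consider "i = 1" | "i = d" "i \<noteq> 1" | m where "i = Suc (Suc m)" "Suc (Suc m) < d"
      proof -
        have "i = 1 \<or> (i = d \<and> i \<noteq> 1) \<or> (\<exists>m. i = Suc (Suc m) \<and> Suc (Suc m) < d)"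
          using i by (cases i rule: nat.exhaust; cases j rule: nat.exhaust) (auto simp: j)
        then show ?thesis using that by blast
      qed
      then show ?thesis
      proof cases
        case 1
        have n: "a - b * q \<noteq> 0" using e_nz[of 1] d3 q by (simp add: e_def)
        have e1: "e 1 = a - b * q" using q by (simp add: e_def)
        have "(1 + q) / q * e 1 \<noteq> 0" using n q q1 unfolding e1 by simp
        then have "z 1 = W 1 / ((1 + q) / q * e 1)"
          unfolding z1[symmetric] by (rule nonzero_mult_div_cancel_right[symmetric])
        also have "\<dots> = k^2 * ((q - 1) * (Q - 1) * (s^2 - Q) / (s^2 - q))"
        proof -
          have A: "W 1 = (1 + q) / q * (k^2 * ((q - 1) * (Q - 1) * (a - b * Q)))"
            unfolding W1 using q(1) by (simp add: field_simps power2_eq_square)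
          have nz: "(1 + q) / q \<noteq> 0" using q(1) q1 by simp
          have "W 1 / ((1 + q) / q * e 1) = k^2 * ((q - 1) * (Q - 1) * (a - b * Q)) / (a - b * q)"
            unfolding e1 A by (rule mult_divide_mult_cancel_left[OF nz])
          then show ?thesis unfolding sm unfolding c1 unfolding times_divide_eq_right .
        qed
        finally have z1': "z 1 = k^2 * ((q - 1) * (Q - 1) * (s^2 - Q) / (s^2 - q))" .
        show ?thesis unfolding 1 z1' by (simp only: if_True refl)
      next
        case 2
        define n where "n = d - 2"
        have n: "d = Suc (Suc n)" using d3 by (simp add: n_def)
        define w where "w = q^n"
        have w: "w \<noteq> 0" "Q = w * q * q" using q by (simp_all add: w_def Q_def n mult_ac)
        have pw: "q^(d-1) = w * q" "q^(d-2) = w" "q^(2*d-3) = w * w * q"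
          unfolding n by (simp_all add: w_def mult_2 mult_2_right power_add mult_ac)
        have nz: "a - b * (w * w * q) \<noteq> 0"
          using e_nz[of "Suc n"] n d3 q by (simp add: e_def w_def mult_ac)
        have z': "z d * ((1 + q) / (w * q) * (a - b * (w * w * q))) = - (k^2 * (q - 1/q) * q * (1 - Q) * (a - b * w))"
          using zd' q w(1) unfolding w(2) by (simp add: mult_ac)
        have "(1 + q) / (w * q) * (a - b * (w * w * q)) \<noteq> 0" using nz q q1 w by simp
        then have "z d = - (k^2 * (q - 1/q) * q * (1 - Q) * (a - b * w)) / ((1 + q) / (w * q) * (a - b * (w * w * q)))"
          unfolding z'[symmetric] by (rule nonzero_mult_div_cancel_right[symmetric])
        also have "\<dots> = k^2 * (w * q * (q - 1) * (Q - 1) * (s^2 - w) / (s^2 - w * w * q))"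
        proof -
          have A: "- (k^2 * (q - 1/q) * q * (1 - Q) * (a - b * w)) = (1 + q) / (w * q) * (k^2 * (w * q * (q - 1) * (Q - 1) * (a - b * w)))"
            using q(1) w(1) by (simp add: field_simps power2_eq_square)
          have nz: "(1 + q) / (w * q) \<noteq> 0" using q(1) q1 w(1) by simp
          have "- (k^2 * (q - 1/q) * q * (1 - Q) * (a - b * w)) / ((1 + q) / (w * q) * (a - b * (w * w * q)))
            = k^2 * (w * q * (q - 1) * (Q - 1) * (a - b * w)) / (a - b * (w * w * q))"
            unfolding A by (rule mult_divide_mult_cancel_left[OF nz])
          then show ?thesis unfolding sm unfolding c1 unfolding times_divide_eq_right .
        qed
        finally have zd'': "z d = k^2 * (w * q * (q - 1) * (Q - 1) * (s^2 - w) / (s^2 - w * w * q))" .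
        have "d \<noteq> 1" using 2 by simp
        then show ?thesis unfolding 2(1) pw zd'' by (simp only: if_True if_False refl)
      next
        case 3
        define w where "w = q^m"
        have w: "w \<noteq> 0" using q by (simp add: w_def)
        have pw: "q^(i-1) = w * q" "q^i = w * q * q" "q^(i-2) = w" "q^(2*i-3) = w * w * q" "q^(2*i-1) = w * w * q * q * q"
          "q^(d+i-1) = Q * w * q"
          unfolding 3 by (simp_all add: w_def Q_def mult_2 mult_2_right power_add mult_ac)
        have "d - i + 1 = d - Suc m" using 3 by auto
        then have pw': "q^(d-i+1) = Q / (w * q)"
          using 3 q by (simp add: w_def Q_def power_diff mult_ac)
        have nz: "a - b * (w * w * q) \<noteq> 0" "a - b * (w * w * q * q * q) \<noteq> 0"
          using e_nz[of "Suc m"] e_nz[of "Suc (Suc m)"] 3 q by (simp_all add: e_def w_def mult_ac)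
        have ee: "e (Suc m) = a - b * (w * w * q)" "e (Suc (Suc m)) = a - b * (w * w * q * q * q)"
          using q by (simp_all add: e_def w_def mult_ac)
        have P': "z i * (((1 + q) / (w * q * q) * e (Suc (Suc m))) * ((1 + q) / (w * q) * e (Suc m))) = F (w * q)"
          using P[of "Suc m"] 3 by (simp add: w_def mult_ac)
        have "((1 + q) / (w * q * q) * e (Suc (Suc m))) * ((1 + q) / (w * q) * e (Suc m)) \<noteq> 0"
          using nz q q1 w unfolding ee by simp
        then have "z i = F (w * q) / (((1 + q) / (w * q * q) * e (Suc (Suc m))) * ((1 + q) / (w * q) * e (Suc m)))"
          unfolding P'[symmetric] by (rule nonzero_mult_div_cancel_right[symmetric])
        also have "\<dots> = k^2 * (w * q * (w * q * q - 1) * (Q / (w * q) - 1) * (s^2 - w) * (s^2 - Q * w * q)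
                 / ((s^2 - w * w * q) * (s^2 - w * w * q * q * q)))"
        proof -
          define C where "C = (1 + q)^2 / (w * w * q * q * q)"
          have C: "C \<noteq> 0" using q(1) q1 w by (simp add: C_def)
          have A: "F (w * q) = C * (k^2 * (w * q * (w * q * q - 1) * (Q / (w * q) - 1) * (a - b * w) * (a - b * (Q * w * q))))"
            unfolding F_def C_def using q(1) w by (simp add: field_simps)
          have A': "((1 + q) / (w * q * q) * e (Suc (Suc m))) * ((1 + q) / (w * q) * e (Suc m))
            = C * ((a - b * (w * w * q)) * (a - b * (w * w * q * q * q)))"
            unfolding ee C_def by (simp add: power2_eq_square mult_ac)
          have "F (w * q) / (((1 + q) / (w * q * q) * e (Suc (Suc m))) * ((1 + q) / (w * q) * e (Suc m)))
            = k^2 * (w * q * (w * q * q - 1) * (Q / (w * q) - 1) * (a - b * w) * (a - b * (Q * w * q)))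
              / ((a - b * (w * w * q)) * (a - b * (w * w * q * q * q)))"
            unfolding A A' by (rule mult_divide_mult_cancel_left[OF C])
          then show ?thesis unfolding sm unfolding c2 unfolding times_divide_eq_right .
        qed
        finally have zi: "z i = k^2 * (w * q * (w * q * q - 1) * (Q / (w * q) - 1) * (s^2 - w) * (s^2 - Q * w * q)
                 / ((s^2 - w * w * q) * (s^2 - w * w * q * q * q)))" .
        have "i \<noteq> 1" "i \<noteq> d" using 3 by auto
        then show ?thesis unfolding pw pw' zi by (simp only: if_False refl)
      qed
    qed
    then show "(1 / k)\<^sup>2 * z i = (if i = 1 then (q - 1) * (q^d - 1) * (s^2 - q^d) / (s^2 - q)
            else if i = d then q^(d-1) * (q - 1) * (q^d - 1) * (s^2 - q^(d-2)) / (s^2 - q^(2*d-3))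
            else q^(i-1) * (q^i - 1) * (q^(d-i+1) - 1) * (s^2 - q^(i-2)) * (s^2 - q^(d+i-1))
                 / ((s^2 - q^(2*i-3)) * (s^2 - q^(2*i-1))))"
      unfolding Q_def using q by (simp add: power_divide)
  qed
  moreover have "family_LT d (Tpair d ?X ?Y ?Z)"
    unfolding family_LT_def by (rule exI[of _ q], rule exI[of _ s]) (use qc s_neq in blast)
  ultimately show ?thesis by blast
qed


section \<open>Family E: equal x and y\<close>

text \<open>With x = y the difference equation is empty, and a single entry equation remains: a
  second-order recurrence for z whose homogeneous part has the characteristic roots q^2 and -q. The
  boundary values z_0 = z_(d+1) = 0 leave one free parameter, which becomes s.\<close>

lemma family_E_fits:
  assumes root: "\<And>a :: 'a. \<exists>s. s^2 = a" and qf: "qform q k"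
    and x: "\<And>i. 1 \<le> i \<Longrightarrow> i \<le> d \<Longrightarrow> x i = x 1 / q^(i-1)"
    and y: "\<And>i. 1 \<le> i \<Longrightarrow> i \<le> d \<Longrightarrow> y i = y 1 / q^(i-1)" and xy: "x 1 = y 1"
  shows "\<exists>\<xi> \<xi>s X Y Z. fits \<xi> \<xi>s X Y Z \<and> family_E d (Tpair d X Y Z)"
proof -
  have q: "q \<noteq> 0" "q^2 \<noteq> 1" "\<beta> = q + 1/q" "k \<noteq> 0" using qf by (auto simp: qform_def)
  note f = qform_facts[OF qf]
  define Q where "Q = q^d"
  have Q0: "Q \<noteq> 0" using q by (simp add: Q_def)
  have q1: "1 + q \<noteq> 0" "q - 1 \<noteq> 0" using f(6,7) by (auto simp: add_eq_0_iff)
  have xeq: "x i = y i" if i: "1 \<le> i" "i \<le> d" for i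
    unfolding x[OF i] y[OF i] xy ..
  have ev: "even d" using odd_neq xeq by blast
  define a where "a = x 1"
  have a0: "a \<noteq> 0" using nonzero[of 1] d3 by (auto simp: a_def)
  have xj: "x (Suc j) = a / q^j" "y (Suc j) = a / q^j" if "Suc j \<le> d" for j
    using x[of "Suc j"] xeq[of "Suc j"] that by (simp_all add: a_def)
  define w where "w = \<omega> / (a * q)"
  have om: "\<omega> = w * (a * q)" using a0 q by (simp add: w_def)
  have step: "z (Suc i) = q * (q - 1) * z i + q^3 * z (i-1) + q^2 * (\<rho> + w * q^i) / (q - 1)"
    if i: "1 \<le> i" "i \<le> d" for i
  proof -
    obtain j where j: "i = Suc j" using i by (cases i) auto
    define e where "e = a / q^j"
    have e0: "e \<noteq> 0" using a0 q by (simp add: e_def)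
    have xi: "x i = e" "y i = e" using xj[of j] i j by (simp_all add: e_def)
    have lower: "z (i-1) * (x i + y (i-1) - \<beta> * x (i-1)) = e * (z (i-1) * (q - q^2))"
    proof (cases j)
      case 0 then show ?thesis using j z0 by simp
    next
      case (Suc m)
      have "x (i-1) = e * q" "y (i-1) = e * q" using xj[of m] i j Suc q by (simp_all add: e_def)
      then show ?thesis unfolding xi q(3) using q(1) by (simp add: field_simps power2_eq_square)
    qed
    have upper: "z (Suc i) * (x i + y (Suc i) - \<beta> * x (Suc i)) = e * (z (Suc i) * ((q - 1) / q^2))"
    proof (cases "i = d")
      case True then show ?thesis using zd by simp
    next
      case False
      then have "x (Suc i) = e / q" "y (Suc i) = e / q" using xj[of i] i j q by (simp_all add: e_def)
      then show ?thesis unfolding xi q(3) using q(1) by (simp add: field_simps power2_eq_square)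
    qed
    have "e * (z (i-1) * (q - q^2)) + z i * (2 * e - \<beta> * e) + e * (z (Suc i) * ((q - 1) / q^2)) = \<rho> * e + \<omega>"
      by (rule eqx'[OF i, unfolded lower upper, unfolded xi])
    also have "\<omega> = e * (w * q^i)" unfolding om e_def j using q by simp
    finally have "e * (z (i-1) * (q - q^2) + z i * (2 - \<beta>) + z (Suc i) * ((q - 1) / q^2)) = e * (\<rho> + w * q^i)"
      by (simp add: algebra_simps)
    then have E: "z (i-1) * (q - q^2) + z i * (2 - \<beta>) + z (Suc i) * ((q - 1) / q^2) = \<rho> + w * q^i"
      using e0 by simp
    have "q * (q - 1) * z i + q^3 * z (i-1) + q^2 * (\<rho> + w * q^i) / (q - 1) = z (Suc i)"
    proof -
      have "(q - 1) * (q * (q - 1) * z i + q^3 * z (i-1)) + q^2 * (\<rho> + w * q^i) = (q - 1) * z (Suc i)"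
        unfolding E[symmetric] q(3) using q(1) by (simp add: field_simps power2_eq_square power3_eq_cube)
      then have "((q - 1) * (q * (q - 1) * z i + q^3 * z (i-1)) + q^2 * (\<rho> + w * q^i)) / (q - 1) = z (Suc i)"
        using q1 by simp
      then show ?thesis using q1 by (simp add: add_divide_distrib)
    qed
    then show ?thesis by (rule sym)
  qed
  \<comment> \<open>The constant \<gamma> and the multiple \<alpha> of q^i are particular solutions
    for the sources \<rho> and \<omega>; B and \<delta> are the coefficients of q^(2i) and (-q)^i,
    fitted to z_1 and z_0 = 0.\<close>
  define \<gamma> where "\<gamma> = - (k^2 * Q)"
  have rho: "\<rho> = - \<gamma> * ((q - 1) * (q + 1) / q)^2"
    unfolding f(5) \<gamma>_def Q_def using q(1) by (simp add: field_simps power2_eq_square)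
  define \<alpha> where "\<alpha> = - (q * w) / (2 * (q - 1)^2)"
  have w: "w = - (2 * \<alpha> * (q - 1)^2 / q)" using q1 q(1) two by (simp add: \<alpha>_def)
  define B where "B = (z 1 - 2 * q * \<alpha> - \<gamma> * (1 + q)) / (q * (1 + q))"
  define \<delta> where "\<delta> = - (\<alpha> + B + \<gamma>)"
  have z1B: "z 1 = q * \<alpha> + B * q^2 + \<gamma> - \<delta> * q"
  proof -
    have "B * (q * (1 + q)) = z 1 - 2 * q * \<alpha> - \<gamma> * (1 + q)" using q(1) q1 by (simp add: B_def)
    then show ?thesis unfolding \<delta>_def by (simp add: algebra_simps power2_eq_square)
  qed
  have src: "q^2 * (\<rho> + w * t) / (q - 1) = - \<gamma> * (q - 1) * (q + 1)^2 - 2 * \<alpha> * (q - 1) * q * t" for t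
  proof -
    have "q^2 * (\<rho> + w * t) = (q - 1) * (- \<gamma> * (q - 1) * (q + 1)^2 - 2 * \<alpha> * (q - 1) * q * t)"
      unfolding rho w using q(1) by (simp add: field_simps power2_eq_square)
    then show ?thesis using q1 by simp
  qed
  have z: "i \<le> Suc d \<Longrightarrow> z i = \<alpha> * q^i + B * (q^i)^2 + \<gamma> + \<delta> * (- q)^i" for i
  proof (induction i rule: less_induct)
    case (less i)
    consider "i = 0" | "i = 1" | j where "i = Suc (Suc j)" by (metis One_nat_def not0_implies_Suc)
    then show ?case
    proof cases
      case 1 then show ?thesis using z0 by (simp add: \<delta>_def)
    next
      case 2 then show ?thesis unfolding 2 z1B by simp
    next
      case 3
      define u where "u = q^j"
      define v where "v = (-q)^j"
      have zj: "z j = \<alpha> * u + B * u^2 + \<gamma> + \<delta> * v"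
        "z (Suc j) = \<alpha> * (q * u) + B * (q * u)^2 + \<gamma> + \<delta> * (- q * v)"
        using less.IH[of j] less.IH[of "Suc j"] less.prems 3 by (simp_all add: u_def v_def)
      have zi: "z i = q * (q - 1) * z (Suc j) + q^3 * z j + (- \<gamma> * (q - 1) * (q + 1)^2 - 2 * \<alpha> * (q - 1) * q * (q * u))"
        using step[of "Suc j"] less.prems 3 unfolding src by (simp add: u_def)
      show ?thesis unfolding zi zj unfolding 3 power_Suc u_def[symmetric] v_def[symmetric]
        by (simp add: algebra_simps power2_eq_square power3_eq_cube)
    qed
  qed
  \<comment> \<open>R = q^(d+1). As d + 1 is odd, z_(d+1) = 0 determines \<alpha> - \<delta>, the
    coefficient of q^i at odd i, just as z_0 = 0 determines \<alpha> + \<delta>, the one at even i.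
    So z factors in either parity, with the known root R or 1.\<close>
  define R where "R = Q * q"
  have R0: "R \<noteq> 0" using Q0 q by (simp add: R_def)
  have "\<alpha> * R + B * R^2 + \<gamma> - \<delta> * R = 0"
    using z[of "Suc d"] zd ev by (simp add: R_def Q_def mult_ac power_mult_distrib)
  then have "(\<alpha> - \<delta>) * R = - (B * R^2 + \<gamma>)" by (simp add: algebra_simps eq_neg_iff_add_eq_0)
  also have "\<dots> = - (B * R + \<gamma> / R) * R" using R0 by (simp add: algebra_simps power2_eq_square)
  finally have AD: "\<alpha> - \<delta> = - (B * R + \<gamma> / R)" using R0 by (simp only: mult_cancel_right simp_thms)
  have ze: "z i = (q^i - 1) * (B * q^i - \<gamma>)" if "i \<le> d" "even i" for i
  proof -
    have "z i = (\<alpha> + \<delta>) * q^i + B * (q^i)^2 + \<gamma>" using z[of i] that by (simp add: algebra_simps)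
    also have "\<alpha> + \<delta> = - (B + \<gamma>)" by (simp add: \<delta>_def)
    finally show ?thesis by (simp add: algebra_simps power2_eq_square)
  qed
  have zo: "z i = (q^i - R) * (B * q^i - \<gamma> / R)" if "i \<le> d" "odd i" for i
  proof -
    have "z i = (\<alpha> - \<delta>) * q^i + B * (q^i)^2 + \<gamma>" using z[of i] that by (simp add: algebra_simps)
    then show ?thesis unfolding AD using R0 by (simp add: algebra_simps power2_eq_square)
  qed
  \<comment> \<open>For B = 0 the left side of the dual equation at i = 1 reduces to \<omega>, which
    leaves \<rho>s = 0.\<close>
  have B0: "B \<noteq> 0"
  proof
    assume B: "B = 0"
    have x2: "x 2 = a / q" "y 2 = a / q" "y 1 = a" using xj[of 1] xj[of 0] d3 by (simp_all add: numeral_2_eq_2)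
    have "a * a * z 1 * (2 * inverse a - \<beta> * inverse a) + (a / q) * (a / q) * z 2 * (inverse a + inverse (a / q) - \<beta> * inverse (a / q)) = \<rho>s * inverse a + \<omega>"
      using eqxs x2 z0 d3 unfolding aw_eqs_def by (auto simp: a_def numeral_2_eq_2)
    moreover have "a * a * z 1 * (2 * inverse a - \<beta> * inverse a) + (a / q) * (a / q) * z 2 * (inverse a + inverse (a / q) - \<beta> * inverse (a / q)) = a * (z 1 * (2 - q - 1/q) - z 2 * (q - 1) / q)"
      unfolding q(3) using a0 q(1) by (simp add: field_simps)
    moreover have "z 1 * (2 - q - 1/q) - z 2 * (q - 1) / q = w * q"
    proof -
      have zz: "z 1 = \<alpha> * q + \<gamma> - \<delta> * q" "z 2 = \<alpha> * (q * q) + \<gamma> + \<delta> * (q * q)"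
        using z[of 1] z[of 2] B d3 by (simp_all add: power2_eq_square)
      have d: "\<delta> = - (\<alpha> + \<gamma>)" using B by (simp add: \<delta>_def)
      show ?thesis unfolding zz d w using q(1) by (simp add: field_simps power2_eq_square)
    qed
    ultimately have "\<rho>s * inverse a = 0" by (simp add: om mult_ac)
    then show False using rhos_nonzero[OF q(1,2,3)] a0 by simp
  qed
  \<comment> \<open>Chosen so that the factor B q^i - \<gamma> becomes k^2 Q (1 - q^(i-2) /
    s^2).\<close>
  obtain s where s: "s^2 = - (k^2 * Q / (q^2 * B))" using root by blast
  have s2: "s^2 \<noteq> 0" using s q Q0 B0 by simp
  have s0: "s \<noteq> 0" using s2 by auto
  have Bs: "B = - (k^2 * Q / (q^2 * s^2))" using s s2 q B0 by (simp add: field_simps)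
  have ze': "z (Suc (Suc m)) = k^2 * (Q * (q^Suc (Suc m) - 1) * (1 - inverse (s^2) * q^m))"
    if "Suc (Suc m) \<le> d" "even m" for m
  proof -
    have "B * q^Suc (Suc m) - \<gamma> = k^2 * Q * (1 - inverse (s^2) * q^m)"
      unfolding Bs \<gamma>_def using q(1) s2 by (simp add: field_simps power2_eq_square)
    then show ?thesis using ze[of "Suc (Suc m)"] that by (simp add: mult_ac)
  qed
  have zo': "z (Suc m) = k^2 * (- ((Q - q^m) * (1 - inverse (s^2) * (Q * q^m))))"
    if "Suc m \<le> d" "even m" for m
  proof -
    have "B * q^Suc m - \<gamma> / R = k^2 / q * (1 - inverse (s^2) * (Q * q^m))"
      unfolding Bs \<gamma>_def R_def using q(1) s2 Q0 by (simp add: field_simps power2_eq_square)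
    moreover have "q^Suc m - R = - (q * (Q - q^m))" by (simp add: R_def algebra_simps)
    moreover have "z (Suc m) = (q^Suc m - R) * (B * q^Suc m - \<gamma> / R)" using zo[of "Suc m"] that by simp
    ultimately have "z (Suc m) = - (q * (Q - q^m)) * (k^2 / q * (1 - inverse (s^2) * (Q * q^m)))" by simp
    then show ?thesis using q(1) by simp
  qed
  \<comment> \<open>If s^2 were q^(2i), then z_(2i+2) would vanish when 2i < d, and z_(2i-d+1)
    otherwise.\<close>
  have s_neq: "s^2 \<noteq> q^(2*i)" if i: "i < d" for i
  proof
    assume H: "s^2 = q^(2*i)"
    show False
    proof (cases "2 * i < d")
      case True
      then have "Suc (Suc (2 * i)) \<le> d" using ev by (auto elim!: evenE)
      then have "z (Suc (Suc (2 * i))) = 0" using ze'[of "2 * i"] q H by simp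
      then show False using nonzero[of "Suc (Suc (2 * i))"] \<open>Suc (Suc (2 * i)) \<le> d\<close> by simp
    next
      case False
      define m where "m = 2 * i - d"
      have m: "2 * i = d + m" "even m" "Suc m \<le> d" using False ev i by (auto simp: m_def)
      have "q^(2*i) = Q * q^m" unfolding m(1) by (simp add: Q_def power_add)
      then have sq: "s^2 = Q * q^m" using H by simp
      have "inverse (s^2) * (Q * q^m) = 1" unfolding sq[symmetric] using s2 by simp
      then have "z (Suc m) = 0" using zo'[OF m(3,2)] by simp
      then show False using nonzero[of "Suc m"] m(3) by simp
    qed
  qed
  have qc: "q_cond d q s" unfolding q_cond_def
  proof (intro conjI allI impI)
    fix i assume "i < d" then show "s^2 \<noteq> q^(2 * i)" by (rule s_neq)
  qed (use q s0 f(1,2) in auto)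
  have "fits (1 / k) (s / (k * a)) (\<lambda>i. s * q powi (1 - int i)) (\<lambda>i. s * q powi (1 - int i))
       (\<lambda>i. if even i then q^d * (q^i - 1) * (1 - inverse (s^2) * q^(i-2))
            else - (q^(i-1) * (q^(d-i+1) - 1) * (1 - inverse (s^2) * q^(d+i-1))))"
    (is "fits _ _ ?X ?Y ?Z")
    unfolding fits_def
  proof (intro conjI allI impI)
    show "1 / k \<noteq> 0" "s / (k * a) \<noteq> 0" using q s0 a0 by auto
    fix i assume "1 \<le> i \<and> i \<le> d"
    then have i: "1 \<le> i" "i \<le> d" by auto
    then obtain j where j: "i = Suc j" by (cases i) auto
    have p: "q powi (1 - int i) = 1 / q^j" unfolding j by (simp add: power_int_minus field_simps)
    have xi: "x i = a / q^j" "y i = a / q^j" using xj[of j] i j by simp_all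
    show "s / (k * a) * x i = 1 / k * (s * q powi (1 - int i))" "s / (k * a) * y i = 1 / k * (s * q powi (1 - int i))"
      unfolding p xi using a0 q by simp_all
    have k2: "(1 / k)^2 * (k^2 * t) = t" for t using q by (simp add: power_divide)
    show "(1 / k)\<^sup>2 * z i = (if even i then q^d * (q^i - 1) * (1 - inverse (s^2) * q^(i-2))
            else - (q^(i-1) * (q^(d-i+1) - 1) * (1 - inverse (s^2) * q^(d+i-1))))"
    proof (cases "even i")
      case True
      then obtain m where m: "i = Suc (Suc m)" "even m" using j by (cases j) auto
      have "i - 2 = m" using m by simp
      then have zi: "z i = k^2 * (q^d * (q^i - 1) * (1 - inverse (s^2) * q^(i-2)))"
        using ze'[of m] i m unfolding Q_def by simp
      show ?thesis unfolding zi k2 using True by simp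
    next
      case False
      then have jj: "even j" using j by simp
      have e1: "q^(i-1) * (q^(d-i+1) - 1) = Q - q^j"
      proof -
        have "q^(i-1) * q^(d-i+1) = q^(i - 1 + (d - i + 1))" by (rule power_add[symmetric])
        also have "i - 1 + (d - i + 1) = d" using i by simp
        finally show ?thesis using j by (simp add: Q_def right_diff_distrib)
      qed
      have e2: "q^(d+i-1) = Q * q^j" using j by (simp add: Q_def power_add)
      have zi: "z i = k^2 * (- ((Q - q^j) * (1 - inverse (s^2) * (Q * q^j))))" using zo'[of j] i j jj by simp
      show ?thesis unfolding zi k2 e1 e2 using False by simp
    qed
  qed
  moreover have "family_E d (Tpair d ?X ?Y ?Z)"
    unfolding family_E_def by (rule exI[of _ q], rule exI[of _ s]) (use qc ev in blast)
  ultimately show ?thesis by blast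
qed


text \<open>Here beta = 0 never occurs, so x and y are geometric with ratios q or 1/q, where
  q + 1/q = beta; taking 1/q for the ratio of x fixes the choice of q.\<close>

lemma generic_fits:
  assumes root: "\<And>a :: 'a. \<exists>s. s^2 = a" and \<beta>: "\<beta> \<noteq> 2" "\<beta> \<noteq> -2"
  shows "\<exists>\<xi> \<xi>s X Y Z. fits \<xi> \<xi>s X Y Z \<and>
    (family_C d (Tpair d X Y Z) \<or> family_LT d (Tpair d X Y Z) \<or> family_E d (Tpair d X Y Z))"
proof -
  obtain r where r: "r^2 - \<beta> * r + 1 = 0" "\<And>i. 1 \<le> i \<Longrightarrow> i \<le> d \<Longrightarrow> x i = x 1 * r ^ (i-1)"
    using x_ratio by blast
  obtain t where t: "t^2 - \<beta> * t + 1 = 0" "\<And>i. 1 \<le> i \<Longrightarrow> i \<le> d \<Longrightarrow> y i = y 1 * t ^ (i-1)"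
    using y_ratio by blast
  have r0: "r \<noteq> 0" using r(1) by auto
  define q where "q = 1 / r"
  have q0: "q \<noteq> 0" and rq: "r = 1 / q" using r0 by (simp_all add: q_def)
  have "\<beta> * r = (q + 1/q) * r" using r(1) r0 unfolding q_def by (simp add: field_simps power2_eq_square)
  then have bq: "\<beta> = q + 1/q" using r0 by simp
  have q2: "q^2 \<noteq> 1"
  proof
    assume "q^2 = 1"
    then have "q = 1 \<or> q = -1" by (simp add: power2_eq_1_iff)
    then show False using bq \<beta> by auto
  qed
  obtain k where qf: "qform q k" using qform_exists[OF q0 q2 bq] by blast
  have x: "x i = x 1 / q^(i-1)" if i: "1 \<le> i" "i \<le> d" for i
    using r(2)[OF i] unfolding rq by (simp add: power_divide)
  have "(t - q) * (t - 1/q) = t^2 - \<beta> * t + 1" unfolding bq using q0 by (simp add: field_simps power2_eq_square)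
  also have "\<dots> = 0" by (rule t(1))
  finally have "t = q \<or> t = 1/q" by simp
  then show ?thesis
  proof
    assume tq: "t = q"
    have y: "y i = y 1 * q^(i-1)" if i: "1 \<le> i" "i \<le> d" for i using t(2)[OF i] unfolding tq .
    show ?thesis using family_LT_fits[OF root qf x y] by blast
  next
    assume tq: "t = 1/q"
    have y: "y i = y 1 / q^(i-1)" if i: "1 \<le> i" "i \<le> d" for i
      using t(2)[OF i] unfolding tq by (simp add: power_divide)
    show ?thesis
    proof (cases "x 1 = y 1")
      case True
      show ?thesis using family_E_fits[OF root qf x y True] by blast
    next
      case False
      show ?thesis using family_C_fits[OF root qf x y False] by blast
    qed
  qed
qed

end

section \<open>From the fitted scalars back to the matrices\<close>

theorem theorem1p17:
  fixes A As :: "'a::alg_closed_field mat" and d :: nat and \<beta> :: 'a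
  assumes "d \<ge> 3"
    and "A \<in> carrier_mat (d+1) (d+1)" and "As \<in> carrier_mat (d+1) (d+1)"
    and "zero_diag_TD_TD_pair d A As"
    and "leonard_pair d A As"
    and "fundamental_parameter d A As \<beta>"
  shows "(\<beta> = 2 \<longrightarrow> (\<exists>\<xi> \<xi>s. \<xi> \<noteq> 0 \<and> \<xi>s \<noteq> 0 \<and>
            (\<exists>BB. family_K d BB \<and> diag_equiv d (\<xi> \<cdot>\<^sub>m A, \<xi>s \<cdot>\<^sub>m As) BB)))
       \<and> (\<beta> = -2 \<longrightarrow> (\<exists>\<xi> \<xi>s. \<xi> \<noteq> 0 \<and> \<xi>s \<noteq> 0 \<and>
            (\<exists>BB. family_BI d BB \<and> diag_equiv d (\<xi> \<cdot>\<^sub>m A, \<xi>s \<cdot>\<^sub>m As) BB)))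
       \<and> (\<beta> \<noteq> 2 \<and> \<beta> \<noteq> -2 \<longrightarrow> (\<exists>\<xi> \<xi>s. \<xi> \<noteq> 0 \<and> \<xi>s \<noteq> 0 \<and>
            (\<exists>BB. (family_C d BB \<or> family_LT d BB \<or> family_E d BB) \<and>
               (diag_equiv d (\<xi> \<cdot>\<^sub>m A, \<xi>s \<cdot>\<^sub>m As) BB \<or>
                diag_equiv d (antidiag_transpose_pair d (\<xi> \<cdot>\<^sub>m A, \<xi>s \<cdot>\<^sub>m As)) BB))))"
proof -
  have A: "zero_diag_TD d A" and B: "zero_diag_TD d As"
    using assms(4) by (auto simp: zero_diag_TD_TD_pair_def)
  obtain E Es th ths where L: "leonard_system d A E As Es th ths"
    and ratio: "\<And>i. 2 \<le> i \<Longrightarrow> i \<le> d - 1 \<Longrightarrow> (th (i-2) - th (i+1)) / (th (i-1) - th i) = \<beta> + 1"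
    using assms(6) unfolding fundamental_parameter_def by blast
  obtain P Q Ps Qs where P: "eigform d A As th P Q" and Ps: "eigform d As A ths Ps Qs"
    using leonard_system_eigform[OF L zero_diagD(1)[OF A] zero_diagD(1)[OF B]] by blast
  obtain \<rho> \<rho>s \<omega> c where T: "td_data d \<beta> \<rho> \<rho>s \<omega> c th ths (xr d A As) (yr d A As) (zr d A)"
    using pair_td_data[OF A B assms(1) P Ps ratio] by blast
  interpret td_data d \<beta> \<rho> \<rho>s \<omega> c th ths "xr d A As" "yr d A As" "zr d A" by (rule T)
  \<comment> \<open>Algebraic closure provides the square root that defines s in the families K, C,
    LT and E.\<close>
  have root: "\<exists>s. s^2 = a" for a :: 'a using nth_root_exists[of 2 a] by simp
  have equiv: "diag_equiv d (\<xi> \<cdot>\<^sub>m A, \<xi>s \<cdot>\<^sub>m As) (Tpair d X Y Z)" if "fits \<xi> \<xi>s X Y Z" for \<xi> \<xi>s X Y Z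
    by (rule diag_equiv_Tpair[OF A B]) (use that in \<open>auto simp: fits_def\<close>)
  have nz: "\<xi> \<noteq> 0 \<and> \<xi>s \<noteq> 0" if "fits \<xi> \<xi>s X Y Z" for \<xi> \<xi>s X Y Z
    using that by (simp add: fits_def)
  show ?thesis
  proof (intro conjI impI)
    assume "\<beta> = 2"
    then obtain \<xi> \<xi>s X Y Z where F: "fits \<xi> \<xi>s X Y Z" and fam: "family_K d (Tpair d X Y Z)"
      using family_K_fits[OF root] by blast
    show "\<exists>\<xi> \<xi>s. \<xi> \<noteq> 0 \<and> \<xi>s \<noteq> 0 \<and> (\<exists>BB. family_K d BB \<and> diag_equiv d (\<xi> \<cdot>\<^sub>m A, \<xi>s \<cdot>\<^sub>m As) BB)"
      using fam equiv[OF F] nz[OF F] by blast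
  next
    assume "\<beta> = -2"
    then obtain \<xi> \<xi>s X Y Z where F: "fits \<xi> \<xi>s X Y Z" and fam: "family_BI d (Tpair d X Y Z)"
      using family_BI_fits by blast
    show "\<exists>\<xi> \<xi>s. \<xi> \<noteq> 0 \<and> \<xi>s \<noteq> 0 \<and> (\<exists>BB. family_BI d BB \<and> diag_equiv d (\<xi> \<cdot>\<^sub>m A, \<xi>s \<cdot>\<^sub>m As) BB)"
      using fam equiv[OF F] nz[OF F] by blast
  next
    assume "\<beta> \<noteq> 2 \<and> \<beta> \<noteq> - 2"
    then obtain \<xi> \<xi>s X Y Z where F: "fits \<xi> \<xi>s X Y Z"
      and fam: "family_C d (Tpair d X Y Z) \<or> family_LT d (Tpair d X Y Z) \<or> family_E d (Tpair d X Y Z)"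
      using generic_fits[OF root] by blast
    show "\<exists>\<xi> \<xi>s. \<xi> \<noteq> 0 \<and> \<xi>s \<noteq> 0 \<and> (\<exists>BB. (family_C d BB \<or> family_LT d BB \<or> family_E d BB) \<and>
               (diag_equiv d (\<xi> \<cdot>\<^sub>m A, \<xi>s \<cdot>\<^sub>m As) BB \<or>
                diag_equiv d (antidiag_transpose_pair d (\<xi> \<cdot>\<^sub>m A, \<xi>s \<cdot>\<^sub>m As)) BB))"
      using fam equiv[OF F] nz[OF F] by blast
  qed
qed

end
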